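(* Let $X\subset\mathbb{R}^m$ be a closed semialgebraic set of dimension $k$. Then there is a bi-Lipschitz and semialgebraic embedding of $X$ into $\mathbb{R}^{2k+1}$.
   Context: Subsets of Euclidean spaces carry the outer metric, i.e. the restriction of the Euclidean distance of the ambient space. A bi-Lipschitz embedding of a closed set $X\subset\mathbb{R}^m$ into $\mathbb{R}^n$ is a map $f:X\to\mathbb{R}^n$ such that $f(X)$ is a closed subset of $\mathbb{R}^n$ and $f:X\to f(X)$ is a bijection with both $f$ and $f^{-1}$ Lipschitz (for the outer metrics). It is a semialgebraic embedding if moreover $X$, $f(X)$ and the maps $f$, $f^{-1}$ are semialgebraic. *)

theory Defs
  imports "HOL-Analysis.Analysis" "HOL-Algebra.Ideal"
begin

(* On a Euclidean space, real_polynomial_function describes the polynomials in the coordinates. *)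
inductive semialgebraic :: "'a::euclidean_space set \<Rightarrow> bool" where
  pos: "real_polynomial_function p \<Longrightarrow> semialgebraic {x. p x > 0}"
| compl: "semialgebraic S \<Longrightarrow> semialgebraic (- S)"
| un: "semialgebraic S \<Longrightarrow> semialgebraic T \<Longrightarrow> semialgebraic (S \<union> T)"
| inter: "semialgebraic S \<Longrightarrow> semialgebraic T \<Longrightarrow> semialgebraic (S \<inter> T)"

definition semialgebraic_map_on ::
  "'a::euclidean_space set \<Rightarrow> ('a \<Rightarrow> 'b::euclidean_space) \<Rightarrow> bool" where
  "semialgebraic_map_on X f \<longleftrightarrow> semialgebraic {(x, f x) |x. x \<in> X}"

(* The supremum is taken in the extended reals, so the zero ring has dimension -\<infinity>. *)
definition krull_dim :: "('a, 'b) ring_scheme \<Rightarrow> ereal" where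
  "krull_dim R =
    (SUP n \<in> {n::nat. \<exists>P. (\<forall>i\<le>n. primeideal (P i) R) \<and> (\<forall>i<n. P i \<subset> P (Suc i))}. ereal (real n))"

(* The ring of polynomial functions on A, that is R[x_1, ..., x_m] / I(A) with I(A) the ideal of
   polynomials vanishing on A. Its elements are functions restricted to A (undefined outside A),
   so that two polynomials are identified exactly if they agree on A. *)
definition polynomial_function_ring :: "'a::euclidean_space set \<Rightarrow> ('a \<Rightarrow> real) ring" where
  "polynomial_function_ring A =
    \<lparr>carrier = {restrict p A |p. real_polynomial_function p},
     mult = (\<lambda>f g. \<lambda>x\<in>A. f x * g x),
     one = (\<lambda>x\<in>A. 1),
     zero = (\<lambda>x\<in>A. 0),
     add = (\<lambda>f g. \<lambda>x\<in>A. f x + g x)\<rparr>"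

lemma cring_polynomial_function_ring: "cring (polynomial_function_ring A)"
proof (rule cringI)
  show "abelian_group (polynomial_function_ring A)"
  proof (rule abelian_groupI)
    fix f assume "f \<in> carrier (polynomial_function_ring A)"
    then obtain p where p: "real_polynomial_function p" "f = restrict p A"
      by (auto simp: polynomial_function_ring_def)
    have "real_polynomial_function (\<lambda>x. - p x)"
      using p(1) by (rule real_polynomial_function_minus)
    then show "\<exists>g\<in>carrier (polynomial_function_ring A).
        g \<oplus>\<^bsub>polynomial_function_ring A\<^esub> f = \<zero>\<^bsub>polynomial_function_ring A\<^esub>"
      using p(2) by (intro bexI[of _ "\<lambda>x\<in>A. - p x"])
        (auto simp: polynomial_function_ring_def restrict_def fun_eq_iff)
  next
    fix f g
    assume "f \<in> carrier (polynomial_function_ring A)" "g \<in> carrier (polynomial_function_ring A)"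
    then obtain p q where "real_polynomial_function p" "f = restrict p A"
        "real_polynomial_function q" "g = restrict q A"
      by (auto simp: polynomial_function_ring_def)
    then show "f \<oplus>\<^bsub>polynomial_function_ring A\<^esub> g \<in> carrier (polynomial_function_ring A)"
      by (auto simp: polynomial_function_ring_def restrict_def fun_eq_iff
          intro!: exI[of _ "\<lambda>x. p x + q x"] real_polynomial_function.intros(3))
  qed (auto simp: polynomial_function_ring_def restrict_def fun_eq_iff
      intro!: exI[of _ "\<lambda>x. 0"] real_polynomial_function.intros(2))
  show "comm_monoid (polynomial_function_ring A)"
  proof (rule comm_monoidI)
    fix f g
    assume "f \<in> carrier (polynomial_function_ring A)" "g \<in> carrier (polynomial_function_ring A)"
    then obtain p q where "real_polynomial_function p" "f = restrict p A"
        "real_polynomial_function q" "g = restrict q A"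
      by (auto simp: polynomial_function_ring_def)
    then show "f \<otimes>\<^bsub>polynomial_function_ring A\<^esub> g \<in> carrier (polynomial_function_ring A)"
      by (auto simp: polynomial_function_ring_def restrict_def fun_eq_iff
          intro!: exI[of _ "\<lambda>x. p x * q x"] real_polynomial_function.intros(4))
  qed (auto simp: polynomial_function_ring_def restrict_def fun_eq_iff
      intro!: exI[of _ "\<lambda>x. 1"] real_polynomial_function.intros(2))
qed (auto simp: polynomial_function_ring_def restrict_def fun_eq_iff algebra_simps)

(* Bochnak-Coste-Roy, Real Algebraic Geometry, Section 2.8. *)
definition semialgebraic_dim :: "'a::euclidean_space set \<Rightarrow> ereal" where
  "semialgebraic_dim A = krull_dim (polynomial_function_ring A)"

definition bilipschitz_embedding_on ::
  "'a::euclidean_space set \<Rightarrow> ('a \<Rightarrow> 'b::euclidean_space) \<Rightarrow> bool" where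
  "bilipschitz_embedding_on X f \<longleftrightarrow>
     closed (f ` X) \<and> bij_betw f X (f ` X) \<and>
     (\<exists>L. L-lipschitz_on X f) \<and> (\<exists>L. L-lipschitz_on (f ` X) (inv_into X f))"

definition semialgebraic_embedding_on ::
  "'a::euclidean_space set \<Rightarrow> ('a \<Rightarrow> 'b::euclidean_space) \<Rightarrow> bool" where
  "semialgebraic_embedding_on X f \<longleftrightarrow>
     bilipschitz_embedding_on X f \<and> semialgebraic X \<and> semialgebraic (f ` X) \<and>
     semialgebraic_map_on X f \<and> semialgebraic_map_on (f ` X) (inv_into X f)"

end

theory Submission
  imports Defs
begin

text \<open>The embedding is the restriction to \<open>X\<close> of a linear map \<open>f\<close>. For such a map to be bi-Lipschitz on \<open>X\<close>
it suffices that \<open>c * norm (x - y) \<le> norm (f x - f y)\<close> for \<open>x\<close>, \<open>y\<close> in \<open>X\<close> and some \<open>c > 0\<close>. Then the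
image is closed because \<open>X\<close> is complete, the graphs of \<open>f\<close> and of its inverse are cut out of products
by polynomial equations, and \<open>f ` X\<close> is semialgebraic by the theorem of Tarski and Seidenberg.

The classical reason why \<open>f\<close> exists is that the directions of the secants of \<open>X\<close> form a set of dimension
at most \<open>2 * k\<close>, so that one can project along a direction that stays away from them as long as the space has
dimension at least \<open>2 * k + 2\<close>. Here dimensions of semialgebraic sets are replaced by counting monomials.
Let \<open>L\<close> be a linear map with image of dimension \<open>n \<ge> 2 * k + 2\<close>. The number of monomials of degree \<open>N\<close> in the
\<open>n\<close> coordinates of \<open>L x - L y\<close> grows like \<open>N ^ (n - 1)\<close>, whereas as functions of \<open>x\<close> and \<open>y\<close>
in \<open>X\<close> they lie in a space of dimension \<open>O(N ^ (2 * k))\<close>, since the monomials of degree at most \<open>N\<close> restricted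
to \<open>X\<close> span a space of dimension \<open>O(N ^ k)\<close> (\<open>monomial_growth_exists\<close>). Hence a nonzero form \<open>G\<close>
vanishes on all \<open>L x - L y\<close> (\<open>secant_form\<close>). Projecting along a vector \<open>v\<close> with \<open>G v \<noteq> 0\<close> loses only a
constant factor on the zero cone of \<open>G\<close>, by compactness of its unit vectors (\<open>secant_projection\<close>), and lowers
the dimension by one.

The growth estimate needs, for every set \<open>J\<close> of \<open>k + 1\<close> coordinates, a nonzero polynomial in these
coordinates that vanishes on \<open>X\<close> (\<open>algebraic_relation\<close>). A weight that separates the occurring monomials gives each
of these relations a leading monomial, and the monomials divisible by none of them, of which there are few, span the
rest. The relation is obtained as follows. The projection of \<open>X\<close> to the coordinates in \<open>J\<close> is semialgebraic
by Tarski-Seidenberg, and every semialgebraic set has its frontier inside the zero set of a nonzero polynomial. So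
the projection either satisfies a polynomial equation or contains a box. In the second case there is a chain of
\<open>k + 2\<close> prime ideals, which contradicts the Krull dimension (\<open>krull_dim_polynomial_function_ring_ge\<close>):
take preimages of the points of the box in a compact part of \<open>X\<close>, let the last parameters tend to zero along an
ultrafilter, one after the other, and consider the polynomials that vanish for almost all values of the
remaining parameters. Limits along an ultrafilter exist by compactness alone, so no regularity of the choice of
preimages is required.

The theorem of Tarski and Seidenberg (\<open>tarski_seidenberg\<close>) is proved by the method of Cohen and Hoermander: for a
family of polynomials in one variable that is closed under derivatives and pseudo-remainders, the signs of the
leading coefficients determine all sign patterns along the line.\<close>

section \<open>Semialgebraic sets\<close>

lemma semialgebraic_UNIV: "semialgebraic UNIV"
proof -
  have "semialgebraic {x::'a. (\<lambda>x. 1::real) x > 0}" by (intro semialgebraic.pos) auto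
  then show ?thesis by simp
qed

lemma semialgebraic_empty: "semialgebraic {}"
  using semialgebraic.compl[OF semialgebraic_UNIV] by simp

lemma semialgebraic_zero_set:
  assumes "real_polynomial_function p"
  shows "semialgebraic {x. p x = 0}"
proof -
  have "{x. p x = 0} = - {x. p x > 0} \<inter> - {x. - p x > 0}" by auto
  then show ?thesis
    using assms by (simp only:) (intro semialgebraic.intros real_polynomial_function_minus)
qed

lemma semialgebraic_sign_set:
  assumes "real_polynomial_function p"
  shows "semialgebraic {x. sgn (p x) = s}"
proof -
  have m: "semialgebraic {x. - p x > 0}"
    using assms by (intro semialgebraic.pos) auto
  consider "s = 1" | "s = 0" | "s = -1" | "s \<noteq> 1" "s \<noteq> 0" "s \<noteq> -1" by blast
  then show ?thesis
  proof cases
    case 1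
    then have "{x. sgn (p x) = s} = {x. p x > 0}" by (auto simp: sgn_if)
    then show ?thesis using assms by (auto intro: semialgebraic.pos)
  next
    case 2
    then have "{x. sgn (p x) = s} = {x. p x = 0}" by (auto simp: sgn_if)
    then show ?thesis using semialgebraic_zero_set[OF assms] by simp
  next
    case 3
    then have "{x. sgn (p x) = s} = {x. - p x > 0}" by (auto simp: sgn_if)
    then show ?thesis using m by simp
  next
    case 4
    then have "{x. sgn (p x) = s} = {}" by (auto simp: sgn_if)
    then show ?thesis by (simp add: semialgebraic_empty)
  qed
qed

lemma semialgebraic_INT:
  "finite I \<Longrightarrow> (\<And>i. i \<in> I \<Longrightarrow> semialgebraic (S i)) \<Longrightarrow> semialgebraic (\<Inter>i\<in>I. S i)"
  by (induction rule: finite_induct) (auto intro: semialgebraic_UNIV semialgebraic.inter)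

lemma semialgebraic_UN:
  "finite I \<Longrightarrow> (\<And>i. i \<in> I \<Longrightarrow> semialgebraic (S i)) \<Longrightarrow> semialgebraic (\<Union>i\<in>I. S i)"
  by (induction rule: finite_induct) (auto intro: semialgebraic_empty semialgebraic.un)

lemma semialgebraic_vimage:
  assumes "semialgebraic S" "polynomial_function g"
  shows "semialgebraic (g -` S)"
  using assms(1)
proof induction
  case (pos p)
  show ?case
    using semialgebraic.pos[OF real_polynomial_function_compose[OF assms(2) pos]] by (simp add: vimage_def)
qed (auto simp: vimage_Compl intro: semialgebraic.intros)

section \<open>Sign diagrams of families of real polynomials\<close>

text \<open>The polynomials \<open>P i\<close> with \<open>i\<close> in \<open>I\<close> cut the half-line to the right of \<open>a\<close> into finitely many open intervals and points
on which all their signs are constant. In \<open>cells I P a M\<close> the list \<open>M\<close> records these signs from left to right: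
entries at even positions (counted from 0) belong to intervals, those at odd positions to points. Taking \<open>a\<close> as an
extended real makes the whole line the case \<open>a = -\<infinity>\<close>. The values of an entry outside \<open>I\<close> are irrelevant.\<close>

inductive cells :: "'i set \<Rightarrow> ('i \<Rightarrow> real poly) \<Rightarrow> ereal \<Rightarrow> ('i \<Rightarrow> real) list \<Rightarrow> bool"
  for I :: "'i set" and P :: "'i \<Rightarrow> real poly" where
  last: "(\<And>t i. a < ereal t \<Longrightarrow> i \<in> I \<Longrightarrow> sgn (poly (P i) t) = \<sigma> i) \<Longrightarrow> a < \<infinity> \<Longrightarrow> cells I P a [\<sigma>]"
| step: "a < ereal r \<Longrightarrow> (\<And>t i. a < ereal t \<Longrightarrow> t < r \<Longrightarrow> i \<in> I \<Longrightarrow> sgn (poly (P i) t) = \<sigma> i) \<Longrightarrow>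
    (\<And>i. i \<in> I \<Longrightarrow> sgn (poly (P i) r) = \<tau> i) \<Longrightarrow> cells I P (ereal r) M \<Longrightarrow> cells I P a (\<sigma> # \<tau> # M)"

lemma cells_sound:
  assumes "cells I P a M" "\<sigma> \<in> set M"
  shows "\<exists>t. \<forall>i\<in>I. sgn (poly (P i) t) = \<sigma> i"
  using assms
proof (induction)
  case (last a \<sigma>')
  then obtain t where "a < ereal t" using ereal_dense2[OF last(2)] by auto
  then show ?case using last by auto
next
  case (step a r \<sigma>' \<tau> M)
  obtain t where "a < ereal t" "t < r" 
    using ereal_dense2[OF step(1)] by auto
  then show ?case using step by auto
qed

lemma cells_complete:
  assumes "cells I P a M" "a < ereal t"
  shows "\<exists>\<sigma>\<in>set M. \<forall>i\<in>I. sgn (poly (P i) t) = \<sigma> i"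
  using assms
proof (induction)
  case (last a \<sigma>')
  then show ?case by simp
next
  case (step a r \<sigma>' \<tau> M)
  consider "t < r" | "t = r" | "r < t" by linarith
  then show ?case
  proof cases
    case 1
    show ?thesis using step(2)[OF step.prems 1] by simp
  next
    case 2
    then show ?thesis using step(3) by simp
  next
    case 3
    then obtain \<sigma> where "\<sigma> \<in> set M" "\<forall>i\<in>I. sgn (poly (P i) t) = \<sigma> i" using step.IH by auto
    then show ?thesis by (intro bexI[of _ \<sigma>]) simp_all
  qed
qed

text \<open>A polynomial whose sign is a function of the signs of the others can be added without subdividing.\<close>

lemma cells_map:
  assumes "cells I P a M"
    and "\<And>\<sigma> t. (\<forall>i\<in>I. sgn (poly (P i) t) = \<sigma> i) \<Longrightarrow> sgn (poly (P p) t) = \<kappa> \<sigma>"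
    and "p \<notin> I"
  shows "cells (insert p I) P a (map (\<lambda>\<sigma>. \<sigma>(p := \<kappa> \<sigma>)) M)"
  using assms(1)
proof induction
  case (last a \<sigma>)
  then show ?case using assms(2,3) by (auto intro!: cells.last)
next
  case (step a r \<sigma> \<tau> M)
  have "cells (insert p I) P a ((\<sigma>(p := \<kappa> \<sigma>)) # (\<tau>(p := \<kappa> \<tau>)) # map (\<lambda>\<sigma>. \<sigma>(p := \<kappa> \<sigma>)) M)"
    by (rule cells.step[OF step(1) _ _ step.IH]) (use step(2,3) assms(2,3) in auto)
  then show ?case by (simp only: list.map)
qed

text \<open>The sign of a polynomial at an end of an interval. At an infinite end this is the sign that it has eventually, which
is required to be nonzero.\<close>

definition left_sign :: "real poly \<Rightarrow> ereal \<Rightarrow> real \<Rightarrow> bool" where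
  "left_sign p a s \<longleftrightarrow> (if a = -\<infinity> then s \<noteq> 0 \<and> (\<exists>b. \<forall>t<b. sgn (poly p t) = s) else sgn (poly p (real_of_ereal a)) = s)"

definition right_sign :: "real poly \<Rightarrow> ereal \<Rightarrow> real \<Rightarrow> bool" where
  "right_sign p a s \<longleftrightarrow> (if a = \<infinity> then s \<noteq> 0 \<and> (\<exists>b. \<forall>t>b. sgn (poly p t) = s) else sgn (poly p (real_of_ereal a)) = s)"

text \<open>Between consecutive zeros the sign is constant, by the intermediate value theorem.\<close>

lemma poly_sgn_constant:
  fixes a b :: ereal
  assumes "\<And>t. a < ereal t \<Longrightarrow> ereal t < b \<Longrightarrow> poly p t \<noteq> 0" "a < b"
  obtains u where "u = 1 \<or> u = -1" "\<And>t. a < ereal t \<Longrightarrow> ereal t < b \<Longrightarrow> sgn (poly p t) = u"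
proof -
  obtain c where c: "a < ereal c" "ereal c < b" using ereal_dense2[OF assms(2)] by auto
  show ?thesis
  proof (rule that[of "sgn (poly p c)"])
    show "sgn (poly p c) = 1 \<or> sgn (poly p c) = - 1"
      using assms(1)[OF c] by (auto simp: sgn_if)
    fix t assume t: "a < ereal t" "ereal t < b"
    show "sgn (poly p t) = sgn (poly p c)"
    proof (rule ccontr)
      assume "sgn (poly p t) \<noteq> sgn (poly p c)"
      then have neg: "poly p t * poly p c < 0"
        using assms(1)[OF c] assms(1)[OF t] by (auto simp: sgn_if mult_less_0_iff split: if_splits)
      then have "t \<noteq> c" using not_square_less_zero by auto
      then obtain x where x: "min t c < x" "x < max t c" "poly p x = 0"
        using neg poly_IVT[of t c p] poly_IVT[of c t p]
        by (cases t c rule: linorder_cases) (auto simp: mult.commute)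
      have "a < ereal x" "ereal x < b"
        using x(1,2) t c by (auto simp: min_def max_def split: if_splits intro: less_trans)
           (meson ereal_less_le less_ereal.simps(1) less_trans order_less_trans)+
      then show False using assms(1) x(3) by auto
    qed
  qed
qed

lemma left_sign_cases:
  assumes "left_sign p a s" "a < b" "u = 1 \<or> u = (-1::real)"
    "\<And>t. a < ereal t \<Longrightarrow> ereal t < b \<Longrightarrow> sgn (poly p t) = u"
  shows "s = u \<or> (s = 0 \<and> a \<noteq> -\<infinity> \<and> poly p (real_of_ereal a) = 0)"
proof (cases "a = -\<infinity>")
  case True
  obtain c where c: "\<forall>t<c. sgn (poly p t) = s" using assms(1) True by (auto simp: left_sign_def)
  obtain d where d: "ereal d < b" using ereal_dense2[OF assms(2)] by auto
  define t where "t = min (c - 1) d"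
  have "ereal t \<le> ereal d" by (simp add: t_def)
  then have "ereal t < b" using d by (rule le_less_trans)
  then have "sgn (poly p t) = u" using assms(4)[of t] True by auto
  then show ?thesis using c by (auto simp: t_def)
next
  case False
  then obtain r where r: "a = ereal r" using assms(2) by (cases a) auto
  show ?thesis
  proof (rule ccontr)
    assume n: "\<not> ?thesis"
    have s: "s = sgn (poly p r)" using assms(1) r by (auto simp: left_sign_def)
    then have nz: "poly p r \<noteq> 0" using n r by auto
    have su: "sgn (poly p r) \<noteq> u" using n s by auto
    obtain c where c: "r < c" "ereal c < b" using ereal_dense2[OF assms(2)] r by auto
    then have "sgn (poly p c) = u" using assms(4) r by auto
    then have "poly p r * poly p c < 0" using su nz assms(3)
      by (auto simp: sgn_if mult_less_0_iff split: if_splits)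
    then obtain x where x: "r < x" "x < c" "poly p x = 0" using poly_IVT c by blast
    then have "sgn (poly p x) = u" using assms(4)[of x] r c(2) less_trans[of "ereal x" "ereal c" b] by auto
    then show False using x assms(3) by auto
  qed
qed

lemma right_sign_cases:
  assumes "right_sign p b s" "a < b" "u = 1 \<or> u = (-1::real)"
    "\<And>t. a < ereal t \<Longrightarrow> ereal t < b \<Longrightarrow> sgn (poly p t) = u"
  shows "s = u \<or> (s = 0 \<and> b \<noteq> \<infinity> \<and> poly p (real_of_ereal b) = 0)"
proof -
  define q where "q = pcompose p [:0,-1:]"
  have q: "poly q t = poly p (-t)" for t by (simp add: q_def poly_pcompose)
  have "left_sign q (-b) s"
  proof (cases "b = \<infinity>")
    case True
    then obtain c where c: "s \<noteq> 0" "\<forall>t>c. sgn (poly p t) = s" using assms(1) by (auto simp: right_sign_def)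
    then have "\<forall>t. t < - c \<longrightarrow> sgn (poly q t) = s" by (simp add: q)
    then show ?thesis using True c(1) unfolding left_sign_def by auto
  qed (use assms(1) in \<open>auto simp: left_sign_def right_sign_def q ereal_uminus_eq_reorder\<close>)
  moreover have "- b < - a" using assms(2) by simp
  ultimately have "s = u \<or> (s = 0 \<and> -b \<noteq> -\<infinity> \<and> poly q (real_of_ereal (-b)) = 0)"
  proof (rule left_sign_cases[OF _ _ assms(3)])
    fix t assume t: "- b < ereal t" "ereal t < - a"
    have "a < ereal (- t)" "ereal (- t) < b" using t by (cases a; cases b; simp)+
    then show "sgn (poly q t) = u" unfolding q by (rule assms(4))
  qed
  then show ?thesis by (auto simp: q)
qed

text \<open>The entries that an interval with sign vector \<open>\<sigma>\<close> contributes after adding a polynomial \<open>p\<close> that is strictly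
monotone on it and has the signs \<open>s\<close> and \<open>s'\<close> at its ends. If these are opposite and nonzero, then \<open>p\<close> has exactly one zero
inside. Otherwise it has none, and its sign is the nonzero one of \<open>s\<close> and \<open>s'\<close>.\<close>

definition split_cell :: "'i \<Rightarrow> real \<Rightarrow> real \<Rightarrow> ('i \<Rightarrow> real) \<Rightarrow> ('i \<Rightarrow> real) list" where
  "split_cell p s s' \<sigma> = (if s * s' = -1 then [\<sigma>(p := s), \<sigma>(p := 0), \<sigma>(p := s')]
     else [\<sigma>(p := (if s = 0 then s' else s))])"

text \<open>If the derivative has no zero inside an interval, then the signs at the ends determine the signs inside.\<close>

lemma poly_interval_signs:
  fixes a b :: ereal
  assumes ab: "a < b" and l: "left_sign p a s" and r: "right_sign p b s'"
    and d: "\<And>t. a < ereal t \<Longrightarrow> ereal t < b \<Longrightarrow> poly (pderiv p) t \<noteq> 0"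
  obtains (no_zero) "s * s' \<noteq> -1"
      "\<And>t. a < ereal t \<Longrightarrow> ereal t < b \<Longrightarrow> sgn (poly p t) = (if s = 0 then s' else s)"
    | (zero) c where "s * s' = -1" "a < ereal c" "ereal c < b" "poly p c = 0"
      "\<And>t. a < ereal t \<Longrightarrow> t < c \<Longrightarrow> sgn (poly p t) = s"
      "\<And>t. c < t \<Longrightarrow> ereal t < b \<Longrightarrow> sgn (poly p t) = s'"
proof -
  \<comment> \<open>By Rolle, there are no two zeros in the closed interval.\<close>
  have rolle: False if xy: "a \<le> ereal x" "x < y" "ereal y \<le> b" "poly p x = 0" "poly p y = 0" for x y
  proof -
    obtain z where z: "x < z" "z < y" "poly p y - poly p x = (y - x) * poly (pderiv p) z"
      using poly_MVT[OF xy(2), of p] by blast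
    have "a < ereal z" "ereal z < b"
      using z xy(1,3) by (metis ereal_less_le le_less_trans less_ereal.simps(1) less_le_trans)+
    then show False using d z xy by auto
  qed
  show ?thesis
  proof (cases "\<exists>c. a < ereal c \<and> ereal c < b \<and> poly p c = 0")
    case True
    then obtain c where c: "a < ereal c" "ereal c < b" "poly p c = 0" by auto
    have n1: "poly p t \<noteq> 0" if "a < ereal t" "ereal t < ereal c" for t
      using rolle[of t c] that c less_imp_le[of a "ereal t"] less_imp_le[of "ereal c" b] by auto
    have n2: "poly p t \<noteq> 0" if "ereal c < ereal t" "ereal t < b" for t
      using rolle[of c t] that c less_imp_le[of a "ereal c"] less_imp_le[of "ereal t" b] by auto
    obtain u where u: "u = 1 \<or> u = -1" "\<And>t. a < ereal t \<Longrightarrow> ereal t < ereal c \<Longrightarrow> sgn (poly p t) = u"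
      using poly_sgn_constant[OF n1 c(1)] by metis
    obtain u' where u': "u' = 1 \<or> u' = -1" "\<And>t. ereal c < ereal t \<Longrightarrow> ereal t < b \<Longrightarrow> sgn (poly p t) = u'"
      using poly_sgn_constant[OF n2 c(2)] by metis
    have su: "s = u"
    proof -
      have "s = u \<or> (s = 0 \<and> a \<noteq> -\<infinity> \<and> poly p (real_of_ereal a) = 0)"
        using left_sign_cases[OF l c(1) u] .
      moreover have False if h: "a \<noteq> -\<infinity>" "poly p (real_of_ereal a) = 0"
      proof -
        obtain r where "a = ereal r" using h(1) c(1) by (cases a) auto
        then show False using rolle[of r c] h(2) c(1,3) less_imp_le[OF c(2)] by simp
      qed
      ultimately show ?thesis by blast
    qed
    have su': "s' = u'"
    proof -
      have "s' = u' \<or> (s' = 0 \<and> b \<noteq> \<infinity> \<and> poly p (real_of_ereal b) = 0)"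
        using right_sign_cases[OF r c(2) u'] .
      moreover have False if h: "b \<noteq> \<infinity>" "poly p (real_of_ereal b) = 0"
      proof -
        obtain r where "b = ereal r" using h(1) c(2) by (cases b) auto
        then show False using rolle[of c r] h(2) c(2,3) less_imp_le[OF c(1)] by simp
      qed
      ultimately show ?thesis by blast
    qed
    have "u \<noteq> u'"
    proof
      assume eq: "u = u'"
      \<comment> \<open>Equal signs on both sides make \<open>c\<close> a local extremum, so the derivative vanishes there.\<close>
      obtain x where x: "a < ereal x" "x < c" using ereal_dense2[OF c(1)] by auto
      obtain y where y: "c < y" "ereal y < b" using ereal_dense2[OF c(2)] by auto
      have dc: "(poly p has_real_derivative poly (pderiv p) c) (at c)" by (rule poly_DERIV)
      have e: "0 < min (c - x) (y - c)" using x y by auto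
      have near: "sgn (poly p t) = u" if "\<bar>c - t\<bar> < min (c - x) (y - c)" "t \<noteq> c" for t
      proof (cases "t < c")
        case True
        then have "x < t" using that by auto
        then show ?thesis using u(2)[of t] True x less_trans[of a "ereal x" "ereal t"] by auto
      next
        case False
        then have "c < t" "t < y" using that by auto
        then show ?thesis using u'(2)[of t] eq y less_trans[of "ereal t" "ereal y" b] by auto
      qed
      have "poly (pderiv p) c = 0"
      proof (cases "u = 1")
        case True
        have "\<forall>t. \<bar>c - t\<bar> < min (c - x) (y - c) \<longrightarrow> poly p c \<le> poly p t"
        proof (intro allI impI)
          fix t assume "\<bar>c - t\<bar> < min (c - x) (y - c)"
          then show "poly p c \<le> poly p t" using near[of t] c(3) True
            by (cases "t = c") (auto simp: sgn_if split: if_splits)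
        qed
        then show ?thesis using DERIV_local_min[OF dc e] by simp
      next
        case False
        then have um: "u = -1" using u by auto
        have "\<forall>t. \<bar>c - t\<bar> < min (c - x) (y - c) \<longrightarrow> poly p t \<le> poly p c"
        proof (intro allI impI)
          fix t assume "\<bar>c - t\<bar> < min (c - x) (y - c)"
          then show "poly p t \<le> poly p c" using near[of t] c(3) um
            by (cases "t = c") (auto simp: sgn_if split: if_splits)
        qed
        then show ?thesis using DERIV_local_max[OF dc e] by simp
      qed
      then show False using d c by auto
    qed
    then have "s * s' = -1" using u u' su su' by auto
    then show ?thesis using c u(2) u'(2) su su' by (intro zero[of c]) simp_all
  next
    case False
    then have n: "\<And>t. a < ereal t \<Longrightarrow> ereal t < b \<Longrightarrow> poly p t \<noteq> 0" by auto
    obtain u where u: "u = 1 \<or> u = -1" "\<And>t. a < ereal t \<Longrightarrow> ereal t < b \<Longrightarrow> sgn (poly p t) = u"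
      using poly_sgn_constant[OF n ab] by metis
    have 1: "s = u \<or> (s = 0 \<and> a \<noteq> -\<infinity> \<and> poly p (real_of_ereal a) = 0)"
      using left_sign_cases[OF l ab u] .
    have 2: "s' = u \<or> (s' = 0 \<and> b \<noteq> \<infinity> \<and> poly p (real_of_ereal b) = 0)"
      using right_sign_cases[OF r ab u] .
    have "s \<noteq> 0 \<or> s' \<noteq> 0"
    proof (rule ccontr)
      assume "\<not> (s \<noteq> 0 \<or> s' \<noteq> 0)"
      then have h: "a \<noteq> -\<infinity>" "poly p (real_of_ereal a) = 0" "b \<noteq> \<infinity>" "poly p (real_of_ereal b) = 0"
        using 1 2 u(1) by auto
      obtain x y where "a = ereal x" "b = ereal y" using h ab by (cases a; cases b) auto
      then show False using rolle[of x y] h(2,4) ab by simp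
    qed
    then have ueq: "u = (if s = 0 then s' else s)" using 1 2 by auto
    have ns: "s * s' \<noteq> -1" using 1 2 u(1) by auto
    show ?thesis by (rule no_zero[OF ns]) (simp only: u(2) ueq[symmetric])
  qed
qed

lemma split_cell_cells:
  assumes ab: "a < ereal b" and l: "left_sign (P p) a s" and r: "sgn (poly (P p) b) = s'"
    and d: "\<And>t. a < ereal t \<Longrightarrow> t < b \<Longrightarrow> poly (pderiv (P p)) t \<noteq> 0"
    and p: "p \<notin> I"
    and \<sigma>: "\<And>t i. a < ereal t \<Longrightarrow> t < b \<Longrightarrow> i \<in> I \<Longrightarrow> sgn (poly (P i) t) = \<sigma> i"
    and \<tau>: "\<And>i. i \<in> I \<Longrightarrow> sgn (poly (P i) b) = \<tau> i"
    and M: "cells (insert p I) P (ereal b) M"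
  shows "cells (insert p I) P a (split_cell p s s' \<sigma> @ \<tau>(p := s') # M)"
proof -
  have R: "right_sign (P p) (ereal b) s'" using r by (simp add: right_sign_def)
  show ?thesis
  proof (rule poly_interval_signs[OF ab l R])
    fix t assume "a < ereal t" "ereal t < ereal b"
    then show "poly (pderiv (P p)) t \<noteq> 0" using d by auto
  next
    assume "s * s' \<noteq> -1" and *: "\<And>t. a < ereal t \<Longrightarrow> ereal t < ereal b \<Longrightarrow> sgn (poly (P p) t) = (if s = 0 then s' else s)"
    then have eq: "split_cell p s s' \<sigma> = [\<sigma>(p := (if s = 0 then s' else s))]" by (simp add: split_cell_def)
    show ?thesis unfolding eq append.simps
      by (rule cells.step[OF ab _ _ M]) (use * \<sigma> \<tau> r p in auto)
  next
    fix c assume ss: "s * s' = -1" and c: "a < ereal c" "ereal c < ereal b" "poly (P p) c = 0"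
      and 1: "\<And>t. a < ereal t \<Longrightarrow> t < c \<Longrightarrow> sgn (poly (P p) t) = s"
      and 2: "\<And>t. c < t \<Longrightarrow> ereal t < ereal b \<Longrightarrow> sgn (poly (P p) t) = s'"
    have eq: "split_cell p s s' \<sigma> = [\<sigma>(p := s), \<sigma>(p := 0), \<sigma>(p := s')]" using ss by (simp add: split_cell_def)
    have ct: "a < ereal t" if "c < t" for t using that c(1) less_trans[of a "ereal c" "ereal t"] by auto
    have "cells (insert p I) P (ereal c) (\<sigma>(p := s') # \<tau>(p := s') # M)"
      by (rule cells.step[OF c(2) _ _ M]) (use 2 \<sigma> \<tau> r p ct in auto)
    then show ?thesis unfolding eq append.simps
      by (intro cells.step[OF c(1)]) (use 1 2 \<sigma> \<tau> r p c in auto)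
  qed
qed

lemma split_cell_last:
  assumes ab: "a < \<infinity>" and l: "left_sign (P p) a s" and R: "right_sign (P p) \<infinity> s'"
    and d: "\<And>t. a < ereal t \<Longrightarrow> poly (pderiv (P p)) t \<noteq> 0"
    and p: "p \<notin> I"
    and \<sigma>: "\<And>t i. a < ereal t \<Longrightarrow> i \<in> I \<Longrightarrow> sgn (poly (P i) t) = \<sigma> i"
  shows "cells (insert p I) P a (split_cell p s s' \<sigma>)"
proof (rule poly_interval_signs[OF ab l R])
  fix t assume "a < ereal t"
  then show "poly (pderiv (P p)) t \<noteq> 0" using d by auto
next
  assume "s * s' \<noteq> -1" and *: "\<And>t. a < ereal t \<Longrightarrow> ereal t < \<infinity> \<Longrightarrow> sgn (poly (P p) t) = (if s = 0 then s' else s)"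
  then have eq: "split_cell p s s' \<sigma> = [\<sigma>(p := (if s = 0 then s' else s))]" by (simp add: split_cell_def)
  show ?thesis unfolding eq
    by (rule cells.last) (use * \<sigma> p ab in auto)
next
  fix c assume ss: "s * s' = -1" and c: "a < ereal c" "ereal c < \<infinity>" "poly (P p) c = 0"
    and 1: "\<And>t. a < ereal t \<Longrightarrow> t < c \<Longrightarrow> sgn (poly (P p) t) = s"
    and 2: "\<And>t. c < t \<Longrightarrow> ereal t < \<infinity> \<Longrightarrow> sgn (poly (P p) t) = s'"
  have eq: "split_cell p s s' \<sigma> = [\<sigma>(p := s), \<sigma>(p := 0), \<sigma>(p := s')]" using ss by (simp add: split_cell_def)
  have ct: "a < ereal t" if "c < t" for t using that c(1) less_trans[of a "ereal c" "ereal t"] by auto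
  have "cells (insert p I) P (ereal c) [\<sigma>(p := s')]"
    by (rule cells.last) (use 2 \<sigma> p ct in auto)
  then show ?thesis unfolding eq append.simps
    by (intro cells.step[OF c(1)]) (use 1 2 \<sigma> p c in auto)
qed

text \<open>The sign diagram after adding \<open>p\<close>. Here \<open>g\<close> gives the sign of \<open>p\<close> at a point of the old diagram as a function of the
old signs there, \<open>s\<close> is the sign of \<open>p\<close> at the left end and \<open>s'\<close> its sign at \<open>\<infinity>\<close>. The result does not depend on the
polynomials themselves, only on these data.\<close>

fun insert_poly :: "'i \<Rightarrow> (('i \<Rightarrow> real) \<Rightarrow> real) \<Rightarrow> real \<Rightarrow> real \<Rightarrow> ('i \<Rightarrow> real) list \<Rightarrow> ('i \<Rightarrow> real) list" where
  "insert_poly p g s' s [] = []"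
| "insert_poly p g s' s [\<sigma>] = split_cell p s s' \<sigma>"
| "insert_poly p g s' s (\<sigma> # \<tau> # M) = split_cell p s (g \<tau>) \<sigma> @ \<tau>(p := g \<tau>) # insert_poly p g s' (g \<tau>) M"

text \<open>The entries of a sign diagram that belong to points, as opposed to open intervals.\<close>

fun point_columns :: "('i \<Rightarrow> real) list \<Rightarrow> ('i \<Rightarrow> real) list" where
  "point_columns (\<sigma> # \<tau> # M) = \<tau> # point_columns M"
| "point_columns _ = []"

lemma point_columns_map: "point_columns (map f M) = map f (point_columns M)"
  by (induction M rule: point_columns.induct) auto

lemma cells_insert_poly:
  assumes "cells I P a M" and "left_sign (P p) a s" and "right_sign (P p) \<infinity> s'" and p: "p \<notin> I"
    and "\<And>\<tau> t. \<tau> \<in> set (point_columns M) \<Longrightarrow> (\<forall>i\<in>I. sgn (poly (P i) t) = \<tau> i) \<Longrightarrow> sgn (poly (P p) t) = g \<tau>"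
    and q: "q \<in> I" "P q = pderiv (P p)" "P q \<noteq> 0"
  shows "cells (insert p I) P a (insert_poly p g s' s M)"
  using assms(1,2,5)
proof (induction arbitrary: s)
  case (last a \<sigma>)
  have "poly (pderiv (P p)) t \<noteq> 0" if t: "a < ereal t" for t
  proof
    assume 0: "poly (pderiv (P p)) t = 0"
    then have "\<sigma> q = 0" using last(1)[of t q] q t by auto
    then have "{t<..} \<subseteq> {x. poly (P q) x = 0}"
      using last(1)[of _ q] q(1) t less_trans[OF t] by (auto simp: sgn_0_0)
    then show False using poly_roots_finite[OF q(3)] finite_subset infinite_Ioi by blast
  qed
  then show ?case using last assms(3) p by (auto intro!: split_cell_last)
next
  case (step a r \<sigma> \<tau> M)
  \<comment> \<open>A zero of the derivative inside a cell would force it to vanish on the whole cell.\<close>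
  have d: "poly (pderiv (P p)) t \<noteq> 0" if t: "a < ereal t" "t < r" for t
  proof
    assume 0: "poly (pderiv (P p)) t = 0"
    then have "\<sigma> q = 0" using step(2)[of t q] q t by auto
    then have "{t<..<r} \<subseteq> {x. poly (P q) x = 0}"
      using step(2)[of _ q] q(1) t less_trans[OF t(1)] by (auto simp: sgn_0_0)
    then show False using poly_roots_finite[OF q(3)] finite_subset infinite_Ioo[OF t(2)] by blast
  qed
  have g: "sgn (poly (P p) r) = g \<tau>" using step.prems(2)[of \<tau> r] step(3) by auto
  have "cells (insert p I) P (ereal r) (insert_poly p g s' (g \<tau>) M)"
    using step.prems(2) g by (intro step.IH) (auto simp: left_sign_def)
  then show ?case using step d g p by (auto intro!: split_cell_cells)
qed

section \<open>Closed families of polynomials with parameters\<close>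

text \<open>A polynomial in one variable whose coefficients are polynomial functions of a parameter \<open>x\<close> is encoded as a pair of a
bound on its degree, the formal degree, and the function sending \<open>x\<close> to the specialised polynomial. The coefficient at
the formal degree, the formal leading coefficient, may vanish for some or all \<open>x\<close>.\<close>

definition param_poly :: "nat \<times> ('a::euclidean_space \<Rightarrow> real poly) \<Rightarrow> bool" where
  "param_poly p \<longleftrightarrow> (\<forall>x. degree (snd p x) \<le> fst p) \<and>
     (\<forall>i. real_polynomial_function (\<lambda>x. coeff (snd p x) i))"

definition formal_lc :: "nat \<times> ('a \<Rightarrow> real poly) \<Rightarrow> 'a \<Rightarrow> real" where
  "formal_lc p x = coeff (snd p x) (fst p)"

text \<open>Removing the formal leading term, and differentiating. Both lower the formal degree by one, in the sense of
truncated subtraction, and are used for positive formal degree only.\<close>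

definition truncation :: "nat \<times> ('a \<Rightarrow> real poly) \<Rightarrow> nat \<times> ('a \<Rightarrow> real poly)" where
  "truncation p = (fst p - 1, \<lambda>x. snd p x - monom (formal_lc p x) (fst p))"

definition param_deriv :: "nat \<times> ('a \<Rightarrow> real poly) \<Rightarrow> nat \<times> ('a \<Rightarrow> real poly)" where
  "param_deriv p = (fst p - 1, \<lambda>x. pderiv (snd p x))"

lemma degree_le_pred:
  fixes p :: "real poly"
  assumes "degree p \<le> d" "coeff p d = 0"
  shows "degree p \<le> d - 1"
proof (cases "p = 0")
  case False
  then have "degree p \<noteq> d" using assms by auto
  then show ?thesis using assms by simp
qed simp

lemma param_poly_truncation:
  assumes "param_poly p"
  shows "param_poly (truncation p)"
  unfolding param_poly_def
proof (intro conjI allI)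
  fix x
  show "degree (snd (truncation p) x) \<le> fst (truncation p)"
    unfolding truncation_def fst_conv snd_conv
  proof (rule degree_le_pred)
    show "degree (snd p x - monom (formal_lc p x) (fst p)) \<le> fst p"
      using assms by (intro degree_diff_le) (auto simp: param_poly_def degree_monom_le)
  qed (simp add: formal_lc_def)
next
  fix i
  show "real_polynomial_function (\<lambda>x. coeff (snd (truncation p) x) i)"
    using assms by (cases "i = fst p") (auto simp: param_poly_def truncation_def formal_lc_def)
qed

lemma poly_truncation: "formal_lc p x = 0 \<Longrightarrow> snd (truncation p) x = snd p x"
  by (simp add: truncation_def)

lemma param_poly_deriv:
  assumes "param_poly p"
  shows "param_poly (param_deriv p)"
  unfolding param_poly_def
proof (intro conjI allI)
  fix x
  show "degree (snd (param_deriv p) x) \<le> fst (param_deriv p)"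
    using assms by (simp add: param_deriv_def param_poly_def degree_pderiv diff_le_mono)
  fix i
  show "real_polynomial_function (\<lambda>x. coeff (snd (param_deriv p) x) i)"
    using assms by (auto simp: param_poly_def param_deriv_def coeff_pderiv)
qed

text \<open>A pseudo-remainder of \<open>p\<close> modulo \<open>q\<close>: each division step multiplies \<open>p\<close> by the square of the formal leading
coefficient of \<open>q\<close>, so where this coefficient is nonzero, the remainder has the same sign as \<open>p\<close> at every zero of \<open>q\<close>.\<close>

lemma pseudo_remainder_exists:
  fixes p q :: "nat \<times> ('a::euclidean_space \<Rightarrow> real poly)"
  assumes "param_poly p" "param_poly q" "fst q \<ge> 1"
  shows "\<exists>r. param_poly r \<and> fst r = fst q - 1 \<and>
    (\<forall>x t. formal_lc q x \<noteq> 0 \<longrightarrow> poly (snd q x) t = 0 \<longrightarrow> sgn (poly (snd r x) t) = sgn (poly (snd p x) t))"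
proof -
  obtain d P where p: "p = (d, P)" by (cases p)
  from assms(1) show ?thesis unfolding p
  proof (induction d arbitrary: P)
    case 0
    then show ?case by (intro exI[of _ "(fst q - 1, P)"]) (auto simp: param_poly_def)
  next
    case (Suc d)
    show ?case
    proof (cases "Suc d < fst q")
      case True
      have "degree (P x) \<le> fst q - 1" for x
        using Suc.prems True by (auto simp: param_poly_def dest: spec[of _ x])
      then show ?thesis using Suc.prems
        by (intro exI[of _ "(fst q - 1, P)"]) (simp add: param_poly_def)
    next
      case False
      let ?e = "fst q"
      define R where "R x = smult ((formal_lc q x)^2) (P x) -
        smult (formal_lc q x * coeff (P x) (Suc d)) (monom 1 (Suc d - ?e) * snd q x)" for x
      have dq: "degree (snd q x) \<le> ?e" and dP: "degree (P x) \<le> Suc d" for x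
        using assms(2) Suc.prems by (auto simp: param_poly_def)
      have dR: "degree (R x) \<le> d" for x
      proof -
        have "degree (R x) \<le> Suc d"
          unfolding R_def
        proof (intro degree_diff_le order_trans[OF degree_smult_le] dP)
          have "degree (monom 1 (Suc d - ?e) * snd q x) \<le> (Suc d - ?e) + ?e"
            by (intro order_trans[OF degree_mult_le] add_mono degree_monom_le dq)
          then show "degree (monom 1 (Suc d - ?e) * snd q x) \<le> Suc d" using False by simp
        qed
        moreover have "coeff (R x) (Suc d) = 0"
          using False by (simp add: R_def coeff_monom_mult formal_lc_def power2_eq_square)
        ultimately show ?thesis using degree_le_pred[of "R x" "Suc d"] by simp
      qed
      have lc: "real_polynomial_function (\<lambda>x. formal_lc q x)"
        using assms(2) by (simp add: param_poly_def formal_lc_def)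
      have cP: "real_polynomial_function (\<lambda>x. coeff (P x) i)" 
        and cq: "real_polynomial_function (\<lambda>x. coeff (snd q x) i)" for i
        using assms(2) Suc.prems by (auto simp: param_poly_def)
      have "real_polynomial_function (\<lambda>x. coeff (R x) i)" for i
      proof (cases "Suc d - ?e \<le> i")
        case True
        then show ?thesis unfolding R_def using lc cP cq
          by (auto simp: coeff_monom_mult intro!: real_polynomial_function_diff real_polynomial_function_power real_polynomial_function.intros(4))
      next
        case False
        then show ?thesis unfolding R_def using lc cP cq
          by (auto simp: coeff_monom_mult intro!: real_polynomial_function_diff real_polynomial_function_power real_polynomial_function.intros(4))
      qed
      then have "param_poly (d, R)" using dR by (simp add: param_poly_def)
      from Suc.IH[OF this] obtain r where r: "param_poly r" "fst r = ?e - 1"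
        "\<And>x t. formal_lc q x \<noteq> 0 \<Longrightarrow> poly (snd q x) t = 0 \<Longrightarrow> sgn (poly (snd r x) t) = sgn (poly (R x) t)"
        by auto
      show ?thesis
      proof (intro exI[of _ r] conjI allI impI)
        fix x t assume *: "formal_lc q x \<noteq> 0" "poly (snd q x) t = 0"
        then have "poly (R x) t = (formal_lc q x)^2 * poly (P x) t" by (simp add: R_def)
        moreover have "sgn ((formal_lc q x)^2) = 1" using * by (intro sgn_pos) simp
        ultimately show "sgn (poly (snd r x) t) = sgn (poly (snd (Suc d, P) x) t)"
          using r(3)[OF *] by (simp only: sgn_mult snd_conv mult_1_left)
      qed (use r in auto)
    qed
  qed
qed

text \<open>A fixed choice of such a pseudo-remainder.\<close>

definition pseudo_remainder :: "nat \<times> ('a::euclidean_space \<Rightarrow> real poly) \<Rightarrow> nat \<times> ('a \<Rightarrow> real poly) \<Rightarrow> nat \<times> ('a \<Rightarrow> real poly)" where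
  "pseudo_remainder p q = (SOME r. param_poly r \<and> fst r = fst q - 1 \<and>
    (\<forall>x t. formal_lc q x \<noteq> 0 \<longrightarrow> poly (snd q x) t = 0 \<longrightarrow> sgn (poly (snd r x) t) = sgn (poly (snd p x) t)))"

lemma pseudo_remainder:
  assumes "param_poly p" "param_poly q" "fst q \<ge> 1"
  shows "param_poly (pseudo_remainder p q)" "fst (pseudo_remainder p q) = fst q - 1"
    "formal_lc q x \<noteq> 0 \<Longrightarrow> poly (snd q x) t = 0 \<Longrightarrow> sgn (poly (snd (pseudo_remainder p q) x) t) = sgn (poly (snd p x) t)"
  using someI_ex[OF pseudo_remainder_exists[OF assms]] unfolding pseudo_remainder_def[symmetric] by auto

text \<open>Families closed under truncation, differentiation and pseudo-remainders. The result has
smaller formal degree than the divisor, or than the single argument.\<close>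

definition closed_family :: "(nat \<times> ('a::euclidean_space \<Rightarrow> real poly)) set \<Rightarrow> bool" where
  "closed_family B \<longleftrightarrow> finite B \<and> (\<forall>p\<in>B. param_poly p) \<and>
     (\<forall>p\<in>B. fst p \<ge> 1 \<longrightarrow> truncation p \<in> B \<and> param_deriv p \<in> B) \<and>
     (\<forall>p\<in>B. \<forall>q\<in>B. 1 \<le> fst q \<and> fst q \<le> fst p \<longrightarrow> pseudo_remainder p q \<in> B)"

text \<open>Closing a family, by induction on the degree. The set \<open>T\<close> holds polynomials of degree above \<open>d\<close>, which are not
themselves part of the family but have to be divided by its members.\<close>

lemma closed_family_exists_aux:
  assumes "finite T" "\<forall>p\<in>T. param_poly p \<and> d < fst p" "finite A" "\<forall>p\<in>A. param_poly p \<and> fst p \<le> d"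
  shows "\<exists>B. A \<subseteq> B \<and> finite B \<and> (\<forall>p\<in>B. param_poly p \<and> fst p \<le> d) \<and>
     (\<forall>p\<in>B. fst p \<ge> 1 \<longrightarrow> truncation p \<in> B \<and> param_deriv p \<in> B) \<and>
     (\<forall>p\<in>T \<union> B. \<forall>q\<in>B. 1 \<le> fst q \<and> fst q \<le> fst p \<longrightarrow> pseudo_remainder p q \<in> B)"
  using assms
proof (induction d arbitrary: T A)
  case 0
  then have "fst p = 0" if "p \<in> A" for p using that by simp
  then show ?case using 0 by (intro exI[of _ A]) simp
next
  case (Suc d)
  \<comment> \<open>The members of top degree; everything they generate together with \<open>T\<close> has lower degree.\<close>
  define U where "U = {p\<in>A. fst p = Suc d}"
  define A' where "A' = (A - U) \<union> truncation ` U \<union> param_deriv ` U \<union> (\<Union>q\<in>U. (\<lambda>p. pseudo_remainder p q) ` (T \<union> U))"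
  have U: "U \<subseteq> A" "finite U" using Suc.prems by (auto simp: U_def)
  have 1: "finite (T \<union> U)" "\<forall>p\<in>T \<union> U. param_poly p \<and> d < fst p" using Suc.prems U by (auto simp: U_def)
  have 2: "finite A'" using Suc.prems U by (auto simp: A'_def)
  have 3: "\<forall>p\<in>A'. param_poly p \<and> fst p \<le> d"
  proof
    fix p assume "p \<in> A'"
    then consider "p \<in> A - U" | q where "q \<in> U" "p = truncation q" | q where "q \<in> U" "p = param_deriv q"
      | q r where "q \<in> T \<union> U" "r \<in> U" "p = pseudo_remainder q r" unfolding A'_def by blast
    then show "param_poly p \<and> fst p \<le> d"
    proof cases
      case 1
      then have "param_poly p" "fst p \<le> Suc d" "fst p \<noteq> Suc d" using Suc.prems(4) by (auto simp: U_def)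
      then show ?thesis by simp
    next
      case 2
      then show ?thesis using Suc.prems(4) param_poly_truncation[of q] by (auto simp: U_def truncation_def)
    next
      case 3
      then show ?thesis using Suc.prems(4) param_poly_deriv[of q] by (auto simp: U_def param_deriv_def)
    next
      case 4
      have "param_poly q" "param_poly r" "fst r = Suc d" using 4 1 Suc.prems(4) by (auto simp: U_def)
      then show ?thesis using pseudo_remainder(1,2)[of q r] 4 by auto
    qed
  qed
  obtain B where B: "A' \<subseteq> B" "finite B" "\<forall>p\<in>B. param_poly p \<and> fst p \<le> d"
     "\<forall>p\<in>B. fst p \<ge> 1 \<longrightarrow> truncation p \<in> B \<and> param_deriv p \<in> B"
     "\<forall>p\<in>(T \<union> U) \<union> B. \<forall>q\<in>B. 1 \<le> fst q \<and> fst q \<le> fst p \<longrightarrow> pseudo_remainder p q \<in> B"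
    using Suc.IH[OF 1 2 3] by auto
  have UB: "truncation p \<in> B" "param_deriv p \<in> B" if "p \<in> U" for p
    using B(1) that unfolding A'_def by blast+
  have rB: "pseudo_remainder p q \<in> B" if "p \<in> T \<union> U" "q \<in> U" for p q
    using B(1) that unfolding A'_def by blast
  have AU: "A \<subseteq> B \<union> U" using B(1) unfolding A'_def by blast
  show ?case
  proof (intro exI[of _ "B \<union> U"] conjI ballI impI)
    show "A \<subseteq> B \<union> U" by (rule AU)
    show "finite (B \<union> U)" using B U by auto
  next
    fix p assume p: "p \<in> B \<union> U"
    show "param_poly p" "fst p \<le> Suc d" using p B(3) Suc.prems(4) U(1) le_SucI by blast+
    assume "1 \<le> fst p"
    then show "truncation p \<in> B \<union> U" "param_deriv p \<in> B \<union> U" using p B(4) UB by blast+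
  next
    fix p q assume p: "p \<in> T \<union> (B \<union> U)" and q: "q \<in> B \<union> U" and d: "1 \<le> fst q \<and> fst q \<le> fst p"
    show "pseudo_remainder p q \<in> B \<union> U"
    proof (cases "q \<in> B")
      case True
      then show ?thesis using B(5) p d by blast
    next
      case False
      then have qU: "q \<in> U" using q by simp
      then have "fst q = Suc d" by (simp add: U_def)
      then have "p \<notin> B" using d B(3) by fastforce
      then have "p \<in> T \<union> U" using p by simp
      then show ?thesis using rB qU by simp
    qed
  qed
qed

lemma closed_family_exists:
  assumes "finite A" "\<forall>p\<in>A. param_poly p"
  shows "\<exists>B. A \<subseteq> B \<and> closed_family B"
proof -
  have "\<exists>d. \<forall>p\<in>A. fst p \<le> d" using assms(1) by (intro exI[of _ "Max (insert 0 (fst ` A))"]) auto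
  then obtain d where d: "\<forall>p\<in>A. fst p \<le> d" by auto
  have "\<exists>B. A \<subseteq> B \<and> finite B \<and> (\<forall>p\<in>B. param_poly p \<and> fst p \<le> d) \<and>
     (\<forall>p\<in>B. fst p \<ge> 1 \<longrightarrow> truncation p \<in> B \<and> param_deriv p \<in> B) \<and>
     (\<forall>p\<in>{} \<union> B. \<forall>q\<in>B. 1 \<le> fst q \<and> fst q \<le> fst p \<longrightarrow> pseudo_remainder p q \<in> B)"
    by (rule closed_family_exists_aux) (use assms d in auto)
  then obtain B where B: "A \<subseteq> B" "finite B" "\<forall>p\<in>B. param_poly p \<and> fst p \<le> d"
     "\<forall>p\<in>B. fst p \<ge> 1 \<longrightarrow> truncation p \<in> B \<and> param_deriv p \<in> B"
     "\<forall>p\<in>{} \<union> B. \<forall>q\<in>B. 1 \<le> fst q \<and> fst q \<le> fst p \<longrightarrow> pseudo_remainder p q \<in> B" by blast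
  then have "closed_family B" unfolding closed_family_def by simp
  then show ?thesis using B(1) by blast
qed

lemma right_sign_infinity:
  assumes "degree p \<le> d" "coeff p d \<noteq> 0"
  shows "right_sign p \<infinity> (sgn (coeff p d))"
proof -
  have dp: "degree p = d" using assms by (simp add: le_antisym le_degree)
  have pos: "\<exists>b. \<forall>t>b. poly p t > 0" if "lead_coeff p > 0" for p :: "real poly"
    using poly_pinfty_gt_lc[OF that] that by (meson less_imp_le less_le_trans)
  have "\<exists>b. \<forall>t>b. sgn (poly p t) = sgn (coeff p d)"
  proof (cases "coeff p d > 0")
    case True
    then show ?thesis using pos[of p] dp by (auto simp: sgn_if)
  next
    case False
    then have "coeff p d < 0" using assms by auto
    then show ?thesis using pos[of "- p"] dp by (auto simp: sgn_if) (metis less_asym)+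
  qed
  then show ?thesis using assms(2) by (auto simp: right_sign_def sgn_0_0)
qed

lemma left_sign_minus_infinity:
  assumes "degree p \<le> d" "coeff p d \<noteq> 0"
  shows "left_sign p (-\<infinity>) ((-1) ^ d * sgn (coeff p d))"
proof -
  define q where "q = pcompose p [:0,-1:]"
  have dp: "degree p = d" using assms by (simp add: le_antisym le_degree)
  have dq: "degree q = d" by (simp add: q_def dp degree_pcompose)
  have "lead_coeff q = lead_coeff p * (-1) ^ d" 
    unfolding q_def by (subst lead_coeff_comp) (auto simp: dp)
  then have "coeff q d = coeff p d * (-1) ^ d" using dp dq by simp
  then have "right_sign q \<infinity> (sgn (coeff p d * (-1) ^ d))"
    using right_sign_infinity[of q d] assms dq by simp
  then obtain b where b: "\<forall>t>b. sgn (poly q t) = (-1) ^ d * sgn (coeff p d)" 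
    by (cases "even d") (auto simp: right_sign_def)
  have "\<forall>t. t < - b \<longrightarrow> sgn (poly p t) = (-1) ^ d * sgn (coeff p d)"
  proof (intro allI impI)
    fix t assume "t < - b"
    then show "sgn (poly p t) = (-1) ^ d * sgn (coeff p d)"
      using b[rule_format, of "- t"] by (simp add: q_def poly_pcompose)
  qed
  then show ?thesis using assms(2) by (auto simp: left_sign_def sgn_0_0)
qed

lemma point_columns_split_cell:
  "\<tau> \<in> set (point_columns (split_cell p s s' \<sigma> @ \<tau>' # M)) \<Longrightarrow> \<tau> p = 0 \<or> \<tau> = \<tau>' \<or> \<tau> \<in> set (point_columns M)"
  "\<tau> \<in> set (point_columns (split_cell p s s' \<sigma>)) \<Longrightarrow> \<tau> p = 0"
  by (auto simp: split_cell_def split: if_splits)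

text \<open>Every point of the new diagram is a zero of the added polynomial or a point of the old diagram.\<close>

lemma point_columns_insert_poly:
  "\<tau> \<in> set (point_columns (insert_poly p g s' s M)) \<Longrightarrow>
    \<tau> p = 0 \<or> (\<exists>\<tau>'\<in>set (point_columns M). \<tau> = \<tau>'(p := g \<tau>'))"
proof (induction p g s' s M rule: insert_poly.induct)
  case (2 p g s' s \<sigma>)
  then show ?case using point_columns_split_cell(2) by force
next
  case (3 p g s' s \<sigma> \<tau>' M)
  have "\<tau> p = 0 \<or> \<tau> = \<tau>'(p := g \<tau>') \<or> \<tau> \<in> set (point_columns (insert_poly p g s' (g \<tau>') M))"
    using 3(2) by (intro point_columns_split_cell(1)[of _ _ s "g \<tau>'" \<sigma>]) (simp only: insert_poly.simps)
  then show ?case using 3(1) by (simp del: fun_upd_apply) blast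
qed simp

section \<open>The theorem of Tarski and Seidenberg\<close>

text \<open>The signs of the formal leading coefficients determine the sign diagram of a closed family. The polynomials are added
in the order of their degrees, keeping the invariant that every point of the diagram is a zero of some polynomial \<open>q\<close> of
positive degree with nonvanishing leading coefficient. The sign of the next polynomial at that point is the sign of
its pseudo-remainder modulo \<open>q\<close>, which has smaller degree and has therefore already been added.\<close>

lemma closed_family_cells:
  fixes B :: "(nat \<times> ('a::euclidean_space \<Rightarrow> real poly)) set"
  assumes B: "closed_family B"
  shows "\<exists>M. \<forall>x. (\<forall>p\<in>B. sgn (formal_lc p x) = s p) \<longrightarrow> cells B (\<lambda>p. snd p x) (-\<infinity>) M"
proof -
  define E where "E = {x. \<forall>p\<in>B. sgn (formal_lc p x) = s p}"
  define good where "good S \<longleftrightarrow> (\<exists>M. (\<forall>x\<in>E. cells S (\<lambda>p. snd p x) (-\<infinity>) M) \<and>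
    (\<forall>\<tau>\<in>set (point_columns M). \<exists>q\<in>S. 1 \<le> fst q \<and> s q \<noteq> 0 \<and> \<tau> q = 0))" for S
  have fin: "finite B" using B by (simp add: closed_family_def)
  have sE: "sgn (formal_lc p x) = s p" if "x \<in> E" "p \<in> B" for x p using that by (simp add: E_def)
  have "S \<subseteq> B \<longrightarrow> (\<forall>p\<in>S. \<forall>q\<in>B. fst q < fst p \<longrightarrow> q \<in> S) \<longrightarrow> good S" if "finite S" for S
    using that
  proof (induction rule: finite_ranking_induct[where f = fst])
    case empty
    have "cells {} (\<lambda>p. snd p x) (-\<infinity>) [\<lambda>_. 0]" for x :: 'a by (rule cells.last) auto
    then show ?case unfolding good_def by (intro impI exI[of _ "[\<lambda>_. 0]"]) auto
  next
    case (insert p S)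
    show ?case
    proof (intro impI)
      assume sub: "insert p S \<subseteq> B" and low: "\<forall>p'\<in>insert p S. \<forall>q\<in>B. fst q < fst p' \<longrightarrow> q \<in> insert p S"
      have pB: "p \<in> B" and SB: "S \<subseteq> B" using sub by auto
      have low': "q \<in> S" if "q \<in> B" "fst q < fst p" for q using low that by auto
      have "\<forall>p'\<in>S. \<forall>q\<in>B. fst q < fst p' \<longrightarrow> q \<in> S"
      proof (intro ballI impI)
        fix p' q assume *: "p' \<in> S" "q \<in> B" "fst q < fst p'"
        then have "q \<in> insert p S" using low by simp
        moreover have "q \<noteq> p" using insert.hyps(2)[OF *(1)] *(3) by auto
        ultimately show "q \<in> S" by simp
      qed
      then have "good S" using insert.IH SB by blast
      then obtain M where M: "\<And>x. x \<in> E \<Longrightarrow> cells S (\<lambda>p. snd p x) (-\<infinity>) M"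
        and gM: "\<And>\<tau>. \<tau> \<in> set (point_columns M) \<Longrightarrow> \<exists>q\<in>S. 1 \<le> fst q \<and> s q \<noteq> 0 \<and> \<tau> q = 0"
        unfolding good_def by blast
      have ppp: "param_poly p" using B pB by (simp add: closed_family_def)
      have deg: "degree (snd p x) \<le> fst p" for x using ppp by (simp add: param_poly_def)
      show "good (insert p S)"
      proof (cases "p \<in> S")
        case True
        then show ?thesis using \<open>good S\<close> by (simp add: insert_absorb)
      next
        case pS: False
        have easy: "good (insert p S)"
          if \<kappa>: "\<And>x \<sigma> t. x \<in> E \<Longrightarrow> \<forall>i\<in>S. sgn (poly (snd i x) t) = \<sigma> i \<Longrightarrow> sgn (poly (snd p x) t) = \<kappa> \<sigma>" for \<kappa>
          unfolding good_def
        proof (intro exI[of _ "map (\<lambda>\<sigma>. \<sigma>(p := \<kappa> \<sigma>)) M"] conjI ballI)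
          fix x assume "x \<in> E"
          then show "cells (insert p S) (\<lambda>p. snd p x) (- \<infinity>) (map (\<lambda>\<sigma>. \<sigma>(p := \<kappa> \<sigma>)) M)"
            by (intro cells_map M \<kappa> pS)
        next
          fix \<tau> assume "\<tau> \<in> set (point_columns (map (\<lambda>\<sigma>. \<sigma>(p := \<kappa> \<sigma>)) M))"
          then obtain \<tau>' where \<tau>': "\<tau>' \<in> set (point_columns M)" "\<tau> = \<tau>'(p := \<kappa> \<tau>')" by (auto simp: point_columns_map)
          then obtain q where "q \<in> S" "1 \<le> fst q \<and> s q \<noteq> 0 \<and> \<tau>' q = 0" using gM by blast
          then show "\<exists>q\<in>insert p S. 1 \<le> fst q \<and> s q \<noteq> 0 \<and> \<tau> q = 0"
            using pS \<tau>'(2) by (intro bexI[of _ q]) auto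
        qed
        have "(fst p = 0 \<or> 1 \<le> fst p \<and> s p = 0) \<or> 1 \<le> fst p \<and> s p \<noteq> 0"
          by (cases "fst p"; cases "s p = 0"; simp)
        then show ?thesis
        proof (elim disjE conjE)
          \<comment> \<open>Formal degree 0: the polynomial is constant, equal to its formal leading coefficient.\<close>
          assume 1: "fst p = 0"
          show ?thesis
          proof (rule easy)
            fix x \<sigma> t assume "x \<in> E"
            have "degree (snd p x) = 0" using deg[of x] 1 by simp
            then obtain a where "snd p x = [:a:]" by (rule degree_eq_zeroE)
            then have "poly (snd p x) t = formal_lc p x" using 1 by (simp add: formal_lc_def)
            then show "sgn (poly (snd p x) t) = s p" using sE[OF \<open>x \<in> E\<close> pB] by simp
          qed
        next
          \<comment> \<open>The formal leading coefficient vanishes, so \<open>p\<close> agrees with its truncation.\<close>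
          assume 2: "1 \<le> fst p" "s p = 0"
          have tr: "truncation p \<in> S"
            using B pB 2 by (intro low') (auto simp: closed_family_def truncation_def)
          show ?thesis
          proof (rule easy)
            fix x and \<sigma> :: "_ \<Rightarrow> real" and t assume "x \<in> E" "\<forall>i\<in>S. sgn (poly (snd i x) t) = \<sigma> i"
            then show "sgn (poly (snd p x) t) = \<sigma> (truncation p)"
              using poly_truncation[of p x] sE[OF \<open>x \<in> E\<close> pB] 2 tr by (auto simp: sgn_0_0)
          qed
        next
          assume 3: "1 \<le> fst p" "s p \<noteq> 0"
          \<comment> \<open>The polynomial has its formal degree: subdivide the intervals by its zeros.\<close>
          define root_of where "root_of \<tau> = (SOME q. q \<in> S \<and> 1 \<le> fst q \<and> s q \<noteq> 0 \<and> \<tau> q = 0)" for \<tau> :: "_ \<Rightarrow> real"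
          define g where "g \<tau> = \<tau> (pseudo_remainder p (root_of \<tau>))" for \<tau> :: "_ \<Rightarrow> real"
          have root_of: "root_of \<tau> \<in> S \<and> 1 \<le> fst (root_of \<tau>) \<and> s (root_of \<tau>) \<noteq> 0 \<and> \<tau> (root_of \<tau>) = 0"
            if "\<tau> \<in> set (point_columns M)" for \<tau>
            unfolding root_of_def using someI_ex[of "\<lambda>q. q \<in> S \<and> 1 \<le> fst q \<and> s q \<noteq> 0 \<and> \<tau> q = 0"] gM[OF that] by blast
          have g: "sgn (poly (snd p x) t) = g \<tau>"
            if x: "x \<in> E" and \<tau>: "\<tau> \<in> set (point_columns M)" "\<forall>i\<in>S. sgn (poly (snd i x) t) = \<tau> i" for x \<tau> t
          proof -
            let ?q = "root_of \<tau>"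
            have q: "?q \<in> S" "1 \<le> fst ?q" "s ?q \<noteq> 0" "\<tau> ?q = 0" using root_of[OF \<tau>(1)] by auto
            have qp: "fst ?q \<le> fst p" using insert.hyps(2) q by auto
            have qB: "?q \<in> B" using q SB by auto
            have pq: "param_poly ?q" using qB B by (simp add: closed_family_def)
            have r: "pseudo_remainder p ?q \<in> B" using B pB qB q qp by (auto simp: closed_family_def)
            have "pseudo_remainder p ?q \<in> S"
              using pseudo_remainder(2)[OF ppp pq q(2)] q(2) qp by (intro low' r) auto
            then have "g \<tau> = sgn (poly (snd (pseudo_remainder p ?q) x) t)" using \<tau>(2) by (simp add: g_def)
            also have "\<dots> = sgn (poly (snd p x) t)"
            proof (rule pseudo_remainder(3)[OF ppp pq q(2)])
              show "formal_lc ?q x \<noteq> 0" using sE[OF x qB] q(3) by auto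
              show "poly (snd ?q x) t = 0" using \<tau>(2) q(1,4) by (auto simp: sgn_0_0)
            qed
            finally show ?thesis by simp
          qed
          have dS: "param_deriv p \<in> S"
            using B pB 3 by (intro low') (auto simp: closed_family_def param_deriv_def)
          show ?thesis
            unfolding good_def
          proof (intro exI[of _ "insert_poly p g (s p) ((-1) ^ fst p * s p) M"] conjI ballI)
            fix x assume x: "x \<in> E"
            have lc: "coeff (snd p x) (fst p) \<noteq> 0" "sgn (coeff (snd p x) (fst p)) = s p"
              using sE[OF x pB] 3 by (auto simp: formal_lc_def)
            have "degree (snd p x) \<noteq> 0" using lc(1) 3 by (metis le_degree le_zero_eq not_one_le_zero)
            then have "snd (param_deriv p) x \<noteq> 0" by (simp add: param_deriv_def pderiv_eq_0_iff)
            then show "cells (insert p S) (\<lambda>p. snd p x) (- \<infinity>) (insert_poly p g (s p) ((-1) ^ fst p * s p) M)"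
              using left_sign_minus_infinity[OF deg lc(1)] right_sign_infinity[OF deg lc(1)]
              by (intro cells_insert_poly[where q = "param_deriv p"] M x pS dS g) (simp_all add: param_deriv_def lc(2))
          next
            fix \<tau> assume "\<tau> \<in> set (point_columns (insert_poly p g (s p) ((-1) ^ fst p * s p) M))"
            then consider "\<tau> p = 0" | \<tau>' where "\<tau>' \<in> set (point_columns M)" "\<tau> = \<tau>'(p := g \<tau>')"
              using point_columns_insert_poly[of \<tau> p g] by blast
            then show "\<exists>q\<in>insert p S. 1 \<le> fst q \<and> s q \<noteq> 0 \<and> \<tau> q = 0"
            proof cases
              case 1
              then show ?thesis using 3 by auto
            next
              case 2
              then show ?thesis using root_of[of \<tau>'] pS by (intro bexI[of _ "root_of \<tau>'"]) auto
            qed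
          qed
        qed
      qed
    qed
  qed
  then have "good B" using fin by blast
  then obtain M where "\<forall>x\<in>E. cells B (\<lambda>p. snd p x) (-\<infinity>) M" unfolding good_def by blast
  then show ?thesis unfolding E_def by (intro exI[of _ M]) simp
qed

text \<open>The parameter is the base point of a line with direction \<open>v\<close>.\<close>

lemma real_polynomial_along_line:
  fixes p :: "'a::euclidean_space \<Rightarrow> real"
  assumes "real_polynomial_function p"
  shows "\<exists>q. param_poly q \<and> (\<forall>x t. poly (snd q x) t = p (x + t *\<^sub>R v))"
  using assms
proof induction
  case (linear f)
  interpret bounded_linear f by fact
  have f: "real_polynomial_function f" by (rule real_polynomial_function.intros(1)) fact
  have "real_polynomial_function (\<lambda>x. coeff [:f x, f v:] i)" for i
  proof -
    have "(\<lambda>x. coeff [:f x, f v:] i) = (if i = 0 then f else if i = 1 then (\<lambda>x. f v) else (\<lambda>x. 0))"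
      by (auto simp: fun_eq_iff coeff_pCons split: nat.split)
    then show ?thesis using f by (auto intro: real_polynomial_function.intros(2))
  qed
  then show ?case
    by (intro exI[of _ "(1, \<lambda>x. [:f x, f v:])"]) (auto simp: param_poly_def add scaleR)
next
  case (const c)
  have "real_polynomial_function (\<lambda>x::'a. coeff [:c:] i)" for i by (rule real_polynomial_function.intros(2))
  then show ?case by (intro exI[of _ "(0, \<lambda>x. [:c:])"]) (auto simp: param_poly_def)
next
  case (add f g)
  then obtain q r where "param_poly q" "\<And>x t. poly (snd q x) t = f (x + t *\<^sub>R v)"
    "param_poly r" "\<And>x t. poly (snd r x) t = g (x + t *\<^sub>R v)" by auto
  then show ?case
    by (intro exI[of _ "(max (fst q) (fst r), \<lambda>x. snd q x + snd r x)"])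
      (auto simp: param_poly_def intro!: degree_add_le intro: order_trans max.cobounded1 max.cobounded2)
next
  case (mult f g)
  then obtain q r where "param_poly q" "\<And>x t. poly (snd q x) t = f (x + t *\<^sub>R v)"
    "param_poly r" "\<And>x t. poly (snd r x) t = g (x + t *\<^sub>R v)" by auto
  then show ?case
    by (intro exI[of _ "(fst q + fst r, \<lambda>x. snd q x * snd r x)"])
      (auto simp: param_poly_def coeff_mult intro!: order_trans[OF degree_mult_le] add_mono
        real_polynomial_function_sum real_polynomial_function.intros(4))
qed

text \<open>Membership of a point of the line in \<open>S\<close> is decided by the signs of finitely many polynomials with parameters.\<close>

lemma semialgebraic_sign_condition:
  fixes S :: "'a::euclidean_space set"
  assumes "semialgebraic S"
  shows "\<exists>A \<phi>. finite A \<and> (\<forall>p\<in>A. param_poly p) \<and>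
    (\<forall>x t \<sigma>. (\<forall>p\<in>A. sgn (poly (snd p x) t) = \<sigma> p) \<longrightarrow> (x + t *\<^sub>R v \<in> S \<longleftrightarrow> \<phi> \<sigma>))"
  using assms
proof induction
  case (pos p)
  obtain q where q: "param_poly q" "\<And>x t. poly (snd q x) t = p (x + t *\<^sub>R v)"
    using real_polynomial_along_line[OF pos] by blast
  show ?case
  proof (intro exI[of _ "{q}"] exI[of _ "\<lambda>\<sigma>. \<sigma> q = 1"] conjI allI impI)
    fix x t and \<sigma> :: "_ \<Rightarrow> real"
    assume "\<forall>p\<in>{q}. sgn (poly (snd p x) t) = \<sigma> p"
    then have "\<sigma> q = sgn (p (x + t *\<^sub>R v))" using q(2) by simp
    then show "x + t *\<^sub>R v \<in> {x. 0 < p x} \<longleftrightarrow> \<sigma> q = 1" by (auto simp: sgn_if)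
  qed (use q in auto)
next
  case (compl S)
  then obtain A \<phi> where A: "finite A" "\<forall>p\<in>A. param_poly p"
    "\<forall>x t \<sigma>. (\<forall>p\<in>A. sgn (poly (snd p x) t) = \<sigma> p) \<longrightarrow> (x + t *\<^sub>R v \<in> S \<longleftrightarrow> \<phi> \<sigma>)" by blast
  then show ?case by (intro exI[of _ A] exI[of _ "\<lambda>\<sigma>. \<not> \<phi> \<sigma>"]) auto
next
  case (un S T)
  then obtain A \<phi> A' \<phi>' where A: "finite A" "\<forall>p\<in>A. param_poly p"
    "\<forall>x t \<sigma>. (\<forall>p\<in>A. sgn (poly (snd p x) t) = \<sigma> p) \<longrightarrow> (x + t *\<^sub>R v \<in> S \<longleftrightarrow> \<phi> \<sigma>)"
    "finite A'" "\<forall>p\<in>A'. param_poly p"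
    "\<forall>x t \<sigma>. (\<forall>p\<in>A'. sgn (poly (snd p x) t) = \<sigma> p) \<longrightarrow> (x + t *\<^sub>R v \<in> T \<longleftrightarrow> \<phi>' \<sigma>)" by blast
  show ?case
  proof (intro exI[of _ "A \<union> A'"] exI[of _ "\<lambda>\<sigma>. \<phi> \<sigma> \<or> \<phi>' \<sigma>"] conjI allI impI)
    fix x t and \<sigma> :: "_ \<Rightarrow> real"
    assume "\<forall>p\<in>A \<union> A'. sgn (poly (snd p x) t) = \<sigma> p"
    then have "x + t *\<^sub>R v \<in> S \<longleftrightarrow> \<phi> \<sigma>" "x + t *\<^sub>R v \<in> T \<longleftrightarrow> \<phi>' \<sigma>" using A(3,6) by simp_all
    then show "x + t *\<^sub>R v \<in> S \<union> T \<longleftrightarrow> \<phi> \<sigma> \<or> \<phi>' \<sigma>" by simp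
  qed (use A in auto)
next
  case (inter S T)
  then obtain A \<phi> A' \<phi>' where A: "finite A" "\<forall>p\<in>A. param_poly p"
    "\<forall>x t \<sigma>. (\<forall>p\<in>A. sgn (poly (snd p x) t) = \<sigma> p) \<longrightarrow> (x + t *\<^sub>R v \<in> S \<longleftrightarrow> \<phi> \<sigma>)"
    "finite A'" "\<forall>p\<in>A'. param_poly p"
    "\<forall>x t \<sigma>. (\<forall>p\<in>A'. sgn (poly (snd p x) t) = \<sigma> p) \<longrightarrow> (x + t *\<^sub>R v \<in> T \<longleftrightarrow> \<phi>' \<sigma>)" by blast
  show ?case
  proof (intro exI[of _ "A \<union> A'"] exI[of _ "\<lambda>\<sigma>. \<phi> \<sigma> \<and> \<phi>' \<sigma>"] conjI allI impI)
    fix x t and \<sigma> :: "_ \<Rightarrow> real"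
    assume "\<forall>p\<in>A \<union> A'. sgn (poly (snd p x) t) = \<sigma> p"
    then have "x + t *\<^sub>R v \<in> S \<longleftrightarrow> \<phi> \<sigma>" "x + t *\<^sub>R v \<in> T \<longleftrightarrow> \<phi>' \<sigma>" using A(3,6) by simp_all
    then show "x + t *\<^sub>R v \<in> S \<inter> T \<longleftrightarrow> \<phi> \<sigma> \<and> \<phi>' \<sigma>" by simp
  qed (use A in auto)
qed

text \<open>Elimination of one real quantifier, stated as the projection of \<open>S\<close> along an arbitrary direction \<open>v\<close>.\<close>

theorem tarski_seidenberg:
  fixes S :: "'a::euclidean_space set"
  assumes "semialgebraic S"
  shows "semialgebraic {x. \<exists>t. x + t *\<^sub>R v \<in> S}"
proof -
  obtain A \<phi> where A: "finite A" "\<forall>p\<in>A. param_poly p"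
    and \<phi>: "\<And>x t \<sigma>. (\<forall>p\<in>A. sgn (poly (snd p x) t) = \<sigma> p) \<Longrightarrow> (x + t *\<^sub>R v \<in> S \<longleftrightarrow> \<phi> \<sigma>)"
    using semialgebraic_sign_condition[OF assms, of v] by metis
  obtain B where AB: "A \<subseteq> B" and B: "closed_family B" using closed_family_exists[OF A] by blast
  have fB: "finite B" and ppB: "\<And>p. p \<in> B \<Longrightarrow> param_poly p" using B by (auto simp: closed_family_def)
  define E where "E s = {x. \<forall>p\<in>B. sgn (formal_lc p x) = s p}" for s
  have "\<exists>M. \<forall>s. \<forall>x\<in>E s. cells B (\<lambda>p. snd p x) (-\<infinity>) (M s)"
    using closed_family_cells[OF B] unfolding E_def by (intro choice) auto
  then obtain M where M: "\<And>s x. x \<in> E s \<Longrightarrow> cells B (\<lambda>p. snd p x) (-\<infinity>) (M s)" by blast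
  \<comment> \<open>The sign vectors of the leading coefficients for which some cell satisfies the condition.\<close>
  define \<Sigma> where "\<Sigma> = {s \<in> B \<rightarrow>\<^sub>E {-1, 0, 1}. \<exists>\<sigma>\<in>set (M s). \<phi> \<sigma>}"
  have fin: "finite \<Sigma>" using fB by (auto simp: \<Sigma>_def intro!: finite_PiE)
  have eq: "(\<exists>t. x + t *\<^sub>R v \<in> S) \<longleftrightarrow> (\<exists>\<sigma>\<in>set (M s). \<phi> \<sigma>)" if x: "x \<in> E s" for x s
  proof
    assume "\<exists>t. x + t *\<^sub>R v \<in> S"
    then obtain t where t: "x + t *\<^sub>R v \<in> S" by auto
    obtain \<sigma> where "\<sigma> \<in> set (M s)" "\<forall>i\<in>B. sgn (poly (snd i x) t) = \<sigma> i"
      using cells_complete[OF M[OF x], of t] by auto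
    then show "\<exists>\<sigma>\<in>set (M s). \<phi> \<sigma>" using \<phi>[of x t \<sigma>] t AB by auto
  next
    assume "\<exists>\<sigma>\<in>set (M s). \<phi> \<sigma>"
    then obtain \<sigma> where \<sigma>: "\<sigma> \<in> set (M s)" "\<phi> \<sigma>" by auto
    then obtain t where "\<forall>i\<in>B. sgn (poly (snd i x) t) = \<sigma> i" using cells_sound[OF M[OF x]] by blast
    then show "\<exists>t. x + t *\<^sub>R v \<in> S" using \<phi>[of x t \<sigma>] \<sigma>(2) AB by auto
  qed
  have "{x. \<exists>t. x + t *\<^sub>R v \<in> S} = (\<Union>s\<in>\<Sigma>. E s)"
  proof (rule Set.set_eqI, rule iffI)
    fix x assume "x \<in> {x. \<exists>t. x + t *\<^sub>R v \<in> S}"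
    then have ex: "\<exists>t. x + t *\<^sub>R v \<in> S" by simp
    define s where "s = (\<lambda>p\<in>B. sgn (formal_lc p x))"
    have "x \<in> E s" by (simp add: E_def s_def)
    moreover have "s \<in> B \<rightarrow>\<^sub>E {-1, 0, 1}" by (auto simp: s_def sgn_if)
    ultimately show "x \<in> (\<Union>s\<in>\<Sigma>. E s)" using ex eq unfolding \<Sigma>_def by blast
  qed (use eq in \<open>auto simp: \<Sigma>_def\<close>)
  moreover have "semialgebraic (E s)" for s
  proof -
    have "E s = (\<Inter>p\<in>B. {x. sgn (formal_lc p x) = s p})" by (auto simp: E_def)
    moreover have "semialgebraic {x. sgn (formal_lc p x) = s p}" if "p \<in> B" for p
      using ppB[OF that] by (intro semialgebraic_sign_set) (auto simp: param_poly_def formal_lc_def)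
    ultimately show ?thesis using fB by (auto intro!: semialgebraic_INT)
  qed
  ultimately show ?thesis using fin by (auto intro!: semialgebraic_UN)
qed

corollary semialgebraic_plus_span:
  fixes S :: "'a::euclidean_space set"
  assumes "finite B" "semialgebraic S"
  shows "semialgebraic {x. \<exists>w\<in>span B. x + w \<in> S}"
  using assms(1)
proof induction
  case empty
  then show ?case using assms(2) by simp
next
  case (insert v B)
  have "{x. \<exists>w\<in>span (insert v B). x + w \<in> S} = {x. \<exists>t. x + t *\<^sub>R v \<in> {x. \<exists>w\<in>span B. x + w \<in> S}}"
  proof (rule Set.set_eqI, rule iffI)
    fix x assume "x \<in> {x. \<exists>w\<in>span (insert v B). x + w \<in> S}"
    then obtain w t where "x + w \<in> S" "w - t *\<^sub>R v \<in> span B" by (auto simp: span_insert)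
    then have "x + t *\<^sub>R v + (w - t *\<^sub>R v) \<in> S" by simp
    then show "x \<in> {x. \<exists>t. x + t *\<^sub>R v \<in> {x. \<exists>w\<in>span B. x + w \<in> S}}"
      using \<open>w - t *\<^sub>R v \<in> span B\<close> by blast
  next
    fix x assume "x \<in> {x. \<exists>t. x + t *\<^sub>R v \<in> {x. \<exists>w\<in>span B. x + w \<in> S}}"
    then obtain t w where w: "w \<in> span B" "x + t *\<^sub>R v + w \<in> S" by auto
    then have "t *\<^sub>R v + w \<in> span (insert v B)" unfolding span_insert by (auto intro!: exI[of _ t])
    then show "x \<in> {x. \<exists>w\<in>span (insert v B). x + w \<in> S}" using w by (auto simp: add.assoc)
  qed
  then show ?case using tarski_seidenberg[OF insert.IH, of v] by simp
qed

section \<open>Frontiers of semialgebraic sets\<close>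

lemma real_polynomial_eq_0_on_open:
  fixes p :: "'a::euclidean_space \<Rightarrow> real"
  assumes p: "real_polynomial_function p" and U: "open U" "a \<in> U" and 0: "\<And>x. x \<in> U \<Longrightarrow> p x = 0"
  shows "p x = 0"
proof -
  obtain q where "param_poly q" and q: "\<And>y t. poly (snd q y) t = p (y + t *\<^sub>R (x - a))"
    using real_polynomial_along_line[OF p] by metis
  have "((\<lambda>t. a + t *\<^sub>R (x - a)) \<longlongrightarrow> a + 0 *\<^sub>R (x - a)) (at 0)" by (intro tendsto_intros)
  then have "eventually (\<lambda>t. a + t *\<^sub>R (x - a) \<in> U) (at 0)"
    using topological_tendstoD[of _ _ _ U] U by simp
  then obtain d where d: "d > 0" "\<And>t. t \<noteq> 0 \<Longrightarrow> dist t 0 < d \<Longrightarrow> a + t *\<^sub>R (x - a) \<in> U"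
    unfolding eventually_at by blast
  have "{0<..<d} \<subseteq> {t. poly (snd q a) t = 0}" using d q 0 by auto
  then have "infinite {t. poly (snd q a) t = 0}" using infinite_Ioo[OF d(1)] finite_subset by blast
  then have "snd q a = 0" using poly_roots_finite by blast
  then show ?thesis using q[of a 1] by simp
qed

lemma real_polynomial_mult_nonzero:
  fixes p q :: "'a::euclidean_space \<Rightarrow> real"
  assumes p: "real_polynomial_function p" "p x \<noteq> 0" and q: "real_polynomial_function q" "q y \<noteq> 0"
  shows "\<exists>z. p z * q z \<noteq> 0"
proof (rule ccontr)
  assume n: "\<not> (\<exists>z. p z * q z \<noteq> 0)"
  have "open {x. p x \<noteq> 0}"
    by (intro open_Collect_neq continuous_on_polymonial_function continuous_on_const)
      (use p real_polynomial_function_eq in blast)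
  then have "q y = 0"
  proof (rule real_polynomial_eq_0_on_open[OF q(1)])
    show "x \<in> {x. p x \<noteq> 0}" using p(2) by simp
    show "q z = 0" if "z \<in> {x. p x \<noteq> 0}" for z
    proof -
      have "p z * q z = 0" using n by blast
      then show ?thesis using that by simp
    qed
  qed
  then show False using q(2) by simp
qed

text \<open>In particular, a semialgebraic set with empty interior lies in the zero set of a nonzero polynomial.\<close>

lemma semialgebraic_frontier:
  fixes S :: "'a::euclidean_space set"
  assumes "semialgebraic S"
  shows "\<exists>h. real_polynomial_function h \<and> (\<exists>x. h x \<noteq> 0) \<and> frontier S \<subseteq> {x. h x = 0}"
  using assms
proof induction
  case (pos p)
  show ?case
  proof (cases "\<exists>x. p x \<noteq> 0")
    case True
    have c: "continuous_on UNIV p" 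
      using pos real_polynomial_function_eq by (intro continuous_on_polymonial_function) blast
    have "open {x. 0 < p x}" by (intro open_Collect_less c continuous_on_const)
    moreover have "closure {x. 0 < p x} \<subseteq> {x. 0 \<le> p x}"
      by (intro closure_minimal closed_Collect_le c continuous_on_const) auto
    ultimately have "frontier {x. 0 < p x} \<subseteq> {x. p x = 0}"
      unfolding frontier_def by (auto simp: interior_open)
    then show ?thesis using True pos by auto
  next
    case False
    then have "{x. 0 < p x} = {}" by auto
    then show ?thesis by (intro exI[of _ "\<lambda>x. 1"]) (auto intro: real_polynomial_function.intros(2))
  qed
next
  case (un S T)
  then obtain g h where "real_polynomial_function g" "\<exists>x. g x \<noteq> 0" "frontier S \<subseteq> {x. g x = 0}"
    "real_polynomial_function h" "\<exists>x. h x \<noteq> 0" "frontier T \<subseteq> {x. h x = 0}" by blast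
  then show ?case using frontier_Un_subset[of S T] real_polynomial_mult_nonzero[of g _ h]
    by (intro exI[of _ "\<lambda>x. g x * h x"]) (auto intro: real_polynomial_function.intros(4))
next
  case (inter S T)
  then obtain g h where "real_polynomial_function g" "\<exists>x. g x \<noteq> 0" "frontier S \<subseteq> {x. g x = 0}"
    "real_polynomial_function h" "\<exists>x. h x \<noteq> 0" "frontier T \<subseteq> {x. h x = 0}" by blast
  then show ?case using frontier_Int_subset[of S T] real_polynomial_mult_nonzero[of g _ h]
    by (intro exI[of _ "\<lambda>x. g x * h x"]) (auto intro: real_polynomial_function.intros(4))
qed simp

section \<open>Ultrafilters and chains of prime ideals\<close>

text \<open>Ultrafilters, as proper filters that decide every predicate.\<close>

definition ultra :: "'a filter \<Rightarrow> bool" where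
  "ultra U \<longleftrightarrow> U \<noteq> bot \<and> (\<forall>P. eventually P U \<or> eventually (\<lambda>x. \<not> P x) U)"

lemma ultra_not: "ultra U \<Longrightarrow> eventually (\<lambda>x. \<not> P x) U \<longleftrightarrow> \<not> eventually P U"
  unfolding ultra_def using eventually_conj[of P U "\<lambda>x. \<not> P x"] by (auto simp: trivial_limit_def)

lemma ultra_exists:
  fixes F :: "'a filter"
  assumes "F \<noteq> bot"
  shows "\<exists>U\<le>F. ultra U"
proof -
  define A where "A = {G. G \<le> F \<and> G \<noteq> bot}"
  \<comment> \<open>Zorn's lemma: the infimum of a nonempty chain of proper filters is proper.\<close>
  have "\<exists>m\<in>A. \<forall>a\<in>A. a \<le> m \<longrightarrow> a = m"
  proof (rule predicate_Zorn)
    show "partial_order_on A (relation_of (\<lambda>x y. y \<le> x) A)"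
      by (auto simp: partial_order_on_def preorder_on_def refl_on_def trans_def antisym_def relation_of_def)
    fix C assume "C \<in> Chains (relation_of (\<lambda>x y. y \<le> x) A)"
    then have C: "C \<subseteq> A" "\<And>G H. G \<in> C \<Longrightarrow> H \<in> C \<Longrightarrow> G \<le> H \<or> H \<le> G"
      by (auto simp: Chains_def relation_of_def)
    show "\<exists>u\<in>A. \<forall>a\<in>C. u \<le> a"
    proof (cases "C = {}")
      case True
      then show ?thesis using assms by (auto simp: A_def)
    next
      case False
      have "eventually P (Inf C) \<longleftrightarrow> (\<exists>b\<in>C. eventually P b)" for P
      proof (rule eventually_Inf_base[OF False])
        fix G H assume "G \<in> C" "H \<in> C"
        then show "\<exists>x\<in>C. x \<le> inf G H" using C(2)[of G H] by (auto intro: bexI[of _ G] bexI[of _ H])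
      qed
      then have "Inf C \<noteq> bot" using C(1) by (auto simp: trivial_limit_def A_def)
      moreover have "Inf C \<le> F"
        using False C(1) by (auto simp: A_def intro: Inf_lower2)
      ultimately show ?thesis by (intro bexI[of _ "Inf C"]) (auto simp: A_def intro: Inf_lower)
    qed
  qed
  then obtain U where U: "U \<le> F" "U \<noteq> bot" and min: "\<And>G. G \<le> U \<Longrightarrow> G \<noteq> bot \<Longrightarrow> G = U"
    unfolding A_def by (auto intro: order_trans)
  have "eventually P U \<or> eventually (\<lambda>x. \<not> P x) U" for P
  proof (cases "inf U (principal {x. P x}) = bot")
    case True
    then have "eventually (\<lambda>x. \<not> P x) U" unfolding trivial_limit_def by (simp add: eventually_inf_principal)
    then show ?thesis by simp
  next
    case False
    then have "inf U (principal {x. P x}) = U" by (intro min) auto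
    then have "U \<le> principal {x. P x}" by (metis inf.cobounded2)
    then show ?thesis by (simp add: le_principal)
  qed
  then have "ultra U" using U by (simp add: ultra_def)
  then show ?thesis using U(1) by blast
qed

lemma ultra_tendsto_compact:
  fixes f :: "'b \<Rightarrow> 'a::euclidean_space"
  assumes U: "ultra U" and K: "compact K" and f: "\<And>t. f t \<in> K"
  shows "\<exists>x\<in>K. (f \<longlongrightarrow> x) U"
proof -
  have "filtermap f U \<noteq> bot" "eventually (\<lambda>x. x \<in> K) (filtermap f U)"
    using U f by (auto simp: ultra_def filtermap_bot_iff eventually_filtermap)
  then obtain x where x: "x \<in> K" "inf (nhds x) (filtermap f U) \<noteq> bot"
    using K unfolding compact_filter by blast
  have "(f \<longlongrightarrow> x) U"
  proof (rule topological_tendstoI, rule ccontr)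
    fix S assume S: "open S" "x \<in> S" "\<not> eventually (\<lambda>t. f t \<in> S) U"
    then have "eventually (\<lambda>t. f t \<notin> S) U" using ultra_not[OF U, of "\<lambda>t. f t \<in> S"] by simp
    then have "eventually (\<lambda>y. y \<notin> S) (filtermap f U)" by (simp add: eventually_filtermap)
    moreover have "eventually (\<lambda>y. y \<in> S) (nhds x)" using S by (intro eventually_nhds_in_open)
    ultimately have "eventually (\<lambda>y. False) (inf (nhds x) (filtermap f U))"
      unfolding eventually_inf by (intro exI[of _ "\<lambda>y. y \<in> S"] exI[of _ "\<lambda>y. y \<notin> S"]) auto
    then show False using x(2) by (simp add: trivial_limit_def)
  qed
  then show ?thesis using x(1) by blast
qed

text \<open>The iterated quantifier "for almost all \<open>t\<^sub>1\<close>, for almost all \<open>t\<^sub>2\<close>, \<dots>, for almost all \<open>t\<^sub>i\<close>" with respect to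
\<open>U\<close>, applied to a predicate on the list of these parameters. The last parameter is quantified innermost. For an
ultrafilter the quantifier commutes with all propositional connectives.\<close>

primrec iter_ev :: "real filter \<Rightarrow> nat \<Rightarrow> (real list \<Rightarrow> bool) \<Rightarrow> bool" where
  "iter_ev U 0 R = R []"
| "iter_ev U (Suc i) R = iter_ev U i (\<lambda>ts. eventually (\<lambda>t. R (ts @ [t])) U)"

lemma iter_ev_all:
  assumes "\<And>ts. length ts = i \<Longrightarrow> (\<forall>t\<in>set ts. Q t) \<Longrightarrow> R ts" "eventually Q U"
  shows "iter_ev U i R"
  using assms(1)
proof (induction i arbitrary: R)
  case (Suc i)
  then have "iter_ev U i (\<lambda>ts. eventually (\<lambda>t. R (ts @ [t])) U)"
    by (intro Suc.IH eventually_mono[OF assms(2)]) auto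
  then show ?case by simp
qed simp

lemma iter_ev_mono: "iter_ev U i R \<Longrightarrow> (\<And>ts. R ts \<Longrightarrow> R' ts) \<Longrightarrow> iter_ev U i R'"
proof (induction i arbitrary: R R')
  case (Suc i)
  then show ?case by (auto elim!: Suc.IH eventually_mono)
qed simp

lemma iter_ev_conj: "iter_ev U i (\<lambda>ts. R ts \<and> R' ts) \<longleftrightarrow> iter_ev U i R \<and> iter_ev U i R'"
  by (induction i arbitrary: R R') (auto simp: eventually_conj_iff)

lemma iter_ev_not: "ultra U \<Longrightarrow> iter_ev U i (\<lambda>ts. \<not> R ts) \<longleftrightarrow> \<not> iter_ev U i R"
  by (induction i arbitrary: R) (auto simp: ultra_not)

lemma iter_ev_disj: "ultra U \<Longrightarrow> iter_ev U i (\<lambda>ts. R ts \<or> R' ts) \<longleftrightarrow> iter_ev U i R \<or> iter_ev U i R'"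
  using iter_ev_conj[of U i "\<lambda>ts. \<not> R ts" "\<lambda>ts. \<not> R' ts"] iter_ev_not[of U i R] iter_ev_not[of U i R']
    iter_ev_not[of U i "\<lambda>ts. R ts \<or> R' ts"] by simp blast

text \<open>The polynomial functions on \<open>X\<close> that vanish at \<open>\<phi> [t\<^sub>1, \<dots>, t\<^sub>i]\<close> for almost all parameters.\<close>

definition germ_ideal :: "'a::euclidean_space set \<Rightarrow> real filter \<Rightarrow> nat \<Rightarrow> (real list \<Rightarrow> 'a) \<Rightarrow> ('a \<Rightarrow> real) set" where
  "germ_ideal X U i \<phi> = {f \<in> carrier (polynomial_function_ring X). iter_ev U i (\<lambda>ts. f (\<phi> ts) = 0)}"

text \<open>The ideal is prime because a product vanishes for almost all parameters only if one of the factors does.\<close>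

lemma primeideal_germ_ideal:
  assumes U: "ultra U" and \<phi>: "\<And>ts. \<phi> ts \<in> X"
  shows "primeideal (germ_ideal X U i \<phi>) (polynomial_function_ring X)"
proof -
  let ?R = "polynomial_function_ring X"
  let ?I = "germ_ideal X U i \<phi>"
  interpret R: cring ?R by (rule cring_polynomial_function_ring)
  have triv: "iter_ev U i (\<lambda>ts. True)" by (rule iter_ev_all[where Q = "\<lambda>_. True"]) auto
  have mult: "(f \<otimes>\<^bsub>?R\<^esub> g) (\<phi> ts) = f (\<phi> ts) * g (\<phi> ts)"
    and add: "(f \<oplus>\<^bsub>?R\<^esub> g) (\<phi> ts) = f (\<phi> ts) + g (\<phi> ts)" for f g ts
    using \<phi> by (auto simp: polynomial_function_ring_def)
  have one: "\<one>\<^bsub>?R\<^esub> (\<phi> ts) = 1" and zero: "\<zero>\<^bsub>?R\<^esub> (\<phi> ts) = 0" for ts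
    using \<phi> by (auto simp: polynomial_function_ring_def)
  have l: "x \<otimes>\<^bsub>?R\<^esub> a \<in> ?I" if "a \<in> ?I" "x \<in> carrier ?R" for a x
    using that unfolding germ_ideal_def by (auto simp: mult elim: iter_ev_mono)
  have "ideal ?I ?R"
  proof (rule idealI)
    show "subgroup ?I (add_monoid ?R)"
    proof (rule subgroup.intro; (simp only: monoid.simps partial_object.simps)?)
      show "?I \<subseteq> carrier ?R" by (auto simp: germ_ideal_def)
      show "\<zero>\<^bsub>?R\<^esub> \<in> ?I" using triv zero by (simp add: germ_ideal_def)
    next
      fix f g assume "f \<in> ?I" "g \<in> ?I"
      then have "f \<in> carrier ?R" "g \<in> carrier ?R" "iter_ev U i (\<lambda>ts. f (\<phi> ts) = 0 \<and> g (\<phi> ts) = 0)"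
        by (auto simp: germ_ideal_def iter_ev_conj)
      then show "f \<oplus>\<^bsub>?R\<^esub> g \<in> ?I"
        unfolding germ_ideal_def by (auto simp: add elim!: iter_ev_mono)
    next
      fix f assume f: "f \<in> ?I"
      then have fc: "f \<in> carrier ?R" by (simp add: germ_ideal_def)
      have "\<ominus>\<^bsub>?R\<^esub> f = (\<ominus>\<^bsub>?R\<^esub> \<one>\<^bsub>?R\<^esub>) \<otimes>\<^bsub>?R\<^esub> f" using fc by (simp add: R.l_minus)
      then have "\<ominus>\<^bsub>?R\<^esub> f \<in> ?I" using l[OF f] by simp
      then show "inv\<^bsub>add_monoid ?R\<^esub> f \<in> ?I" by (simp add: a_inv_def)
    qed
  next
    fix a x assume a: "a \<in> ?I" "x \<in> carrier ?R"
    show "x \<otimes>\<^bsub>?R\<^esub> a \<in> ?I" by (rule l[OF a])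
    moreover have "a \<in> carrier ?R" using a by (simp add: germ_ideal_def)
    ultimately show "a \<otimes>\<^bsub>?R\<^esub> x \<in> ?I" using R.m_comm[of a x] a by simp
  qed (rule R.ring_axioms)
  then show ?thesis
  proof (rule primeidealI)
    show "cring ?R" by (rule R.is_cring)
    have "iter_ev U i (\<lambda>ts. \<not> \<one>\<^bsub>?R\<^esub> (\<phi> ts) = 0)" using triv one by simp
    then have "\<one>\<^bsub>?R\<^esub> \<notin> ?I" unfolding iter_ev_not[OF U] by (simp add: germ_ideal_def)
    then show "carrier ?R \<noteq> ?I" using R.one_closed by blast
    fix a b assume "a \<in> carrier ?R" "b \<in> carrier ?R" "a \<otimes>\<^bsub>?R\<^esub> b \<in> ?I"
    then show "a \<in> ?I \<or> b \<in> ?I"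
      by (simp add: germ_ideal_def mult iter_ev_disj[OF U])
  qed
qed

text \<open>A compact subset of \<open>X\<close> whose image under \<open>d\<close> linear functionals contains a box forces the dimension to be at least \<open>d\<close>.\<close>

lemma krull_dim_polynomial_function_ring_ge:
  fixes X K :: "'a::euclidean_space set" and b :: "nat \<Rightarrow> 'a"
  assumes K: "compact K" "K \<subseteq> X" "K \<noteq> {}" and \<epsilon>: "0 < \<epsilon>"
    and box: "\<And>ts. length ts = d \<Longrightarrow> \<forall>t\<in>set ts. 0 < t \<and> t < \<epsilon> \<Longrightarrow> \<exists>x\<in>K. \<forall>j<d. x \<bullet> b j = c j + ts ! j"
  shows "ereal (real d) \<le> semialgebraic_dim X"
proof -
  obtain U where U: "U \<le> at_right (0::real)" "ultra U"
    using ultra_exists[of "at_right (0::real)"] by auto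
  have Ub: "U \<noteq> bot" using U by (simp add: ultra_def)
  define ok where "ok t \<longleftrightarrow> 0 < t \<and> t < \<epsilon>" for t
  have ok: "eventually ok U"
    using U(1) eventually_at_right_real[OF \<epsilon>] unfolding ok_def by (auto simp: le_filter_def)
  have Ulim: "((\<lambda>t. t) \<longlongrightarrow> 0) U"
  proof (rule tendsto_mono[OF U(1)])
    show "((\<lambda>t. t) \<longlongrightarrow> 0) (at_right (0::real))" by (rule tendsto_ident_at)
  qed
  \<comment> \<open>\<open>\<psi> 0\<close> picks a preimage of each point of the box, and \<open>\<psi> (Suc i)\<close> is the limit of \<open>\<psi> i\<close> as its last parameter tends to 0.\<close>
  define \<psi> where "\<psi> = rec_nat (\<lambda>ts. SOME x. x \<in> K \<and> (length ts = d \<and> (\<forall>t\<in>set ts. ok t) \<longrightarrow> (\<forall>j<d. x \<bullet> b j = c j + ts ! j)))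
    (\<lambda>_ g ts. SOME x. x \<in> K \<and> ((\<lambda>t. g (ts @ [t])) \<longlongrightarrow> x) U)"
  have \<psi>0: "\<psi> 0 ts \<in> K \<and> (length ts = d \<and> (\<forall>t\<in>set ts. ok t) \<longrightarrow> (\<forall>j<d. \<psi> 0 ts \<bullet> b j = c j + ts ! j))" for ts
  proof -
    have "\<exists>x. x \<in> K \<and> (length ts = d \<and> (\<forall>t\<in>set ts. ok t) \<longrightarrow> (\<forall>j<d. x \<bullet> b j = c j + ts ! j))"
      using box[of ts] K(3) unfolding ok_def by blast
    from someI_ex[OF this] show ?thesis by (simp add: \<psi>_def)
  qed
  have \<psi>S: "\<psi> (Suc i) ts = (SOME x. x \<in> K \<and> ((\<lambda>t. \<psi> i (ts @ [t])) \<longlongrightarrow> x) U)" for i ts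
    by (simp add: \<psi>_def)
  have \<psi>K: "\<psi> i ts \<in> K" and \<psi>lim: "((\<lambda>t. \<psi> i (ts @ [t])) \<longlongrightarrow> \<psi> (Suc i) ts) U" for i ts
  proof -
    have "(\<forall>ts. \<psi> i ts \<in> K) \<and> (\<forall>ts. ((\<lambda>t. \<psi> i (ts @ [t])) \<longlongrightarrow> \<psi> (Suc i) ts) U)"
    proof (induction i)
      case 0
      have "\<exists>x. x \<in> K \<and> ((\<lambda>t. \<psi> 0 (ts @ [t])) \<longlongrightarrow> x) U" for ts
        using ultra_tendsto_compact[OF U(2) K(1), of "\<lambda>t. \<psi> 0 (ts @ [t])"] \<psi>0 by blast
      from someI_ex[OF this] show ?case using \<psi>0 by (simp add: \<psi>S)
    next
      case (Suc i)
      have "\<exists>x. x \<in> K \<and> ((\<lambda>t. \<psi> i (ts @ [t])) \<longlongrightarrow> x) U" for ts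
        using ultra_tendsto_compact[OF U(2) K(1), of "\<lambda>t. \<psi> i (ts @ [t])"] Suc by blast
      from someI_ex[OF this] have 1: "\<psi> (Suc i) ts \<in> K" for ts by (simp add: \<psi>S)
      have "\<exists>x. x \<in> K \<and> ((\<lambda>t. \<psi> (Suc i) (ts @ [t])) \<longlongrightarrow> x) U" for ts
        using ultra_tendsto_compact[OF U(2) K(1), of "\<lambda>t. \<psi> (Suc i) (ts @ [t])"] 1 by blast
      from someI_ex[OF this] show ?case using 1 by (simp add: \<psi>S[of "Suc i"])
    qed
    then show "\<psi> i ts \<in> K" "((\<lambda>t. \<psi> i (ts @ [t])) \<longlongrightarrow> \<psi> (Suc i) ts) U" by blast+
  qed
  \<comment> \<open>The coordinates pass to the limit: the parameters that were sent to 0 contribute nothing.\<close>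
  have coord: "\<psi> i ts \<bullet> b j = c j + (if j < d - i then ts ! j else 0)"
    if "i \<le> d" "length ts = d - i" "\<forall>t\<in>set ts. ok t" "j < d" for i ts j
    using that
  proof (induction i arbitrary: ts)
    case 0
    then show ?case using \<psi>0[of ts] by simp
  next
    case (Suc i)
    have l1: "((\<lambda>t. \<psi> i (ts @ [t]) \<bullet> b j) \<longlongrightarrow> \<psi> (Suc i) ts \<bullet> b j) U"
      by (intro tendsto_intros \<psi>lim)
    have ev: "eventually (\<lambda>t. \<psi> i (ts @ [t]) \<bullet> b j = c j + (if j < d - i then (ts @ [t]) ! j else 0)) U"
      by (rule eventually_mono[OF ok]) (rule Suc.IH, use Suc.prems in auto)
    have l2: "((\<lambda>t. c j + (if j < d - i then (ts @ [t]) ! j else 0)) \<longlongrightarrow> c j + (if j < d - Suc i then ts ! j else 0)) U"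
    proof -
      consider "j < d - Suc i" | "j = d - Suc i" "j < d - i" | "\<not> j < d - i" using Suc.prems by linarith
      then show ?thesis
      proof cases
        case 1
        then have "j < d - i" by linarith
        then show ?thesis using 1 Suc.prems by (simp add: nth_append)
      next
        case 2
        then have "(ts @ [t]) ! j = t" for t using Suc.prems by (simp add: nth_append)
        then show ?thesis using 2 tendsto_add[OF tendsto_const Ulim, of "c j"] by simp
      next
        case 3
        then have "\<not> j < d - Suc i" by linarith
        then show ?thesis using 3 by simp
      qed
    qed
    show ?case
      using tendsto_unique[OF Ub l1] tendsto_cong[OF ev] l2 by blast
  qed
  define P where "P i = germ_ideal X U (d - i) (\<psi> i)" for i
  have "primeideal (P i) (polynomial_function_ring X)" for i
    unfolding P_def by (rule primeideal_germ_ideal[OF U(2)]) (use \<psi>K K(2) in auto)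
  moreover have "P i \<subset> P (Suc i)" if i: "i < d" for i
  proof
    define e where "e = d - Suc i"
    have e: "d - i = Suc e" using i by (simp add: e_def)
    show "P i \<subseteq> P (Suc i)"
    proof
      fix f assume "f \<in> P i"
      then have f: "f \<in> carrier (polynomial_function_ring X)"
        and ev: "iter_ev U e (\<lambda>ts. eventually (\<lambda>t. f (\<psi> i (ts @ [t])) = 0) U)"
        by (auto simp: P_def germ_ideal_def e)
      obtain p where p: "real_polynomial_function p" "f = restrict p X"
        using f by (auto simp: polynomial_function_ring_def)
      have "f (\<psi> (Suc i) ts) = 0" if "eventually (\<lambda>t. f (\<psi> i (ts @ [t])) = 0) U" for ts
      proof -
        have fp: "f (\<psi> i ts) = p (\<psi> i ts)" for i ts using p(2) \<psi>K K(2) by auto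
        have "isCont p (\<psi> (Suc i) ts)"
          using continuous_real_polymonial_function[OF p(1)] .
        then have "((\<lambda>t. p (\<psi> i (ts @ [t]))) \<longlongrightarrow> p (\<psi> (Suc i) ts)) U"
          using \<psi>lim isCont_tendsto_compose by blast
        moreover have "((\<lambda>t. p (\<psi> i (ts @ [t]))) \<longlongrightarrow> 0) U"
          using that unfolding fp by (rule tendsto_eventually)
        ultimately show ?thesis using tendsto_unique[OF Ub] unfolding fp by blast
      qed
      then have "iter_ev U e (\<lambda>ts. f (\<psi> (Suc i) ts) = 0)" by (rule iter_ev_mono[OF ev])
      then show "f \<in> P (Suc i)" using f by (simp add: P_def germ_ideal_def e_def)
    qed
    \<comment> \<open>A coordinate function in the larger ideal only: it measures the parameter that is sent to 0.\<close>
    define y where "y = restrict (\<lambda>x. x \<bullet> b e - c e) X"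
    have y: "y \<in> carrier (polynomial_function_ring X)"
    proof -
      have "real_polynomial_function (\<lambda>x. x \<bullet> b e - c e)"
        by (intro real_polynomial_function_diff real_polynomial_function.intros(1,2) bounded_linear_inner_left)
      then show ?thesis unfolding y_def polynomial_function_ring_def by auto
    qed
    have yv: "y (\<psi> i ts) = \<psi> i ts \<bullet> b e - c e" for i ts using \<psi>K K(2) by (auto simp: y_def)
    have "iter_ev U e (\<lambda>ts. y (\<psi> (Suc i) ts) = 0)"
      by (rule iter_ev_all[OF _ ok]) (use coord[of "Suc i"] i in \<open>auto simp: yv e_def\<close>)
    then have in1: "y \<in> P (Suc i)" using y by (simp add: P_def germ_ideal_def e_def)
    have "iter_ev U (Suc e) (\<lambda>ts. \<not> y (\<psi> i ts) = 0)"
    proof (rule iter_ev_all[OF _ ok])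
      fix ts assume ts: "length ts = Suc e" "\<forall>t\<in>set ts. ok t"
      then have "ts ! e \<in> set ts" by simp
      then have "ts ! e > 0" using ts by (auto simp: ok_def)
      then show "\<not> y (\<psi> i ts) = 0" using coord[of i ts e] ts e i by (auto simp: yv)
    qed
    then have "y \<notin> P i" unfolding iter_ev_not[OF U(2)] by (simp add: P_def germ_ideal_def e del: iter_ev.simps)
    then show "P i \<noteq> P (Suc i)" using in1 by blast
  qed
  ultimately show ?thesis
    unfolding semialgebraic_dim_def krull_dim_def by (intro SUP_upper) auto
qed

section \<open>Algebraic relations between coordinates\<close>

lemma Baire_closed_cover:
  fixes S :: "nat \<Rightarrow> 'a::euclidean_space set"
  assumes cl: "\<And>n. closed (S n)" and U: "open U" "U \<noteq> {}" "U \<subseteq> (\<Union>n. S n)"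
  shows "\<exists>n. interior (S n) \<noteq> {}"
proof (rule ccontr)
  assume n: "\<nexists>n. interior (S n) \<noteq> {}"
  have "UNIV \<subseteq> closure (\<Inter>(range (\<lambda>n. - S n)))"
  proof (rule Baire)
    fix T assume "T \<in> range (\<lambda>n. - S n)"
    then obtain m where T: "T = - S m" by auto
    then show "openin (top_of_set UNIV) T \<and> UNIV \<subseteq> closure T"
      using n cl[of m] by (auto simp: closure_complement)
  qed auto
  then have "U \<inter> (\<Inter>(range (\<lambda>n. - S n))) \<noteq> {}"
    using U(1,2) open_Int_closure_eq_empty[of U "\<Inter>(range (\<lambda>n. - S n))"] by auto
  then show False using U(3) by auto
qed

text \<open>The orthogonal projection to the coordinates in \<open>J\<close>, for a set \<open>J\<close> of basis vectors.\<close>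

definition coord_proj :: "'a::euclidean_space set \<Rightarrow> 'a \<Rightarrow> 'a" where
  "coord_proj J x = (\<Sum>b\<in>J. (x \<bullet> b) *\<^sub>R b)"

lemma coord_proj_inner:
  assumes "J \<subseteq> Basis" "b \<in> Basis"
  shows "coord_proj J x \<bullet> b = (if b \<in> J then x \<bullet> b else 0)"
proof -
  have "finite J" using finite_subset[OF assms(1) finite_Basis] .
  have "coord_proj J x \<bullet> b = (\<Sum>i\<in>J. (x \<bullet> i) * (i \<bullet> b))" by (simp add: coord_proj_def inner_sum_left)
  also have "\<dots> = (\<Sum>i\<in>J. if i = b then x \<bullet> b else 0)"
    using assms by (intro sum.cong) (auto simp: inner_Basis)
  finally show ?thesis using \<open>finite J\<close> by simp
qed

lemma linear_coord_proj: "linear (coord_proj J)"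
  unfolding coord_proj_def by (intro linear_compose_sum ballI) (auto intro!: linearI simp: inner_left_distrib scaleR_left_distrib)

lemma in_plus_span_iff:
  assumes "J \<subseteq> Basis"
  shows "(\<exists>w\<in>span (Basis - J). x + w \<in> X) \<longleftrightarrow> (\<exists>y\<in>X. coord_proj J y = coord_proj J x)"
proof -
  have sp: "span (Basis - J) = {w. \<forall>b\<in>Basis. b \<notin> Basis - J \<longrightarrow> w \<bullet> b = 0}" by (rule span_substd_basis) auto
  have eq: "coord_proj J y = coord_proj J x \<longleftrightarrow> y - x \<in> span (Basis - J)" for x y
    unfolding sp euclidean_eq_iff[of "coord_proj J y"] using coord_proj_inner[OF assms] assms
    by (auto simp: inner_diff_left)
  show ?thesis
  proof
    assume "\<exists>w\<in>span (Basis - J). x + w \<in> X"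
    then obtain w where "w \<in> span (Basis - J)" "x + w \<in> X" by auto
    then show "\<exists>y\<in>X. coord_proj J y = coord_proj J x" using eq by (intro bexI[of _ "x + w"]) auto
  next
    assume "\<exists>y\<in>X. coord_proj J y = coord_proj J x"
    then obtain y where "y \<in> X" "coord_proj J y = coord_proj J x" by auto
    then show "\<exists>w\<in>span (Basis - J). x + w \<in> X" using eq by (intro bexI[of _ "y - x"]) auto
  qed
qed

text \<open>If \<open>J\<close> has more elements than the dimension of \<open>X\<close>, then the coordinates in \<open>J\<close> are algebraically dependent on
\<open>X\<close>: the relation is the polynomial \<open>\<lambda>x. h (coord_proj J x + w)\<close>, which only involves these coordinates.\<close>

lemma algebraic_relation:
  fixes X :: "'a::euclidean_space set"
  assumes X: "closed X" "semialgebraic X" and J: "J \<subseteq> Basis" "semialgebraic_dim X < ereal (real (card J))"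
  shows "\<exists>h w. real_polynomial_function h \<and> (\<exists>z. h (coord_proj J z + w) \<noteq> 0) \<and> (\<forall>x\<in>X. h (coord_proj J x + w) = 0)"
proof -
  \<comment> \<open>The cylinder over the projection of \<open>K\<close>.\<close>
  define S where "S K = {x. \<exists>y\<in>K. coord_proj J y = coord_proj J x}" for K
  have "semialgebraic (S X)"
    using semialgebraic_plus_span[of "Basis - J" X] X(2) by (simp add: in_plus_span_iff[OF J(1)] S_def)
  then obtain h where h: "real_polynomial_function h" "\<exists>z. h z \<noteq> 0" "frontier (S X) \<subseteq> {x. h x = 0}"
    using semialgebraic_frontier by blast
  \<comment> \<open>Otherwise, by Baire, already the projection of a bounded part of \<open>X\<close> contains a box.\<close>
  have "interior (S X) = {}"
  proof (rule ccontr)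
    assume ne: "interior (S X) \<noteq> {}"
    define K where "K n = X \<inter> cball 0 (real n)" for n
    have KX: "compact (K n)" for n using X(1) by (auto simp: K_def intro: closed_Int_compact)
    have cont: "continuous_on A (coord_proj J)" for A :: "'a set"
      using linear_coord_proj linear_continuous_on linear_conv_bounded_linear by blast
    have "closed (S (K n))" for n
    proof -
      have "S (K n) = coord_proj J -` (coord_proj J ` K n)" unfolding S_def vimage_def image_iff by metis
      moreover have "closed (coord_proj J ` K n)"
        by (intro compact_imp_closed compact_continuous_image cont KX)
      ultimately show ?thesis using cont by (simp add: closed_vimage)
    qed
    moreover have "interior (S X) \<subseteq> (\<Union>n. S (K n))"
    proof
      fix x assume "x \<in> interior (S X)"
      then obtain y where y: "y \<in> X" "coord_proj J y = coord_proj J x" using interior_subset by (auto simp: S_def)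
      obtain n where "norm y \<le> real n" using real_arch_simple by blast
      then show "x \<in> (\<Union>n. S (K n))" using y by (auto simp: S_def K_def intro!: exI[of _ n] bexI[of _ y])
    qed
    ultimately obtain n where "interior (S (K n)) \<noteq> {}"
      using Baire_closed_cover[of "\<lambda>n. S (K n)" "interior (S X)"] ne by auto
    then obtain a \<delta> where a: "0 < \<delta>" "ball a \<delta> \<subseteq> S (K n)" by (meson all_not_in_conv mem_interior)
    obtain b where b: "bij_betw b {..<card J} J"
      using J(1) finite_subset[OF _ finite_Basis] by (metis bij_betw_from_nat_into_finite)
    have bJ: "b j \<in> J" if "j < card J" for j using b that bij_betwE by blast
    define \<epsilon> where "\<epsilon> = \<delta> / (real (card J) + 1)"
    have "ereal (real (card J)) \<le> semialgebraic_dim X"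
    proof (rule krull_dim_polynomial_function_ring_ge[where K = "K n" and b = b and c = "\<lambda>j. a \<bullet> b j" and \<epsilon> = \<epsilon>])
      show "compact (K n)" by (rule KX)
      show "K n \<subseteq> X" by (auto simp: K_def)
      have "a \<in> S (K n)" using a by auto
      then show "K n \<noteq> {}" by (auto simp: S_def)
      show \<epsilon>: "0 < \<epsilon>" using a(1) by (simp add: \<epsilon>_def add_nonneg_pos)
      fix ts :: "real list" assume ts: "length ts = card J" "\<forall>t\<in>set ts. 0 < t \<and> t < \<epsilon>"
      define x where "x = a + (\<Sum>j<card J. (ts ! j) *\<^sub>R b j)"
      have tsj: "0 < ts ! j" "ts ! j < \<epsilon>" if "j < card J" for j using ts that by auto
      have "norm (\<Sum>j<card J. (ts ! j) *\<^sub>R b j) \<le> (\<Sum>j<card J. \<epsilon>)"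
      proof (intro sum_norm_le)
        fix j assume "j \<in> {..<card J}"
        then have j: "j < card J" by simp
        then have "b j \<in> Basis" using bJ[OF j] J(1) by blast
        then have "norm (b j) = 1" "0 < ts ! j" "ts ! j < \<epsilon>" using tsj[OF j] by simp_all
        then show "norm ((ts ! j) *\<^sub>R b j) \<le> \<epsilon>" by simp
      qed
      also have "\<dots> < \<delta>" using a(1) by (simp add: \<epsilon>_def field_simps)
      finally have "x \<in> ball a \<delta>" by (simp add: x_def dist_norm)
      then obtain y where y: "y \<in> K n" "coord_proj J y = coord_proj J x" using a(2) by (auto simp: S_def)
      have "y \<bullet> b i = a \<bullet> b i + ts ! i" if i: "i < card J" for i
      proof -
        have bi: "b i \<in> J" "b i \<in> Basis" using bJ[OF i] J(1) by auto
        have "y \<bullet> b i = x \<bullet> b i"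
          using coord_proj_inner[OF J(1) bi(2), of y] coord_proj_inner[OF J(1) bi(2), of x] y(2) bi by simp
        also have "\<dots> = a \<bullet> b i + (\<Sum>j<card J. (ts ! j) * (b j \<bullet> b i))"
          by (simp add: x_def inner_left_distrib inner_sum_left)
        also have "(\<Sum>j<card J. (ts ! j) * (b j \<bullet> b i)) = (\<Sum>j<card J. if j = i then ts ! i else 0)"
        proof (intro sum.cong refl)
          fix j assume "j \<in> {..<card J}"
          then have j: "j < card J" by simp
          then have "b j = b i \<longleftrightarrow> j = i" using b i by (auto simp: bij_betw_def inj_on_def)
          moreover have "b j \<in> Basis" using bJ[OF j] J(1) by auto
          ultimately show "(ts ! j) * (b j \<bullet> b i) = (if j = i then ts ! i else 0)" using bi by (auto simp: inner_Basis)
        qed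
        finally show ?thesis using i by simp
      qed
      then show "\<exists>x\<in>K n. \<forall>j<card J. x \<bullet> b j = a \<bullet> b j + ts ! j" using y(1) by blast
    qed
    then show False using J(2) by simp
  qed
  then have hS: "h x = 0" if "x \<in> S X" for x
    using that h(3) closure_subset by (fastforce simp: frontier_def)
  obtain z where z: "h z \<noteq> 0" using h(2) by blast
  \<comment> \<open>Fix the variables outside \<open>J\<close> at a point where \<open>h\<close> does not vanish.\<close>
  define w where "w = z - coord_proj J z"
  have idem: "coord_proj J (coord_proj J x) = coord_proj J x" for x
    by (rule euclidean_eqI) (simp add: coord_proj_inner[OF J(1)])
  have Jw: "coord_proj J w = 0"
    unfolding w_def by (simp add: linear_diff[OF linear_coord_proj] idem)
  have "h (coord_proj J x + w) = 0" if "x \<in> X" for x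
  proof -
    have "coord_proj J (coord_proj J x + w) = coord_proj J x"
      by (simp add: linear_add[OF linear_coord_proj] idem Jw)
    then have "coord_proj J x + w \<in> S X" using that by (auto simp: S_def intro!: bexI[of _ x])
    then show ?thesis by (rule hS)
  qed
  moreover have "h (coord_proj J z + w) \<noteq> 0" using z by (simp add: w_def)
  ultimately show ?thesis using h(1) by blast
qed

section \<open>Linear combinations of functions on a set\<close>

text \<open>The functions that agree on \<open>X\<close> with a linear combination of functions in \<open>S\<close>. Equality is only required on \<open>X\<close>, so
this is the span of the restrictions to \<open>X\<close>.\<close>

inductive lincomb :: "'x set \<Rightarrow> ('x \<Rightarrow> real) set \<Rightarrow> ('x \<Rightarrow> real) \<Rightarrow> bool" for X S where
  lincomb_zero: "(\<And>x. x \<in> X \<Longrightarrow> f x = 0) \<Longrightarrow> lincomb X S f"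
| lincomb_plus: "lincomb X S f \<Longrightarrow> g \<in> S \<Longrightarrow> (\<And>x. x \<in> X \<Longrightarrow> f' x = f x + c * g x) \<Longrightarrow> lincomb X S f'"

lemma lincomb_cong:
  assumes "lincomb X S f" "\<And>x. x \<in> X \<Longrightarrow> f' x = f x"
  shows "lincomb X S f'"
  using assms
proof cases
  case lincomb_zero
  then show ?thesis using assms(2) by (intro lincomb.lincomb_zero) simp
next
  case (lincomb_plus h g c)
  then show ?thesis using assms(2) by (intro lincomb.lincomb_plus[of X S h g f' c]) simp_all
qed

lemma lincomb_base: "g \<in> S \<Longrightarrow> lincomb X S g"
  by (rule lincomb_plus[OF lincomb_zero[of X "\<lambda>_. 0"], of g S g 1]) auto

lemma lincomb_add:
  assumes "lincomb X S f" "lincomb X S g"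
  shows "lincomb X S (\<lambda>x. f x + g x)"
  using assms(2)
proof induction
  case (lincomb_zero g)
  then show ?case using lincomb_cong[OF assms(1)] by simp
next
  case (lincomb_plus h g h' c)
  show ?case by (rule lincomb.lincomb_plus[OF lincomb_plus.IH, of g _ c]) (use lincomb_plus in simp_all)
qed

lemma lincomb_scale:
  assumes "lincomb X S f"
  shows "lincomb X S (\<lambda>x. k * f x)"
  using assms
proof induction
  case (lincomb_zero f)
  then show ?case by (intro lincomb.lincomb_zero) simp
next
  case (lincomb_plus f g f' c)
  show ?case by (rule lincomb.lincomb_plus[OF lincomb_plus.IH, of g _ "k * c"]) (use lincomb_plus in \<open>simp_all add: algebra_simps\<close>)
qed

lemma lincomb_sum:
  "finite I \<Longrightarrow> (\<And>i. i \<in> I \<Longrightarrow> lincomb X S (f i)) \<Longrightarrow> lincomb X S (\<lambda>x. \<Sum>i\<in>I. f i x)"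
  by (induction rule: finite_induct) (auto intro: lincomb_zero lincomb_add)

lemma lincomb_trans:
  assumes "lincomb X S f" "\<And>g. g \<in> S \<Longrightarrow> lincomb X T g"
  shows "lincomb X T f"
  using assms(1)
proof induction
  case (lincomb_zero f)
  then show ?case by (rule lincomb.lincomb_zero)
next
  case (lincomb_plus f g f' c)
  show ?case
    by (rule lincomb_cong[OF lincomb_add[OF lincomb_plus.IH lincomb_scale[OF assms(2)[OF lincomb_plus.hyps(2)], of c]]])
      (rule lincomb_plus.hyps(3))
qed

lemma lincomb_subset_domain:
  assumes "lincomb Y S f" "X \<subseteq> Y"
  shows "lincomb X S f"
  using assms(1)
proof induction
  case (lincomb_plus f g f' c)
  show ?case by (rule lincomb.lincomb_plus[OF lincomb_plus.IH lincomb_plus.hyps(2), of _ c]) (use lincomb_plus.hyps(3) assms(2) in auto)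
qed (use assms(2) in \<open>auto intro: lincomb.lincomb_zero\<close>)

text \<open>Products, where the factors may be composed with maps into their domains; this covers both pointwise products on one set
and tensor products on a product of two sets.\<close>

lemma lincomb_times:
  assumes f: "lincomb X S f" and g: "lincomb Y T g"
    and st: "\<And>s t. s \<in> S \<Longrightarrow> t \<in> T \<Longrightarrow> lincomb Z R (\<lambda>z. s (\<pi> z) * t (\<rho> z))"
    and Z: "\<And>z. z \<in> Z \<Longrightarrow> \<pi> z \<in> X" "\<And>z. z \<in> Z \<Longrightarrow> \<rho> z \<in> Y"
  shows "lincomb Z R (\<lambda>z. f (\<pi> z) * g (\<rho> z))"
  using f
proof induction
  case (lincomb_zero f)
  then show ?case using Z by (intro lincomb.lincomb_zero) simp
next
  case (lincomb_plus f s f' c)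
  note s = lincomb_plus.hyps(2)
  have "lincomb Z R (\<lambda>z. s (\<pi> z) * g (\<rho> z))"
    using g
  proof induction
    case (lincomb_zero g)
    then show ?case using Z by (intro lincomb.lincomb_zero) simp
  next
    case (lincomb_plus g t g' d)
    show ?case
      by (rule lincomb_cong[OF lincomb_add[OF lincomb_plus.IH lincomb_scale[OF st[OF s lincomb_plus.hyps(2)], of d]]])
        (simp add: lincomb_plus.hyps(3) Z algebra_simps)
  qed
  from lincomb_cong[OF lincomb_add[OF lincomb_plus.IH lincomb_scale[OF this, of c]]]
  show ?case by (simp add: lincomb_plus.hyps(3) Z algebra_simps)
qed

lemma lincomb_insert:
  assumes "lincomb X (insert s S) f"
  shows "\<exists>d. lincomb X S (\<lambda>x. f x - d * s x)"
  using assms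
proof induction
  case (lincomb_zero f)
  then show ?case by (intro exI[of _ 0] lincomb.lincomb_zero) simp
next
  case (lincomb_plus f g f' c)
  then obtain d where d: "lincomb X S (\<lambda>x. f x - d * s x)" by blast
  show ?case
  proof (cases "g = s")
    case True
    then show ?thesis
      by (intro exI[of _ "d + c"] lincomb_cong[OF d]) (simp add: lincomb_plus.hyps(3) algebra_simps)
  next
    case False
    then have "g \<in> S" using lincomb_plus.hyps(2) by simp
    then show ?thesis
      by (intro exI[of _ d] lincomb.lincomb_plus[OF d, of g _ c]) (simp_all add: lincomb_plus.hyps(3) algebra_simps)
  qed
qed

lemma lincomb_empty: "lincomb X {} f \<Longrightarrow> x \<in> X \<Longrightarrow> f x = 0"
  by (induction rule: lincomb.induct) auto

text \<open>More functions than spanning functions are linearly dependent: Gaussian elimination of one spanning function at a time.\<close>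

lemma lincomb_dependent:
  fixes g :: "'i \<Rightarrow> 'x \<Rightarrow> real"
  assumes "finite S" "finite A" "card S < card A" "\<And>a. a \<in> A \<Longrightarrow> lincomb X S (g a)"
  shows "\<exists>c. (\<exists>a\<in>A. c a \<noteq> 0) \<and> (\<forall>x\<in>X. (\<Sum>a\<in>A. c a * g a x) = 0)"
  using assms
proof (induction S arbitrary: A g rule: finite_induct)
  case empty
  then have "A \<noteq> {}" by auto
  then show ?case using lincomb_empty[OF empty(3)] by (intro exI[of _ "\<lambda>_. 1"]) auto
next
  case (insert s S)
  have "\<exists>d. \<forall>a\<in>A. lincomb X S (\<lambda>x. g a x - d a * s x)"
    using lincomb_insert[OF insert.prems(3)] by (intro bchoice) blast
  then obtain d where d: "\<And>a. a \<in> A \<Longrightarrow> lincomb X S (\<lambda>x. g a x - d a * s x)" by blast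
  have cardA: "Suc (card S) < card A" using insert by simp
  show ?case
  proof (cases "\<forall>a\<in>A. d a = 0")
    case True
    then have "lincomb X S (g a)" if "a \<in> A" for a using d[OF that] that by simp
    then show ?thesis using insert.IH[of A g] insert.prems(1) cardA by simp
  next
    case False
    then obtain a0 where a0: "a0 \<in> A" "d a0 \<noteq> 0" by blast
    define h where "h a x = g a x - (d a / d a0) * g a0 x" for a x
    have "lincomb X S (h a)" if a: "a \<in> A - {a0}" for a
    proof -
      have "a \<in> A" using a by simp
      from lincomb_add[OF d[OF this] lincomb_scale[OF d[OF a0(1)], of "- (d a / d a0)"]]
      show ?thesis by (rule lincomb_cong) (use a0(2) in \<open>simp add: h_def field_simps\<close>)
    qed
    moreover have "finite (A - {a0})" "card S < card (A - {a0})" using insert.prems(1) cardA a0(1) by auto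
    ultimately obtain c where c: "\<exists>a\<in>A - {a0}. c a \<noteq> 0" "\<forall>x\<in>X. (\<Sum>a\<in>A - {a0}. c a * h a x) = 0"
      using insert.IH[of "A - {a0}" h] by blast
    define c' where "c' a = (if a = a0 then - (\<Sum>a\<in>A - {a0}. c a * (d a / d a0)) else c a)" for a
    have "(\<Sum>a\<in>A. c' a * g a x) = 0" if "x \<in> X" for x
    proof -
      have "(\<Sum>a\<in>A. c' a * g a x) = c' a0 * g a0 x + (\<Sum>a\<in>A - {a0}. c' a * g a x)"
        using insert.prems(1) a0(1) by (rule sum.remove)
      also have "(\<Sum>a\<in>A - {a0}. c' a * g a x) = (\<Sum>a\<in>A - {a0}. c a * g a x)"
        by (intro sum.cong) (auto simp: c'_def)
      also have "c' a0 * g a0 x + \<dots> = (\<Sum>a\<in>A - {a0}. c a * h a x)"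
        by (simp add: c'_def h_def sum_distrib_right sum_subtractf right_diff_distrib mult.assoc)
      finally show ?thesis using c(2) that by simp
    qed
    moreover have "\<exists>a\<in>A. c' a \<noteq> 0" using c(1) by (auto simp: c'_def)
    ultimately show ?thesis by blast
  qed
qed

lemma lincomb_image_finite:
  assumes "lincomb X (m ` E) f"
  shows "\<exists>A c. finite A \<and> A \<subseteq> E \<and> (\<forall>x\<in>X. f x = (\<Sum>a\<in>A. c a * m a x))"
  using assms
proof induction
  case (lincomb_zero f)
  then show ?case by (intro exI[of _ "{}"]) simp
next
  case (lincomb_plus f g f' k)
  then obtain A c where A: "finite A" "A \<subseteq> E" "\<And>x. x \<in> X \<Longrightarrow> f x = (\<Sum>a\<in>A. c a * m a x)" by blast
  obtain e where e: "e \<in> E" "g = m e" using lincomb_plus.hyps(2) by blast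
  define c' where "c' a = (if a \<in> A then c a else 0) + (if a = e then k else 0)" for a
  have "f' x = (\<Sum>a\<in>insert e A. c' a * m a x)" if x: "x \<in> X" for x
  proof -
    have "(\<Sum>a\<in>insert e A. c' a * m a x) = (\<Sum>a\<in>insert e A. (if a \<in> A then c a * m a x else 0)) + (\<Sum>a\<in>insert e A. if a = e then k * m e x else 0)"
      unfolding c'_def sum.distrib[symmetric] by (intro sum.cong) (auto simp: algebra_simps)
    also have "(\<Sum>a\<in>insert e A. (if a \<in> A then c a * m a x else 0)) = (\<Sum>a\<in>A. c a * m a x)"
      using A(1) by (intro sum.mono_neutral_cong_right) auto
    also have "(\<Sum>a\<in>insert e A. if a = e then k * m e x else 0) = k * m e x" using A(1) by simp
    finally show ?thesis using A(3)[OF x] lincomb_plus.hyps(3)[OF x] e by simp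
  qed
  then show ?case using A e by (intro exI[of _ "insert e A"] exI[of _ c']) auto
qed

section \<open>Monomials and leading monomials\<close>

text \<open>Exponent vectors supported in \<open>J\<close>. Exponents are total functions; those of interest vanish outside a finite set.\<close>

definition expo :: "'a set \<Rightarrow> ('a \<Rightarrow> nat) set" where
  "expo J = {a. \<forall>b. b \<notin> J \<longrightarrow> a b = 0}"

text \<open>The monomial with exponents \<open>a\<close> in the coordinates with respect to the standard basis.\<close>

definition monomial :: "('a::euclidean_space \<Rightarrow> nat) \<Rightarrow> 'a \<Rightarrow> real" where
  "monomial a x = (\<Prod>b\<in>Basis. (x \<bullet> b) ^ a b)"

lemma monomial_add: "monomial (\<lambda>b. a b + a' b) x = monomial a x * monomial a' x"
  by (simp add: monomial_def power_add prod.distrib)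

lemma monomial_0: "monomial (\<lambda>b. 0) x = 1"
  by (simp add: monomial_def)

lemma monomial_single: "b \<in> Basis \<Longrightarrow> monomial (\<lambda>i. if i = b then 1 else 0) x = x \<bullet> b"
  by (simp add: monomial_def if_distrib[of "\<lambda>n. _ ^ n"] prod.delta cong: if_cong)

lemma real_polynomial_monomials:
  fixes h :: "'a::euclidean_space \<Rightarrow> real"
  assumes "real_polynomial_function h" and J: "J \<subseteq> Basis"
  shows "lincomb UNIV (monomial ` expo J) (\<lambda>x. h (coord_proj J x + w))"
  using assms(1)
proof induction
  case (linear f)
  interpret f: bounded_linear f by fact
  have fin: "finite J" using finite_subset[OF J finite_Basis] .
  have "lincomb UNIV (monomial ` expo J) (\<lambda>x. f b * (x \<bullet> b))" if "b \<in> J" for b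
  proof (rule lincomb_scale)
    have "b \<in> Basis" using that J by blast
    then have "(\<lambda>x. x \<bullet> b) = monomial (\<lambda>i. if i = b then 1 else 0)"
      by (intro ext) (rule monomial_single[symmetric])
    moreover have "(\<lambda>i. if i = b then 1 else 0) \<in> expo J" using that by (auto simp: expo_def)
    ultimately show "lincomb UNIV (monomial ` expo J) (\<lambda>x. x \<bullet> b)" by (auto intro: lincomb_base)
  qed
  then have 1: "lincomb UNIV (monomial ` expo J) (\<lambda>x. \<Sum>b\<in>J. f b * (x \<bullet> b))" using fin by (intro lincomb_sum)
  have "monomial (\<lambda>b. 0) \<in> monomial ` expo J" by (auto simp: expo_def)
  from lincomb_scale[OF lincomb_base[OF this], of UNIV "f w"]
  have 2: "lincomb UNIV (monomial ` expo J) (\<lambda>x. f w)" by (simp add: monomial_0)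
  have "f (coord_proj J x + w) = (\<Sum>b\<in>J. f b * (x \<bullet> b)) + f w" for x
    by (simp add: f.add coord_proj_def f.sum f.scaleR mult.commute)
  then show ?case using lincomb_add[OF 1 2] by simp
next
  case (const c)
  have "monomial (\<lambda>b. 0) \<in> monomial ` expo J" by (auto simp: expo_def)
  from lincomb_scale[OF lincomb_base[OF this], of UNIV c] show ?case by (simp add: monomial_0)
next
  case (add f g)
  then show ?case by (intro lincomb_add)
next
  case (mult f g)
  show ?case
  proof (rule lincomb_times[OF mult.IH, where \<pi> = "\<lambda>x. x" and \<rho> = "\<lambda>x. x"])
    fix s t assume "s \<in> monomial ` expo J" "t \<in> monomial ` expo J"
    then obtain a a' where a: "a \<in> expo J" "s = monomial a" "a' \<in> expo J" "t = monomial a'" by blast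
    then have "(\<lambda>x. s x * t x) = monomial (\<lambda>b. a b + a' b)" by (simp add: monomial_add fun_eq_iff)
    moreover have "(\<lambda>b. a b + a' b) \<in> expo J" using a by (auto simp: expo_def)
    ultimately show "lincomb UNIV (monomial ` expo J) (\<lambda>x. s x * t x)" by (auto intro: lincomb_base)
  qed auto
qed

text \<open>Positive weights that distinguish all exponent vectors with entries below \<open>B\<close>: take powers of \<open>B\<close>, so that the weight
is the number with these digits.\<close>

lemma separating_weights:
  assumes "finite I" "0 < (B::nat)"
  shows "\<exists>w. (\<forall>i\<in>I. 1 \<le> w i) \<and> inj_on (\<lambda>a. \<Sum>i\<in>I. a i * w i) {a \<in> expo I. \<forall>i. a i < B}"
  using assms(1)
proof induction
  case empty
  then show ?case by (auto simp: expo_def inj_on_def)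
next
  case (insert j I)
  then obtain w where w: "\<forall>i\<in>I. 1 \<le> w i" and inj: "inj_on (\<lambda>a. \<Sum>i\<in>I. a i * w i) {a \<in> expo I. \<forall>i. a i < B}" by blast
  define w' where "w' i = (if i = j then 1 else B * w i)" for i
  have sum: "(\<Sum>i\<in>insert j I. a i * w' i) = a j + B * (\<Sum>i\<in>I. a i * w i)" for a :: "_ \<Rightarrow> nat"
  proof -
    have "(\<Sum>i\<in>I. a i * w' i) = (\<Sum>i\<in>I. B * (a i * w i))"
      using insert.hyps(2) by (intro sum.cong) (auto simp: w'_def)
    then show ?thesis using insert.hyps by (simp add: w'_def sum_distrib_left)
  qed
  have "inj_on (\<lambda>a. \<Sum>i\<in>insert j I. a i * w' i) {a \<in> expo (insert j I). \<forall>i. a i < B}"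
  proof (rule inj_onI)
    fix a a' assume a: "a \<in> {a \<in> expo (insert j I). \<forall>i. a i < B}" "a' \<in> {a \<in> expo (insert j I). \<forall>i. a i < B}"
      and "(\<Sum>i\<in>insert j I. a i * w' i) = (\<Sum>i\<in>insert j I. a' i * w' i)"
    then have eq: "a j + B * (\<Sum>i\<in>I. a i * w i) = a' j + B * (\<Sum>i\<in>I. a' i * w i)" by (simp only: sum)
    have lt: "a j < B" "a' j < B" using a by auto
    have "a j = (a j + B * (\<Sum>i\<in>I. a i * w i)) mod B" using lt by simp
    also have "\<dots> = a' j" unfolding eq using lt by simp
    finally have j: "a j = a' j" .
    then have s: "(\<Sum>i\<in>I. a i * w i) = (\<Sum>i\<in>I. a' i * w i)" using eq assms(2) by simp
    have upd: "(\<Sum>i\<in>I. (b(j := 0)) i * w i) = (\<Sum>i\<in>I. b i * w i)" for b :: "_ \<Rightarrow> nat"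
      using insert.hyps(2) by (intro sum.cong) auto
    have "a(j := 0) = a'(j := 0)"
    proof (rule inj_onD[OF inj])
      show "(\<Sum>i\<in>I. (a(j := 0)) i * w i) = (\<Sum>i\<in>I. (a'(j := 0)) i * w i)" unfolding upd by (rule s)
    qed (use a assms(2) in \<open>auto simp: expo_def\<close>)
    then show "a = a'" using j by (metis fun_upd_triv fun_upd_upd)
  qed
  moreover have "\<forall>i\<in>insert j I. 1 \<le> w' i" using w assms(2) by (auto simp: w'_def)
  ultimately show ?case by blast
qed

text \<open>The weighted degree of a monomial. It replaces a monomial order: on a finite set of monomials, suitable weights
have no ties, and being a natural number the weight allows induction.\<close>

definition weight :: "('a::euclidean_space \<Rightarrow> nat) \<Rightarrow> ('a \<Rightarrow> nat) \<Rightarrow> nat" where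
  "weight w a = (\<Sum>b\<in>Basis. a b * w b)"

lemma weight_add: "weight w (\<lambda>b. a b + a' b) = weight w a + weight w a'"
  by (simp add: weight_def sum.distrib algebra_simps)

text \<open>A relation expresses its monomial of largest weight by monomials of smaller weight.\<close>

lemma leading_monomial:
  assumes A: "finite A" "A \<subseteq> E" and c: "\<exists>a\<in>A. c a \<noteq> 0" and 0: "\<And>x. x \<in> X \<Longrightarrow> (\<Sum>a\<in>A. c a * monomial a x) = 0"
    and inj: "inj_on (weight w) A"
  shows "\<exists>a\<in>A. lincomb X (monomial ` {a'\<in>E. weight w a' < weight w a}) (monomial a)"
proof -
  define A' where "A' = {a\<in>A. c a \<noteq> 0}"
  have A': "finite A'" "A' \<noteq> {}" "A' \<subseteq> A" using A c by (auto simp: A'_def)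
  have "Max (weight w ` A') \<in> weight w ` A'" using A' by (intro Max_in) auto
  then obtain a where a: "a \<in> A'" "weight w a = Max (weight w ` A')" by force
  have max: "weight w a' \<le> weight w a" if "a' \<in> A'" for a' using that A' a(2) by simp
  have ca: "c a \<noteq> 0" using a(1) by (simp add: A'_def)
  have less: "weight w a' < weight w a" if "a' \<in> A' - {a}" for a'
  proof -
    have "weight w a' \<noteq> weight w a" using inj_onD[OF inj, of a' a] that a(1) A' by auto
    then show ?thesis using max[of a'] that by simp
  qed
  have 1: "lincomb X (monomial ` {a'\<in>E. weight w a' < weight w a}) (\<lambda>x. \<Sum>a'\<in>A' - {a}. (- c a' / c a) * monomial a' x)"
    using less A A' by (intro lincomb_sum lincomb_scale lincomb_base) auto
  have "monomial a x = (\<Sum>a'\<in>A' - {a}. (- c a' / c a) * monomial a' x)" if "x \<in> X" for x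
  proof -
    have "0 = (\<Sum>a\<in>A. c a * monomial a x)" using 0[OF that] by simp
    also have "\<dots> = (\<Sum>a\<in>A'. c a * monomial a x)"
      using A by (intro sum.mono_neutral_right) (auto simp: A'_def)
    also have "\<dots> = c a * monomial a x + (\<Sum>a'\<in>A' - {a}. c a' * monomial a' x)" using A'(1) a(1) by (rule sum.remove)
    finally have "monomial a x = - (\<Sum>a'\<in>A' - {a}. c a' * monomial a' x) / c a" using ca by (simp add: field_simps)
    then show ?thesis by (simp add: sum_divide_distrib sum_negf)
  qed
  then show ?thesis using lincomb_cong[OF 1] a(1) A' by blast
qed

text \<open>One weight serves the relations for all sets \<open>J\<close> of \<open>k + 1\<close> coordinates. The leading exponents \<open>l J\<close> are supported in \<open>J\<close>.\<close>

lemma leading_exponents: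
  fixes X :: "'a::euclidean_space set"
  assumes X: "closed X" "semialgebraic X" "semialgebraic_dim X \<le> ereal (real k)"
  shows "\<exists>w l. (\<forall>b\<in>Basis. 1 \<le> w b) \<and> (\<forall>J. J \<subseteq> Basis \<and> card J = Suc k \<longrightarrow>
     l J \<in> expo J \<and> lincomb X (monomial ` {a\<in>expo Basis. weight w a < weight w (l J)}) (monomial (l J)))"
proof -
  define \<J> where "\<J> = {J. J \<subseteq> (Basis::'a set) \<and> card J = Suc k}"
  have fin: "finite \<J>" unfolding \<J>_def by (rule finite_subset[of _ "Pow Basis"]) auto
  have "\<exists>Ac. finite (fst Ac) \<and> fst Ac \<subseteq> expo J \<and> (\<exists>a\<in>fst Ac. snd Ac a \<noteq> 0) \<and>
      (\<forall>x\<in>X. (\<Sum>a\<in>fst Ac. snd Ac a * monomial a x) = 0)" if J: "J \<in> \<J>" for J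
  proof -
    have JB: "J \<subseteq> Basis" using J by (simp add: \<J>_def)
    have "semialgebraic_dim X < ereal (real (card J))"
      using J X(3) by (auto simp: \<J>_def intro: le_less_trans)
    then obtain h w z where h: "real_polynomial_function h" "h (coord_proj J z + w) \<noteq> 0"
      "\<And>x. x \<in> X \<Longrightarrow> h (coord_proj J x + w) = 0" using algebraic_relation[OF X(1,2) JB] by blast
    have "\<exists>A c. finite A \<and> A \<subseteq> expo J \<and> (\<forall>x\<in>UNIV. h (coord_proj J x + w) = (\<Sum>a\<in>A. c a * monomial a x))"
      by (rule lincomb_image_finite[OF real_polynomial_monomials[OF h(1) JB]])
    then obtain A c where A: "finite A" "A \<subseteq> expo J" "\<And>x. h (coord_proj J x + w) = (\<Sum>a\<in>A. c a * monomial a x)"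
      by auto
    have "\<exists>a\<in>A. c a \<noteq> 0"
    proof (rule ccontr)
      assume "\<not> ?thesis"
      then have "h (coord_proj J z + w) = 0" unfolding A(3) by (intro sum.neutral) simp
      then show False using h(2) by simp
    qed
    moreover have "(\<Sum>a\<in>A. c a * monomial a x) = 0" if "x \<in> X" for x using h(3)[OF that] A(3)[of x] by simp
    ultimately show ?thesis using A(1,2) by (intro exI[of _ "(A, c)"]) simp
  qed
  then have "\<exists>Ac. \<forall>J\<in>\<J>. finite (fst (Ac J)) \<and> fst (Ac J) \<subseteq> expo J \<and> (\<exists>a\<in>fst (Ac J). snd (Ac J) a \<noteq> 0) \<and>
      (\<forall>x\<in>X. (\<Sum>a\<in>fst (Ac J). snd (Ac J) a * monomial a x) = 0)" by (intro bchoice) blast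
  then obtain Ac where Ac: "\<And>J. J \<in> \<J> \<Longrightarrow> finite (fst (Ac J))" "\<And>J. J \<in> \<J> \<Longrightarrow> fst (Ac J) \<subseteq> expo J"
      "\<And>J. J \<in> \<J> \<Longrightarrow> \<exists>a\<in>fst (Ac J). snd (Ac J) a \<noteq> 0"
      "\<And>J x. J \<in> \<J> \<Longrightarrow> x \<in> X \<Longrightarrow> (\<Sum>a\<in>fst (Ac J). snd (Ac J) a * monomial a x) = 0" by blast
  \<comment> \<open>\<open>B\<close> exceeds all exponents that occur in the chosen relations.\<close>
  define V where "V = (\<Union>J\<in>\<J>. \<Union>a\<in>fst (Ac J). a ` Basis)"
  have finV: "finite V" using fin Ac(1) by (auto simp: V_def)
  define B where "B = Suc (Max (insert 0 V))"
  have B: "a b < B" if "J \<in> \<J>" "a \<in> fst (Ac J)" for J a b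
  proof (cases "b \<in> Basis")
    case True
    then have "a b \<in> V" using that by (auto simp: V_def)
    then show ?thesis using finV by (simp add: B_def less_Suc_eq_le)
  next
    case False
    then have "b \<notin> J" using that by (auto simp: \<J>_def)
    then show ?thesis using Ac(2)[OF that(1)] that(2) by (auto simp: B_def expo_def)
  qed
  obtain w where w: "\<forall>b\<in>Basis. 1 \<le> w b" and inj: "inj_on (weight w) {a \<in> expo (Basis::'a set). \<forall>b. a b < B}"
    using separating_weights[OF finite_Basis, of B] unfolding weight_def B_def by blast
  have "\<exists>a. a \<in> expo J \<and> lincomb X (monomial ` {a'\<in>expo Basis. weight w a' < weight w a}) (monomial a)" if J: "J \<in> \<J>" for J
  proof -
    have "expo J \<subseteq> expo Basis" using J by (auto simp: \<J>_def expo_def)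
    then have sub: "fst (Ac J) \<subseteq> expo Basis" using Ac(2)[OF J] by blast
    have "inj_on (weight w) (fst (Ac J))"
      by (rule inj_on_subset[OF inj]) (use sub B[OF J] in auto)
    from leading_monomial[OF Ac(1)[OF J] sub Ac(3)[OF J] Ac(4)[OF J] this]
    show ?thesis using Ac(2)[OF J] by blast
  qed
  then have "\<exists>l. \<forall>J\<in>\<J>. l J \<in> expo J \<and> lincomb X (monomial ` {a'\<in>expo Basis. weight w a' < weight w (l J)}) (monomial (l J))"
    by (intro bchoice) blast
  then show ?thesis using w unfolding \<J>_def by blast
qed

section \<open>Growth of the space of polynomial functions\<close>

lemma card_bounded_exponents:
  fixes m :: "'a::euclidean_space \<Rightarrow> nat"
  shows "finite {a \<in> expo Basis. \<forall>b\<in>Basis. a b \<le> m b}"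
    "card {a \<in> expo Basis. \<forall>b\<in>Basis. a b \<le> m b} \<le> (\<Prod>b\<in>Basis. m b + 1)"
proof -
  let ?f = "\<lambda>a. restrict a (Basis::'a set)" and ?P = "PiE Basis (\<lambda>b. {..m b})"
  have inj: "inj_on ?f {a \<in> expo Basis. \<forall>b\<in>Basis. a b \<le> m b}"
  proof (rule inj_onI)
    fix a a' assume a: "a \<in> {a \<in> expo Basis. \<forall>b\<in>Basis. a b \<le> m b}" "a' \<in> {a \<in> expo Basis. \<forall>b\<in>Basis. a b \<le> m b}"
      and eq: "?f a = ?f a'"
    show "a = a'"
    proof
      fix b show "a b = a' b"
        using fun_cong[OF eq, of b] a by (cases "b \<in> Basis") (auto simp: expo_def)
    qed
  qed
  have im: "?f ` {a \<in> expo Basis. \<forall>b\<in>Basis. a b \<le> m b} \<subseteq> ?P" by auto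
  have fP: "finite ?P" by (intro finite_PiE) auto
  show "finite {a \<in> expo Basis. \<forall>b\<in>Basis. a b \<le> m b}"
    using inj im fP by (meson finite_imageD finite_subset)
  have "card {a \<in> expo Basis. \<forall>b\<in>Basis. a b \<le> m b} \<le> card ?P" by (rule card_inj_on_le[OF inj im fP])
  also have "\<dots> = (\<Prod>b\<in>Basis. m b + 1)" by (simp add: card_PiE)
  finally show "card {a \<in> expo Basis. \<forall>b\<in>Basis. a b \<le> m b} \<le> (\<Prod>b\<in>Basis. m b + 1)" .
qed

text \<open>The monomials with all exponents at most \<open>N\<close> span on \<open>X\<close> a space of dimension \<open>O(N ^ k)\<close>, with constants \<open>K\<close> and \<open>C\<close>.\<close>

definition monomial_growth :: "'a::euclidean_space set \<Rightarrow> nat \<Rightarrow> nat \<Rightarrow> nat \<Rightarrow> bool" where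
  "monomial_growth X k K C \<longleftrightarrow> (\<forall>N. \<exists>S. finite S \<and> card S \<le> K * (C * N + 1) ^ k \<and>
     (\<forall>a\<in>expo Basis. (\<forall>b. a b \<le> N) \<longrightarrow> lincomb X S (monomial a)))"

text \<open>Modulo the relations, every monomial is a combination of standard monomials, those divisible by no leading monomial. A
standard monomial has large exponents in at most \<open>k\<close> variables, since \<open>k + 1\<close> variables \<open>J\<close> with large exponents
would make it divisible by the leading monomial with exponents \<open>l J\<close>.\<close>

lemma monomial_growth_exists:
  fixes X :: "'a::euclidean_space set"
  assumes X: "closed X" "semialgebraic X" "semialgebraic_dim X \<le> ereal (real k)"
  shows "\<exists>K C. 1 \<le> K \<and> monomial_growth X k K C"
proof -
  obtain w l where w: "\<And>b. b \<in> Basis \<Longrightarrow> 1 \<le> w b"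
    and l: "\<And>J. J \<subseteq> Basis \<Longrightarrow> card J = Suc k \<Longrightarrow> l J \<in> expo J"
      "\<And>J. J \<subseteq> Basis \<Longrightarrow> card J = Suc k \<Longrightarrow> lincomb X (monomial ` {a\<in>expo Basis. weight w a < weight w (l J)}) (monomial (l J))"
    using leading_exponents[OF X] by blast
  define Std where "Std W = {a\<in>expo Basis. weight w a \<le> W \<and>
    (\<forall>J. J \<subseteq> Basis \<and> card J = Suc k \<longrightarrow> (\<exists>b\<in>J. a b < l J b))}" for W
  have reduce: "a \<in> expo Basis \<Longrightarrow> weight w a \<le> W \<Longrightarrow> lincomb X (monomial ` Std W) (monomial a)" for a W
  proof (induction "weight w a" arbitrary: a rule: less_induct)
    case less
    show ?case
    proof (cases "a \<in> Std W")
      case True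
      then show ?thesis by (intro lincomb_base) simp
    next
      case False
      then obtain J where J: "J \<subseteq> Basis" "card J = Suc k" "\<And>b. b \<in> J \<Longrightarrow> l J b \<le> a b"
        using less.prems by (auto simp: Std_def not_less)
      have le: "l J b \<le> a b" for b using l(1)[OF J(1,2)] J(3) by (cases "b \<in> J") (auto simp: expo_def)
      define r where "r b = a b - l J b" for b
      have r: "r \<in> expo Basis" using less.prems(1) by (auto simp: r_def expo_def)
      have a: "a = (\<lambda>b. l J b + r b)" using le by (auto simp: r_def)
      have "lincomb X (monomial ` Std W) (\<lambda>x. monomial (l J) x * monomial r x)"
      proof (rule lincomb_times[OF l(2)[OF J(1,2)] lincomb_base[of "monomial r" "{monomial r}"], where \<pi> = "\<lambda>x. x" and \<rho> = "\<lambda>x. x"])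
        fix s t assume "s \<in> monomial ` {a \<in> expo Basis. weight w a < weight w (l J)}" "t \<in> {monomial r}"
        then obtain a' where a': "a' \<in> expo Basis" "weight w a' < weight w (l J)" "s = monomial a'" "t = monomial r" by blast
        have "weight w (\<lambda>b. a' b + r b) < weight w a" unfolding a weight_add using a'(2) by simp
        moreover have "(\<lambda>b. a' b + r b) \<in> expo Basis" using a' r by (auto simp: expo_def)
        ultimately have "lincomb X (monomial ` Std W) (monomial (\<lambda>b. a' b + r b))" using less.prems(2) by (intro less.hyps) auto
        moreover have "monomial (\<lambda>b. a' b + r b) = (\<lambda>x. s x * t x)" using a' by (simp add: fun_eq_iff monomial_add)
        ultimately show "lincomb X (monomial ` Std W) (\<lambda>x. s x * t x)" by simp
      qed auto
      moreover have "monomial a = (\<lambda>x. monomial (l J) x * monomial r x)" unfolding a by (simp add: fun_eq_iff monomial_add)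
      ultimately show ?thesis by simp
    qed
  qed
  \<comment> \<open>\<open>A\<close> bounds all exponents of the leading monomials.\<close>
  define V where "V = (\<Union>J\<in>Pow Basis. l J ` Basis)"
  define A where "A = Max (insert 0 V)"
  have finV: "finite V" by (auto simp: V_def)
  have A: "l J b \<le> A" if "J \<subseteq> Basis" "b \<in> Basis" for J b
    unfolding A_def using finV that by (intro Max_ge) (auto simp: V_def)
  define n where "n = DIM('a)"
  define box where "box W T = {a \<in> expo Basis. \<forall>b\<in>Basis. a b \<le> (if b \<in> T then W else A)}" for W and T :: "'a set"
  define \<T> where "\<T> = {T. T \<subseteq> (Basis::'a set) \<and> card T \<le> k}"
  have fT: "finite \<T>" and cT: "card \<T> \<le> 2 ^ n"
  proof -
    have "\<T> \<subseteq> Pow Basis" by (auto simp: \<T>_def)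
    then show "finite \<T>" "card \<T> \<le> 2 ^ n"
      using card_mono[of "Pow Basis" \<T>] finite_subset[of \<T> "Pow Basis"] by (auto simp: card_Pow n_def)
  qed
  have StdT: "Std W \<subseteq> (\<Union>T\<in>\<T>. box W T)" for W
  proof
    fix a assume a: "a \<in> Std W"
    \<comment> \<open>The variables with large exponents.\<close>
    define T where "T = {b\<in>Basis. A < a b}"
    have "card T \<le> k"
    proof (rule ccontr)
      assume "\<not> card T \<le> k"
      then obtain J where J: "J \<subseteq> T" "card J = Suc k" using obtain_subset_with_card_n[of "Suc k" T] by auto
      then have JB: "J \<subseteq> Basis" by (auto simp: T_def)
      have "\<exists>b\<in>J. a b < l J b" using a JB J(2) unfolding Std_def by blast
      then obtain b where b: "b \<in> J" "a b < l J b" by blast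
      then have "A < a b" using J(1) by (auto simp: T_def)
      moreover have "l J b \<le> A" using b(1) JB by (intro A[OF JB]) blast
      ultimately show False using b(2) by simp
    qed
    moreover have "a b \<le> W" if "b \<in> Basis" for b
    proof -
      have "a b \<le> a b * w b" using w[OF that] by simp
      also have "\<dots> \<le> weight w a" unfolding weight_def using that by (intro member_le_sum) auto
      also have "\<dots> \<le> W" using a by (simp add: Std_def)
      finally show ?thesis .
    qed
    ultimately have "a \<in> box W T" "T \<in> \<T>"
      using a by (auto simp: \<T>_def box_def Std_def T_def)
    then show "a \<in> (\<Union>T\<in>\<T>. box W T)" by blast
  qed
  have box: "finite (box W T)" "T \<in> \<T> \<Longrightarrow> card (box W T) \<le> (A + 1) ^ n * (W + 1) ^ k" for W T
  proof -
    show "finite (box W T)" unfolding box_def by (rule card_bounded_exponents)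
    assume T: "T \<in> \<T>"
    have "card (box W T) \<le> (\<Prod>b\<in>Basis. (if b \<in> T then W else A) + 1)"
      unfolding box_def by (rule card_bounded_exponents)
    also have "\<dots> = (\<Prod>b\<in>Basis. (if b \<in> T then W + 1 else A + 1))" by (intro prod.cong) auto
    also have "\<dots> = (\<Prod>b\<in>Basis \<inter> {b. b \<in> T}. W + 1) * (\<Prod>b\<in>Basis \<inter> - {b. b \<in> T}. A + 1)"
      by (rule prod.If_cases) simp
    also have "\<dots> = (W + 1) ^ card T * (A + 1) ^ card (Basis - T)"
      using T by (simp add: \<T>_def Int_absorb1 Diff_eq del: power_Suc)
    also have "\<dots> \<le> (W + 1) ^ k * (A + 1) ^ n"
      using T card_mono[of Basis "Basis - T"] by (intro mult_mono power_increasing) (auto simp: \<T>_def n_def)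
    finally show "card (box W T) \<le> (A + 1) ^ n * (W + 1) ^ k" by (simp add: mult.commute)
  qed
  define K where "K = 2 ^ n * (A + 1) ^ n"
  define C where "C = (\<Sum>b\<in>Basis. w b)"
  have "monomial_growth X k K C"
    unfolding monomial_growth_def
  proof
    fix N
    show "\<exists>S. finite S \<and> card S \<le> K * (C * N + 1) ^ k \<and>
     (\<forall>a\<in>expo Basis. (\<forall>b. a b \<le> N) \<longrightarrow> lincomb X S (monomial a))"
    proof (intro exI[of _ "monomial ` Std (C * N)"] conjI ballI impI)
      have fS: "finite (Std (C * N))" using StdT box(1) fT by (meson finite_UN finite_subset)
      then show "finite (monomial ` Std (C * N))" by simp
      have "card (monomial ` Std (C * N)) \<le> card (\<Union>T\<in>\<T>. box (C * N) T)"
        using card_image_le[OF fS] card_mono[OF _ StdT] box(1) fT by (meson finite_UN le_trans)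
      also have "\<dots> \<le> (\<Sum>T\<in>\<T>. card (box (C * N) T))" by (rule card_UN_le[OF fT])
      also have "\<dots> \<le> card \<T> * ((A + 1) ^ n * (C * N + 1) ^ k)"
        using sum_bounded_above[of \<T> "\<lambda>T. card (box (C * N) T)"] box(2) by simp
      also have "\<dots> \<le> 2 ^ n * ((A + 1) ^ n * (C * N + 1) ^ k)" using cT by (rule mult_le_mono1)
      finally show "card (monomial ` Std (C * N)) \<le> K * (C * N + 1) ^ k" by (simp add: K_def mult.assoc)
    next
      fix a :: "'a \<Rightarrow> nat" assume a: "a \<in> expo Basis" "\<forall>b. a b \<le> N"
      have "weight w a \<le> (\<Sum>b\<in>Basis. N * w b)" unfolding weight_def using a by (intro sum_mono mult_le_mono1) auto
      also have "\<dots> = C * N" by (simp add: C_def sum_distrib_left mult.commute)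
      finally show "lincomb X (monomial ` Std (C * N)) (monomial a)" by (rule reduce[OF a(1)])
    qed
  qed
  moreover have "1 \<le> K" by (simp add: K_def)
  ultimately show ?thesis by blast
qed

section \<open>A form vanishing on all secants\<close>

text \<open>The products of a monomial of degree at most \<open>N\<close> in the first and one of degree at most \<open>N\<close> in the second argument.\<close>

definition bidegree_monomials :: "nat \<Rightarrow> ('a::euclidean_space \<times> 'a \<Rightarrow> real) set" where
  "bidegree_monomials N = {\<lambda>p. monomial a (fst p) * monomial a' (snd p) |a a'.
     a \<in> expo Basis \<and> a' \<in> expo Basis \<and> sum a Basis \<le> N \<and> sum a' Basis \<le> N}"

lemma lincomb_bidegree_mult:
  assumes "lincomb UNIV (bidegree_monomials m) f" "lincomb UNIV (bidegree_monomials n) g"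
  shows "lincomb UNIV (bidegree_monomials (m + n)) (\<lambda>p. f p * g p)"
proof (rule lincomb_times[OF assms, where \<pi> = "\<lambda>p. p" and \<rho> = "\<lambda>p. p"])
  fix s t :: "'a \<times> 'a \<Rightarrow> real" assume "s \<in> bidegree_monomials m" "t \<in> bidegree_monomials n"
  then obtain a a' b b' where st: "s = (\<lambda>p. monomial a (fst p) * monomial a' (snd p))" "t = (\<lambda>p. monomial b (fst p) * monomial b' (snd p))"
    and e: "a \<in> expo Basis" "a' \<in> expo Basis" "b \<in> expo Basis" "b' \<in> expo Basis"
    and d: "sum a Basis \<le> m" "sum a' Basis \<le> m" "sum b Basis \<le> n" "sum b' Basis \<le> n"
    unfolding bidegree_monomials_def by blast
  let ?c = "\<lambda>i. a i + b i" and ?c' = "\<lambda>i. a' i + b' i"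
  have eq: "(\<lambda>p. s p * t p) = (\<lambda>p. monomial ?c (fst p) * monomial ?c' (snd p))"
    by (simp add: st monomial_add mult_ac)
  have "?c \<in> expo Basis" "?c' \<in> expo Basis" "sum ?c Basis \<le> m + n" "sum ?c' Basis \<le> m + n"
    using e d by (auto simp: expo_def sum.distrib add_mono)
  then have "(\<lambda>p. s p * t p) \<in> bidegree_monomials (m + n)" unfolding eq bidegree_monomials_def by blast
  then show "lincomb UNIV (bidegree_monomials (m + n)) (\<lambda>p. s p * t p)" by (rule lincomb_base)
qed auto

lemma lincomb_bidegree_one: "lincomb UNIV (bidegree_monomials n) (\<lambda>p::'a::euclidean_space \<times> 'a. 1)"
proof -
  have "(\<lambda>p::'a \<times> 'a. monomial (\<lambda>b. 0) (fst p) * monomial (\<lambda>b. 0) (snd p)) \<in> bidegree_monomials n"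
    unfolding bidegree_monomials_def by (auto simp: expo_def intro!: exI[of _ "\<lambda>b. 0"])
  from lincomb_base[OF this, of UNIV] show ?thesis by (simp add: monomial_0)
qed

lemma lincomb_bidegree_linear:
  fixes f :: "'a::euclidean_space \<Rightarrow> real"
  assumes "linear f"
  shows "lincomb UNIV (bidegree_monomials 1) (\<lambda>p. f (fst p) - f (snd p))"
proof -
  have f: "f x = (\<Sum>b\<in>Basis. f b * (x \<bullet> b))" for x
  proof -
    have "f x = f (\<Sum>b\<in>Basis. (x \<bullet> b) *\<^sub>R b)" by (simp add: euclidean_representation)
    also have "\<dots> = (\<Sum>b\<in>Basis. f b * (x \<bullet> b))"
      using assms by (simp add: linear_sum linear_cmul mult.commute)
    finally show ?thesis .
  qed
  let ?u = "\<lambda>b i. if i = b then 1 else (0::nat)"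
  have u: "?u b \<in> expo Basis" "sum (?u b) Basis \<le> 1" if "b \<in> Basis" for b :: 'a
    using that by (auto simp: expo_def)
  have z: "(\<lambda>b. 0) \<in> expo (Basis :: 'a set)" "sum (\<lambda>b::'a. 0::nat) Basis \<le> 1" by (auto simp: expo_def)
  have 1: "lincomb UNIV (bidegree_monomials 1) (\<lambda>p. f b * (fst p \<bullet> b) + - f b * (snd p \<bullet> b))" if b: "b \<in> Basis" for b
  proof (intro lincomb_add lincomb_scale)
    have "(\<lambda>p. monomial (?u b) (fst p) * monomial (\<lambda>b. 0) (snd p)) \<in> bidegree_monomials 1"
      unfolding bidegree_monomials_def using u[OF b] z by blast
    from lincomb_base[OF this, of UNIV] show "lincomb UNIV (bidegree_monomials 1) (\<lambda>p. fst p \<bullet> b)"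
      by (rule lincomb_cong) (simp only: monomial_single[OF b] monomial_0 mult_1_right)
    have "(\<lambda>p. monomial (\<lambda>b. 0) (fst p) * monomial (?u b) (snd p)) \<in> bidegree_monomials 1"
      unfolding bidegree_monomials_def using u[OF b] z by blast
    from lincomb_base[OF this, of UNIV] show "lincomb UNIV (bidegree_monomials 1) (\<lambda>p. snd p \<bullet> b)"
      by (rule lincomb_cong) (simp only: monomial_single[OF b] monomial_0 mult_1_left)
  qed
  have "lincomb UNIV (bidegree_monomials 1) (\<lambda>p. \<Sum>b\<in>Basis. f b * (fst p \<bullet> b) + - f b * (snd p \<bullet> b))"
    by (intro lincomb_sum 1) auto
  then show ?thesis
  proof (rule lincomb_cong)
    fix p :: "'a \<times> 'a"
    have "f (fst p) - f (snd p) = (\<Sum>b\<in>Basis. f b * (fst p \<bullet> b)) - (\<Sum>b\<in>Basis. f b * (snd p \<bullet> b))"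
      by (simp only: f[symmetric])
    then show "f (fst p) - f (snd p) = (\<Sum>b\<in>Basis. f b * (fst p \<bullet> b) + - f b * (snd p \<bullet> b))"
      by (simp add: sum_subtractf)
  qed
qed

lemma lincomb_bidegree_power:
  assumes "lincomb UNIV (bidegree_monomials 1) f"
  shows "lincomb UNIV (bidegree_monomials n) (\<lambda>p. f p ^ n)"
proof (induction n)
  case 0
  then show ?case by (simp add: lincomb_bidegree_one)
next
  case (Suc n)
  from lincomb_bidegree_mult[OF assms Suc] show ?case by simp
qed

lemma lincomb_bidegree_prod:
  assumes "finite I" "\<And>i. i \<in> I \<Longrightarrow> lincomb UNIV (bidegree_monomials (n i)) (f i)"
  shows "lincomb UNIV (bidegree_monomials (sum n I)) (\<lambda>p. \<Prod>i\<in>I. f i p)"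
  using assms
proof (induction rule: finite_induct)
  case empty
  then show ?case by (simp add: lincomb_bidegree_one)
next
  case (insert i I)
  then show ?case using lincomb_bidegree_mult[of "n i" "f i" "sum n I"] by simp
qed

lemma growth_on_pairs:
  assumes S: "\<And>a. a \<in> expo Basis \<Longrightarrow> \<forall>b. a b \<le> N \<Longrightarrow> lincomb X S (monomial a)"
    and f: "lincomb UNIV (bidegree_monomials N) f"
  shows "lincomb (X \<times> X) ((\<lambda>(s, t) p. s (fst p) * t (snd p)) ` (S \<times> S)) f"
proof (rule lincomb_trans[OF lincomb_subset_domain[OF f]])
  fix g :: "'a \<times> 'a \<Rightarrow> real" assume "g \<in> bidegree_monomials N"
  then obtain a a' where g: "g = (\<lambda>p. monomial a (fst p) * monomial a' (snd p))"
    and a: "a \<in> expo Basis" "a' \<in> expo Basis" "sum a Basis \<le> N" "sum a' Basis \<le> N"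
    unfolding bidegree_monomials_def by blast
  have le: "c b \<le> N" if "c \<in> expo Basis" "sum c Basis \<le> N" for c :: "'a \<Rightarrow> nat" and b
  proof (cases "b \<in> Basis")
    case True
    then have "c b \<le> sum c Basis" by (intro member_le_sum) auto
    then show ?thesis using that by simp
  qed (use that in \<open>auto simp: expo_def\<close>)
  show "lincomb (X \<times> X) ((\<lambda>(s, t) p. s (fst p) * t (snd p)) ` (S \<times> S)) g"
    unfolding g
  proof (rule lincomb_times[where S = S and T = S and X = X and Y = X])
    show "lincomb X S (monomial a)" "lincomb X S (monomial a')" using S le a by blast+
    fix s t assume "s \<in> S" "t \<in> S"
    then show "lincomb (X \<times> X) ((\<lambda>(s, t) p. s (fst p) * t (snd p)) ` (S \<times> S)) (\<lambda>z. s (fst z) * t (snd z))"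
      by (intro lincomb_base) force
  qed auto
qed auto

text \<open>If \<open>B\<close> is orthonormal with at least \<open>2 * k + 2\<close> elements, then some form \<open>G\<close> in the coordinates with respect to \<open>B\<close>, nonzero
on the span of \<open>B\<close>, vanishes on all differences of \<open>L ` X\<close>.\<close>

lemma secant_form:
  fixes X :: "'a::euclidean_space set" and L :: "'a \<Rightarrow> 'a"
  assumes growth: "monomial_growth X k K C" "1 \<le> K" and L: "linear L"
    and B: "finite B" "pairwise orthogonal B" "\<And>b. b \<in> B \<Longrightarrow> norm b = 1" "2 * k + 2 \<le> card B"
  shows "\<exists>G N. continuous_on UNIV G \<and> 1 \<le> (N::nat) \<and> (\<forall>t u. G (t *\<^sub>R u) = t ^ N * G u) \<and>
    (\<forall>x\<in>X. \<forall>y\<in>X. G (L x - L y) = 0) \<and> (\<exists>v\<in>span B. G v \<noteq> (0::real))"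
proof -
  define n where "n = card B"
  \<comment> \<open>With \<open>n\<close> variables and degree \<open>N = n * q\<close> there are at least \<open>(q + 1) ^ (n - 1)\<close> monomials; this \<open>q\<close> makes them outnumber the spanning functions.\<close>
  define q where "q = K ^ 2 * (C * n + 1) ^ (2 * k)"
  define N where "N = n * q"
  have n: "2 * k + 2 \<le> n" using B(4) by (simp add: n_def)
  have q: "1 \<le> q" using growth(2) by (simp add: q_def Suc_le_eq)
  have N: "1 \<le> N" using q n by (simp add: N_def Suc_le_eq)
  obtain b0 where b0: "b0 \<in> B" using B(4) by (metis card.empty not_numeral_le_zero add_2_eq_Suc' ex_in_conv le_zero_eq nat.distinct(1))
  \<comment> \<open>All exponents except the one at \<open>b0\<close> are chosen freely up to \<open>q\<close>; the one at \<open>b0\<close> completes the degree to \<open>N\<close>.\<close>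
  define E where "E = PiE (B - {b0}) (\<lambda>b. {..q})"
  define \<alpha> where "\<alpha> \<beta> b = (if b = b0 then N - (\<Sum>b\<in>B - {b0}. \<beta> b) else if b \<in> B then \<beta> b else 0)" for \<beta> :: "'a \<Rightarrow> nat" and b
  have cB: "card (B - {b0}) = n - 1" using b0 B(1) by (simp add: n_def)
  have fE: "finite E" using B(1) by (auto simp: E_def intro!: finite_PiE)
  have cE: "card E = (q + 1) ^ (n - 1)" unfolding E_def using B(1) cB by (simp add: card_PiE)
  have sum\<alpha>: "sum (\<alpha> \<beta>) B = N" if \<beta>: "\<beta> \<in> E" for \<beta>
  proof -
    have "(\<Sum>b\<in>B - {b0}. \<beta> b) \<le> (\<Sum>b\<in>B - {b0}. q)" using \<beta> by (intro sum_mono) (auto simp: E_def PiE_iff)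
    also have "\<dots> \<le> N" using cB by (simp add: N_def)
    finally have le: "(\<Sum>b\<in>B - {b0}. \<beta> b) \<le> N" .
    have "sum (\<alpha> \<beta>) B = \<alpha> \<beta> b0 + (\<Sum>b\<in>B - {b0}. \<alpha> \<beta> b)" using B(1) b0 by (rule sum.remove)
    also have "(\<Sum>b\<in>B - {b0}. \<alpha> \<beta> b) = (\<Sum>b\<in>B - {b0}. \<beta> b)" by (intro sum.cong) (auto simp: \<alpha>_def)
    finally show ?thesis using le by (simp add: \<alpha>_def)
  qed
  have inj\<alpha>: "inj_on \<alpha> E"
  proof (rule inj_onI)
    fix \<beta> \<beta>' assume E: "\<beta> \<in> E" "\<beta>' \<in> E" and eq: "\<alpha> \<beta> = \<alpha> \<beta>'"
    show "\<beta> = \<beta>'"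
    proof
      fix b show "\<beta> b = \<beta>' b"
      proof (cases "b \<in> B - {b0}")
        case True
        then show ?thesis using fun_cong[OF eq, of b] by (simp add: \<alpha>_def)
      next
        case False
        then show ?thesis using E by (simp add: E_def PiE_iff extensional_def)
      qed
    qed
  qed
  define F where "F \<beta> u = (\<Prod>b\<in>B. (u \<bullet> b) ^ \<alpha> \<beta> b)" for \<beta> u
  obtain S where S: "finite S" "card S \<le> K * (C * N + 1) ^ k"
    "\<And>a. a \<in> expo Basis \<Longrightarrow> \<forall>b. a b \<le> N \<Longrightarrow> lincomb X S (monomial a)"
    using growth(1)[unfolded monomial_growth_def, rule_format, of N] by (elim exE conjE) blast
  define SS where "SS = (\<lambda>(s, t) p. s (fst p) * t (snd p)) ` (S \<times> S)"
  have fSS: "finite SS" using S(1) by (simp add: SS_def)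
  have "card SS \<le> card S * card S" unfolding SS_def using card_image_le[of "S \<times> S"] S(1) by (simp add: card_cartesian_product)
  also have "\<dots> \<le> (K * (C * N + 1) ^ k) * (K * (C * N + 1) ^ k)" using S(2) by (intro mult_le_mono)
  also have "\<dots> = K ^ 2 * (C * N + 1) ^ (2 * k)" 
    by (simp only: power2_eq_square[symmetric] power_mult_distrib power_mult[symmetric] mult.commute[of 2 k])
  also have "\<dots> \<le> K ^ 2 * ((C * n + 1) * (q + 1)) ^ (2 * k)"
    by (intro mult_le_mono2 power_mono) (simp_all add: N_def algebra_simps)
  also have "\<dots> = q * (q + 1) ^ (2 * k)" by (simp only: q_def power_mult_distrib mult.assoc)
  also have "\<dots> < (q + 1) * (q + 1) ^ (2 * k)" by simp
  also have "\<dots> \<le> (q + 1) ^ (n - 1)"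
    unfolding power_Suc[symmetric] using n by (intro power_increasing) auto
  finally have card: "card SS < card E" by (simp add: cE)
  have "lincomb (X \<times> X) SS (\<lambda>p. F \<beta> (L (fst p) - L (snd p)))" if \<beta>: "\<beta> \<in> E" for \<beta>
    unfolding SS_def
  proof (rule growth_on_pairs[OF S(3)])
    have lin: "linear (\<lambda>x. L x \<bullet> b)" for b
      using L by (intro linearI) (simp_all add: linear_add linear_cmul inner_left_distrib)
    have "lincomb UNIV (bidegree_monomials (sum (\<alpha> \<beta>) B)) (\<lambda>p. \<Prod>b\<in>B. (L (fst p) \<bullet> b - L (snd p) \<bullet> b) ^ \<alpha> \<beta> b)"
      by (intro lincomb_bidegree_prod B(1) lincomb_bidegree_power lincomb_bidegree_linear lin)
    then show "lincomb UNIV (bidegree_monomials N) (\<lambda>p. F \<beta> (L (fst p) - L (snd p)))"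
      by (simp add: sum\<alpha>[OF \<beta>] F_def inner_diff_left)
  qed auto
  then have "\<exists>c. (\<exists>\<beta>\<in>E. c \<beta> \<noteq> 0) \<and> (\<forall>p\<in>X \<times> X. (\<Sum>\<beta>\<in>E. c \<beta> * F \<beta> (L (fst p) - L (snd p))) = 0)"
    by (rule lincomb_dependent[OF fSS fE card])
  then obtain c where "(\<exists>\<beta>\<in>E. c \<beta> \<noteq> 0) \<and> (\<forall>p\<in>X \<times> X. (\<Sum>\<beta>\<in>E. c \<beta> * F \<beta> (L (fst p) - L (snd p))) = 0)"
    by (elim exE)
  then have c: "\<exists>\<beta>\<in>E. c \<beta> \<noteq> 0" "\<And>p. p \<in> X \<times> X \<Longrightarrow> (\<Sum>\<beta>\<in>E. c \<beta> * F \<beta> (L (fst p) - L (snd p))) = 0"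
    by auto
  define G where "G u = (\<Sum>\<beta>\<in>E. c \<beta> * F \<beta> u)" for u
  have "continuous_on UNIV G" unfolding G_def F_def by (intro continuous_intros)
  moreover have "G (t *\<^sub>R u) = t ^ N * G u" for t u
  proof -
    have "F \<beta> (t *\<^sub>R u) = t ^ N * F \<beta> u" if "\<beta> \<in> E" for \<beta>
      by (simp add: F_def power_mult_distrib prod.distrib power_sum[symmetric] sum\<alpha>[OF that])
    then show ?thesis by (simp add: G_def sum_distrib_left mult_ac)
  qed
  moreover have "G (L x - L y) = 0" if "x \<in> X" "y \<in> X" for x y
    using c(2)[of "(x, y)"] that by (simp add: G_def)
  moreover have "\<exists>v\<in>span B. G v \<noteq> 0"
  proof -
    \<comment> \<open>Substituting \<open>t ^ w b\<close> for the coordinate at \<open>b\<close> turns \<open>G\<close> into a nonzero polynomial in \<open>t\<close>.\<close>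
    obtain w where w: "inj_on (\<lambda>a. \<Sum>b\<in>B. a b * w b) {a \<in> expo B. \<forall>i. a i < N + 1}"
      using separating_weights[OF B(1), of "N + 1"] by auto
    define wt where "wt \<beta> = (\<Sum>b\<in>B. \<alpha> \<beta> b * w b)" for \<beta>
    have inj: "inj_on wt E"
    proof (rule inj_onI)
      fix \<beta> \<beta>' assume E: "\<beta> \<in> E" "\<beta>' \<in> E" and eq: "wt \<beta> = wt \<beta>'"
      have mem: "\<alpha> \<beta> \<in> {a \<in> expo B. \<forall>i. a i < N + 1}" if "\<beta> \<in> E" for \<beta>
      proof -
        have z: "\<alpha> \<beta> i = 0" if "i \<notin> B" for i using that b0 by (auto simp: \<alpha>_def)
        have "\<alpha> \<beta> i \<le> N" if "i \<in> B" for i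
          using member_le_sum[of i B "\<alpha> \<beta>"] that B(1) sum\<alpha>[OF \<open>\<beta> \<in> E\<close>] by simp
        then have "\<alpha> \<beta> i < N + 1" for i using z[of i] by (cases "i \<in> B") (auto simp: less_Suc_eq_le)
        then show ?thesis using z by (simp add: expo_def)
      qed
      have "\<alpha> \<beta> = \<alpha> \<beta>'" using inj_onD[OF w _ mem[OF E(1)] mem[OF E(2)]] eq by (simp add: wt_def)
      then show "\<beta> = \<beta>'" using inj_onD[OF inj\<alpha>] E by blast
    qed
    define p where "p = (\<Sum>\<beta>\<in>E. monom (c \<beta>) (wt \<beta>))"
    obtain \<beta>0 where \<beta>0: "\<beta>0 \<in> E" "c \<beta>0 \<noteq> 0" using c(1) by blast
    have "coeff p (wt \<beta>0) = (\<Sum>\<beta>\<in>E. if wt \<beta> = wt \<beta>0 then c \<beta> else 0)" by (simp add: p_def coeff_sum)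
    also have "\<dots> = (\<Sum>\<beta>\<in>E. if \<beta> = \<beta>0 then c \<beta>0 else 0)"
      using inj_on_eq_iff[OF inj _ \<beta>0(1)] by (intro sum.cong) auto
    also have "\<dots> = c \<beta>0" using fE \<beta>0(1) by simp
    finally have "p \<noteq> 0" using \<beta>0(2) by auto
    then obtain t where t: "poly p t \<noteq> 0" using poly_all_0_iff_0 by blast
    define v where "v = (\<Sum>b\<in>B. t ^ w b *\<^sub>R b)"
    have "v \<bullet> b = t ^ w b" if b: "b \<in> B" for b
    proof -
      have "v \<bullet> b = (\<Sum>i\<in>B. t ^ w i * (i \<bullet> b))" by (simp add: v_def inner_sum_left)
      also have "\<dots> = (\<Sum>i\<in>B. if i = b then t ^ w b else 0)"
      proof (intro sum.cong refl)
        fix i assume "i \<in> B"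
        then show "t ^ w i * (i \<bullet> b) = (if i = b then t ^ w b else 0)"
          using B(2,3) b by (auto simp: pairwise_def orthogonal_def dot_square_norm)
      qed
      finally show ?thesis using B(1) b by simp
    qed
    then have "F \<beta> v = t ^ wt \<beta>" for \<beta>
      by (simp add: F_def wt_def power_sum power_mult[symmetric] mult.commute)
    then have "G v = poly p t" by (simp add: G_def p_def poly_sum poly_monom)
    moreover have "v \<in> span B" unfolding v_def by (intro span_sum span_mul span_base)
    ultimately show ?thesis using t by (intro bexI[of _ v]) simp_all
  qed
  ultimately show ?thesis using N by (intro exI[of _ G] exI[of _ N]) auto
qed

section \<open>Projecting along a non-secant direction\<close>

text \<open>The orthogonal projection along \<open>v\<close> is bounded below on the zero cone of \<open>G\<close>, which contains all differences but not \<open>v\<close>.\<close>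

lemma secant_projection:
  fixes L :: "'a::euclidean_space \<Rightarrow> 'a"
  assumes L: "linear L" and G: "continuous_on UNIV G" "1 \<le> (N::nat)" "\<And>t u. G (t *\<^sub>R u) = t ^ N * (G u :: real)"
    and 0: "\<And>x y. x \<in> X \<Longrightarrow> y \<in> X \<Longrightarrow> G (L x - L y) = 0"
    and v: "v \<in> range L" "G v \<noteq> 0"
  shows "\<exists>(P :: 'a \<Rightarrow> 'a) c. linear P \<and> 0 < c \<and> dim (range (P \<circ> L)) < dim (range L) \<and>
    (\<forall>x\<in>X. \<forall>y\<in>X. c * norm (L x - L y) \<le> norm (P (L x) - P (L y)))"
proof -
  have "G 0 = 0" using G(3)[of 0 v] G(2) by simp
  then have v0: "v \<noteq> 0" using v(2) by auto
  define P where "P u = u - ((u \<bullet> v) / (v \<bullet> v)) *\<^sub>R v" for u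
  have P: "linear P" unfolding P_def by (intro linearI) (simp_all add: algebra_simps add_divide_distrib)
  have orth: "P u \<bullet> v = 0" for u using v0 by (simp add: P_def inner_diff_left)
  have nz: "P u \<noteq> 0" if "G u = 0" "u \<noteq> 0" for u
  proof
    assume "P u = 0"
    then have u: "u = ((u \<bullet> v) / (v \<bullet> v)) *\<^sub>R v" by (simp add: P_def)
    then have "((u \<bullet> v) / (v \<bullet> v)) \<noteq> 0" using that(2) by auto
    moreover have "G u = ((u \<bullet> v) / (v \<bullet> v)) ^ N * G v" by (subst u) (rule G(3))
    ultimately show False using that(1) v(2) by simp
  qed
  have contP: "continuous_on A (\<lambda>u. norm (P u))" for A
    using P by (intro continuous_on_norm) (simp add: linear_continuous_on linear_conv_bounded_linear)
  define Z where "Z = {u. G u = 0} \<inter> sphere 0 1"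
  have cZ: "compact Z" unfolding Z_def by (intro closed_Int_compact closed_Collect_eq G(1) continuous_on_const compact_sphere)
  have "\<exists>c>0. \<forall>u\<in>Z. c \<le> norm (P u)"
  proof (cases "Z = {}")
    case True
    then show ?thesis by (intro exI[of _ 1]) simp
  next
    case False
    obtain u0 where u0: "u0 \<in> Z" "\<And>u. u \<in> Z \<Longrightarrow> norm (P u0) \<le> norm (P u)"
      using continuous_attains_inf[OF cZ False contP] by blast
    have "u0 \<noteq> 0" "G u0 = 0" using u0(1) by (auto simp: Z_def)
    then have "norm (P u0) > 0" using nz by simp
    then show ?thesis using u0(2) by blast
  qed
  then obtain c where c: "c > 0" "\<And>u. u \<in> Z \<Longrightarrow> c \<le> norm (P u)" by blast
  have le: "c * norm u \<le> norm (P u)" if "G u = 0" for u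
  proof (cases "u = 0")
    case True
    then show ?thesis by simp
  next
    case False
    have "(1 / norm u) *\<^sub>R u \<in> Z" using that False G(3) by (simp add: Z_def)
    then have "c \<le> norm (P ((1 / norm u) *\<^sub>R u))" by (rule c(2))
    also have "\<dots> = norm (P u) / norm u" using P False by (simp add: linear_cmul)
    finally show ?thesis using False by (simp add: field_simps)
  qed
  have sub: "range (P \<circ> L) \<subset> range L"
  proof
    show "range (P \<circ> L) \<subseteq> range L"
    proof
      fix y assume "y \<in> range (P \<circ> L)"
      then obtain x where "y = P (L x)" by auto
      moreover obtain z where "v = L z" using v(1) by auto
      ultimately have "y = L (x - ((L x \<bullet> v) / (v \<bullet> v)) *\<^sub>R z)"
        using L by (simp add: P_def linear_diff linear_cmul)
      then show "y \<in> range L" by simp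
    qed
    have "v \<notin> range (P \<circ> L)"
    proof
      assume "v \<in> range (P \<circ> L)"
      then obtain x where "v = P (L x)" by auto
      then have "v \<bullet> v = 0" using orth[of "L x"] by simp
      then show False using v0 by simp
    qed
    then show "range (P \<circ> L) \<noteq> range L" using v(1) by blast
  qed
  have "subspace (range L)" "subspace (range (P \<circ> L))"
    using linear_subspace_image[OF L subspace_UNIV] linear_subspace_image[OF linear_compose[OF L P] subspace_UNIV] .
  then have "dim (range (P \<circ> L)) < dim (range L)" using sub by (intro dim_psubset) (simp add: span_eq_iff[THEN iffD2])
  moreover have "c * norm (L x - L y) \<le> norm (P (L x) - P (L y))" if "x \<in> X" "y \<in> X" for x y
    using le[OF 0[OF that]] P by (simp add: linear_diff)
  ultimately show ?thesis using P c(1) by (intro exI[of _ P] exI[of _ c]) simp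
qed

text \<open>Among the linear maps that are bounded below on the differences of \<open>X\<close>, one with image of least dimension has an image of
dimension at most \<open>2 * k + 1\<close>, which embeds isometrically into the target.\<close>

lemma linear_bilipschitz_projection:
  fixes X :: "'a::euclidean_space set"
  assumes X: "closed X" "semialgebraic X" "semialgebraic_dim X \<le> ereal (real k)" and "2 * k + 1 \<le> DIM('b::euclidean_space)"
  shows "\<exists>(f :: 'a \<Rightarrow> 'b) c. linear f \<and> 0 < c \<and> (\<forall>x\<in>X. \<forall>y\<in>X. c * norm (x - y) \<le> norm (f x - f y))"
proof -
  define adm where "adm L \<longleftrightarrow> linear L \<and> (\<exists>c>0. \<forall>x\<in>X. \<forall>y\<in>X. c * norm (x - y) \<le> norm (L x - L y))" for L :: "'a \<Rightarrow> 'a"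
  have "adm (\<lambda>x. x)" unfolding adm_def by (auto intro!: exI[of _ 1] linear_ident)
  then obtain L where L: "adm L" and min: "\<And>L'. adm L' \<Longrightarrow> dim (range L) \<le> dim (range L')"
    using ex_has_least_nat[of adm "\<lambda>x. x" "\<lambda>L. dim (range L)"] by blast
  have lin: "linear L" using L by (simp add: adm_def)
  obtain c where c: "c > 0" "\<And>x y. x \<in> X \<Longrightarrow> y \<in> X \<Longrightarrow> c * norm (x - y) \<le> norm (L x - L y)"
    using L by (auto simp: adm_def)
  have sub: "subspace (range L)" using lin by (simp add: linear_subspace_image)
  have "dim (range L) \<le> 2 * k + 1"
  proof (rule ccontr)
    assume "\<not> dim (range L) \<le> 2 * k + 1"
    then have d: "2 * k + 2 \<le> dim (range L)" by simp
    obtain K C where KC: "1 \<le> K" "monomial_growth X k K C" using monomial_growth_exists[OF X] by blast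
    obtain B where B: "B \<subseteq> range L" "pairwise orthogonal B" "\<And>b. b \<in> B \<Longrightarrow> norm b = 1"
      "independent B" "card B = dim (range L)" "span B = range L"
      using orthonormal_basis_subspace[OF sub] by blast
    have fB: "finite B" using B(4) by (rule independent_imp_finite)
    have "\<exists>G N. continuous_on UNIV G \<and> 1 \<le> (N::nat) \<and> (\<forall>t u. G (t *\<^sub>R u) = t ^ N * G u) \<and>
        (\<forall>x\<in>X. \<forall>y\<in>X. G (L x - L y) = 0) \<and> (\<exists>v\<in>span B. G v \<noteq> (0::real))"
      using d B(5) by (intro secant_form[OF KC(2,1) lin fB B(2,3)]) simp_all
    then obtain G N where G: "continuous_on UNIV G" "1 \<le> (N::nat)" "\<And>t u. G (t *\<^sub>R u) = t ^ N * G u"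
      "\<And>x y. x \<in> X \<Longrightarrow> y \<in> X \<Longrightarrow> G (L x - L y) = 0" "\<exists>v\<in>span B. G v \<noteq> (0::real)"
      by (elim exE conjE) blast
    obtain v where v: "v \<in> range L" "G v \<noteq> 0" using G(5) B(6) by blast
    have "\<exists>(P :: 'a \<Rightarrow> 'a) c. linear P \<and> 0 < c \<and> dim (range (P \<circ> L)) < dim (range L) \<and>
        (\<forall>x\<in>X. \<forall>y\<in>X. c * norm (L x - L y) \<le> norm (P (L x) - P (L y)))"
      by (rule secant_projection[OF lin G(1-4) v])
    then obtain P :: "'a \<Rightarrow> 'a" and c' where P: "linear P" "0 < c'" "dim (range (P \<circ> L)) < dim (range L)"
      "\<And>x y. x \<in> X \<Longrightarrow> y \<in> X \<Longrightarrow> c' * norm (L x - L y) \<le> norm (P (L x) - P (L y))"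
      by (elim exE conjE) blast
    have "(c' * c) * norm (x - y) \<le> norm ((P \<circ> L) x - (P \<circ> L) y)" if "x \<in> X" "y \<in> X" for x y
    proof -
      have "c' * (c * norm (x - y)) \<le> c' * norm (L x - L y)" using c(2)[OF that] P(2) by (intro mult_left_mono) auto
      then show ?thesis using P(4)[OF that] by (simp add: mult.assoc)
    qed
    moreover have "0 < c' * c" using c(1) P(2) by simp
    ultimately have "adm (P \<circ> L)" unfolding adm_def using linear_compose[OF lin P(1)] by (intro conjI exI[of _ "c' * c"]) auto
    then have "dim (range L) \<le> dim (range (P \<circ> L))" by (rule min)
    then show False using P(3) by simp
  qed
  then have "dim (range L) \<le> dim (UNIV :: 'b set)" using assms(4) by simp
  then obtain f :: "'a \<Rightarrow> 'b" where f: "linear f" "f \<in> range L \<rightarrow> UNIV" "\<And>x. x \<in> range L \<Longrightarrow> norm (f x) = norm x"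
    by (rule isometry_subset_subspace[OF sub subspace_UNIV]) (rule that, assumption+)
  show ?thesis
  proof (intro exI[of _ "f \<circ> L"] exI[of _ c] conjI ballI)
    show "linear (f \<circ> L)" using linear_compose[OF lin f(1)] .
    fix x y assume "x \<in> X" "y \<in> X"
    have "(f \<circ> L) x - (f \<circ> L) y = f (L (x - y))" using lin f(1) by (simp add: linear_diff)
    moreover have "norm (f (L (x - y))) = norm (L (x - y))" by (rule f(3)) simp
    ultimately have "norm ((f \<circ> L) x - (f \<circ> L) y) = norm (L x - L y)" by (simp only: linear_diff[OF lin])
    then show "c * norm (x - y) \<le> norm ((f \<circ> L) x - (f \<circ> L) y)" using c(2)[OF \<open>x \<in> X\<close> \<open>y \<in> X\<close>] by simp
  qed (rule c(1))
qed

section \<open>Linear maps as semialgebraic embeddings\<close>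

lemma polynomial_function_linear: "linear (f :: 'a::euclidean_space \<Rightarrow> 'b::euclidean_space) \<Longrightarrow> polynomial_function f"
  by (intro polynomial_function_bounded_linear) (simp add: linear_conv_bounded_linear)

lemma semialgebraic_linear_graph:
  fixes f :: "'a::euclidean_space \<Rightarrow> 'b::euclidean_space"
  assumes "linear f" "semialgebraic X"
  shows "semialgebraic {(x, f x) |x. x \<in> X}"
proof -
  have bl: "bounded_linear f" using assms(1) by (simp add: linear_conv_bounded_linear)
  have 1: "semialgebraic (fst -` X :: ('a \<times> 'b) set)"
    using assms(2) by (intro semialgebraic_vimage polynomial_function_bounded_linear bounded_linear_fst)
  define p where "p z = (\<Sum>b\<in>Basis. ((snd z - f (fst z)) \<bullet> b)^2)" for z :: "'a \<times> 'b"
  have "bounded_linear (\<lambda>z::'a \<times> 'b. (snd z - f (fst z)) \<bullet> b)" for b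
    by (intro bounded_linear_intros bounded_linear_compose[OF bl])
  then have "real_polynomial_function p" unfolding p_def
    by (intro real_polynomial_function_sum real_polynomial_function_power real_polynomial_function.intros(1)) auto
  then have 2: "semialgebraic {z. p z = 0}" by (rule semialgebraic_zero_set)
  have p0: "p z = 0 \<longleftrightarrow> snd z = f (fst z)" for z
  proof -
    have "p z = 0 \<longleftrightarrow> (\<forall>b\<in>Basis. (snd z - f (fst z)) \<bullet> b = 0)" unfolding p_def by (subst sum_nonneg_eq_0_iff) auto
    also have "\<dots> \<longleftrightarrow> snd z = f (fst z)" by (simp add: inner_diff_left euclidean_eq_iff[of "snd z"])
    finally show ?thesis .
  qed
  have "{(x, f x) |x. x \<in> X} = fst -` X \<inter> {z. p z = 0}" unfolding p0 by force
  then show ?thesis using semialgebraic.inter[OF 1 2] by simp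
qed

text \<open>The image is cut out at \<open>x = 0\<close> from the cylinder obtained by eliminating all coordinates of the first factor.\<close>

lemma semialgebraic_snd_image:
  fixes S :: "('a::euclidean_space \<times> 'b::euclidean_space) set"
  assumes "semialgebraic S"
  shows "semialgebraic (snd ` S)"
proof -
  define B where "B = (\<lambda>b. (b, 0::'b)) ` (Basis :: 'a set)"
  have "span B = {z. \<forall>i\<in>Basis. i \<notin> B \<longrightarrow> z \<bullet> i = 0}"
    by (rule span_substd_basis) (auto simp: B_def Basis_prod_def)
  also have "\<dots> = {z. snd z = 0}"
  proof -
    have "(\<forall>i\<in>Basis. i \<notin> B \<longrightarrow> z \<bullet> i = 0) \<longleftrightarrow> (\<forall>b\<in>Basis. snd z \<bullet> b = 0)" for z :: "'a \<times> 'b"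
    proof
      assume h: "\<forall>i\<in>Basis. i \<notin> B \<longrightarrow> z \<bullet> i = 0"
      show "\<forall>b\<in>Basis. snd z \<bullet> b = 0"
      proof
        fix b :: 'b assume b: "b \<in> Basis"
        then have "(0, b) \<in> (Basis :: ('a \<times> 'b) set)" "(0, b) \<notin> B" by (auto simp: B_def Basis_prod_def)
        then have "z \<bullet> (0, b) = 0" using h by blast
        then show "snd z \<bullet> b = 0" by (simp add: inner_prod_def)
      qed
    next
      assume h: "\<forall>b\<in>Basis. snd z \<bullet> b = 0"
      show "\<forall>i\<in>Basis. i \<notin> B \<longrightarrow> z \<bullet> i = 0"
      proof (intro ballI impI)
        fix i :: "'a \<times> 'b" assume "i \<in> Basis" "i \<notin> B"
        then obtain b where "i = (0, b)" "b \<in> Basis" by (auto simp: B_def Basis_prod_def)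
        then show "z \<bullet> i = 0" using h by (simp add: inner_prod_def)
      qed
    qed
    then show ?thesis by (simp add: euclidean_all_zero_iff)
  qed
  finally have B: "span B = {z. snd z = 0}" .
  have "semialgebraic {z. \<exists>w\<in>span B. z + w \<in> S}" by (intro semialgebraic_plus_span assms) (simp add: B_def)
  moreover have "polynomial_function (\<lambda>y. (0::'a, y::'b))"
    by (intro polynomial_function_linear linearI) auto
  ultimately have "semialgebraic ((\<lambda>y. (0::'a, y::'b)) -` {z. \<exists>w\<in>span B. z + w \<in> S})" by (rule semialgebraic_vimage)
  also have "(\<lambda>y. (0::'a, y::'b)) -` {z. \<exists>w\<in>span B. z + w \<in> S} = snd ` S"
  proof (rule Set.set_eqI, rule iffI)
    fix y assume "y \<in> (\<lambda>y. (0::'a, y)) -` {z. \<exists>w\<in>span B. z + w \<in> S}"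
    then obtain w where "snd w = 0" "(0, y) + w \<in> S" unfolding B by auto
    then show "y \<in> snd ` S" by (intro image_eqI[of _ _ "(0, y) + w"]) auto
  next
    fix y assume "y \<in> snd ` S"
    then obtain x where "(x, y) \<in> S" by force
    then show "y \<in> (\<lambda>y. (0::'a, y)) -` {z. \<exists>w\<in>span B. z + w \<in> S}" unfolding B
      by (auto intro!: exI[of _ "(x, 0)"])
  qed
  finally show ?thesis .
qed

lemma linear_embedding:
  fixes X :: "'a::euclidean_space set" and f :: "'a \<Rightarrow> 'b::euclidean_space"
  assumes X: "closed X" "semialgebraic X" and f: "linear f"
    and c: "0 < c" "\<And>x y. x \<in> X \<Longrightarrow> y \<in> X \<Longrightarrow> c * norm (x - y) \<le> norm (f x - f y)"
  shows "semialgebraic_embedding_on X f"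
proof -
  have bl: "bounded_linear f" using f by (simp add: linear_conv_bounded_linear)
  have inj: "inj_on f X"
  proof (rule inj_onI)
    fix x y assume "x \<in> X" "y \<in> X" "f x = f y"
    then have "c * norm (x - y) \<le> 0" using c(2)[of x y] by simp
    then show "x = y" using c(1) by (simp add: mult_le_0_iff)
  qed
  have "closed (f ` X)"
    unfolding closed_sequential_limits
  proof (intro allI impI, elim conjE)
    fix y l assume y: "\<forall>n. y n \<in> f ` X" and l: "y \<longlonglongrightarrow> l"
    have "\<forall>n. \<exists>x. x \<in> X \<and> y n = f x" using y by blast
    then obtain x where x: "\<And>n. x n \<in> X" "\<And>n. y n = f (x n)" by metis
    \<comment> \<open>The lower bound makes preimages of convergent sequences Cauchy.\<close>
    have "Cauchy x"
    proof (rule CauchyI)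
      fix e :: real assume e: "0 < e"
      have "Cauchy y" using l by (rule LIMSEQ_imp_Cauchy)
      then obtain M where M: "\<And>m n. M \<le> m \<Longrightarrow> M \<le> n \<Longrightarrow> norm (y m - y n) < c * e"
        using CauchyD[of y "c * e"] e c(1) by auto
      have "norm (x m - x n) < e" if "M \<le> m" "M \<le> n" for m n
      proof -
        have "c * norm (x m - x n) < c * e" using c(2)[OF x(1) x(1), of m n] M[OF that] x(2) by simp
        then show ?thesis using c(1) by simp
      qed
      then show "\<exists>M. \<forall>m\<ge>M. \<forall>n\<ge>M. norm (x m - x n) < e" by blast
    qed
    then obtain a where a: "x \<longlonglongrightarrow> a" using Cauchy_convergent convergent_def by blast
    have "a \<in> X" using X(1) x(1) a by (rule closed_sequentially)
    moreover have "y \<longlonglongrightarrow> f a" unfolding x(2) using bounded_linear.tendsto[OF bl a] .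
    then have "l = f a" using l LIMSEQ_unique by blast
    ultimately show "l \<in> f ` X" by blast
  qed
  moreover have "\<exists>L. L-lipschitz_on X f"
    using bounded_linear.lipschitz_boundE[OF bl] by metis
  moreover have "(1 / c)-lipschitz_on (f ` X) (inv_into X f)"
  proof (rule lipschitz_onI)
    fix u v assume "u \<in> f ` X" "v \<in> f ` X"
    then obtain x y where xy: "x \<in> X" "u = f x" "y \<in> X" "v = f y" by blast
    then show "dist (inv_into X f u) (inv_into X f v) \<le> 1 / c * dist u v"
      using c(2)[OF xy(1,3)] c(1) inj by (simp add: dist_norm field_simps)
  qed (use c(1) in simp)
  ultimately have 1: "bilipschitz_embedding_on X f"
    unfolding bilipschitz_embedding_on_def using inj by (auto simp: bij_betw_def)
  have graph: "semialgebraic {(x, f x) |x. x \<in> X}" by (rule semialgebraic_linear_graph[OF f X(2)])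
  have "snd ` {(x, f x) |x. x \<in> X} = f ` X" by force
  then have 2: "semialgebraic (f ` X)" using semialgebraic_snd_image[OF graph] by simp
  have "polynomial_function (\<lambda>z::'b \<times> 'a. (snd z, fst z))"
    by (intro polynomial_function_linear linearI) auto
  from semialgebraic_vimage[OF graph this]
  have "semialgebraic ((\<lambda>z. (snd z, fst z)) -` {(x, f x) |x. x \<in> X})" .
  also have "(\<lambda>z. (snd z, fst z)) -` {(x, f x) |x. x \<in> X} = {(y, inv_into X f y) |y. y \<in> f ` X}"
    using inj by force
  finally have 3: "semialgebraic_map_on (f ` X) (inv_into X f)" by (simp add: semialgebraic_map_on_def)
  show ?thesis
    unfolding semialgebraic_embedding_on_def
    using 1 X(2) 2 graph 3 by (simp add: semialgebraic_map_on_def)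
qed

theorem theorem3p3:
  fixes X :: "(real ^ 'm) set" and k :: nat
  assumes "closed X" and "semialgebraic X" and "semialgebraic_dim X = ereal (real k)"
    and "CARD('n) = 2 * k + 1"
  shows "\<exists>f :: real ^ 'm \<Rightarrow> real ^ 'n::finite.
    bilipschitz_embedding_on X f \<and> semialgebraic_embedding_on X f"
proof -
  obtain f :: "real ^ 'm \<Rightarrow> real ^ 'n" and c where f: "linear f" "0 < c"
    "\<And>x y. x \<in> X \<Longrightarrow> y \<in> X \<Longrightarrow> c * norm (x - y) \<le> norm (f x - f y)"
    using linear_bilipschitz_projection[of X k, where 'b = "real ^ 'n"] assms by auto
  have "semialgebraic_embedding_on X f" by (rule linear_embedding[OF assms(1,2) f])
  then show ?thesis unfolding semialgebraic_embedding_on_def by blast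
qed

end
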